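(* Let $N \geq 3$, $p \in (1,N)$, $p^*=\frac{Np}{N-p}$ and $r \in (p,p^*]$. If $g \in \mathcal{H}_{p,r}(\mathbb{R}^N) \cap \mathcal{F}_{p,p}(\mathbb{R}^N)$ and $\gamma > \frac{r}{r-p}$, then $C_B(g,\gamma)$ is attained in $\mathcal{D}^{1,p}_0(\mathbb{R}^N)$; that is, there exists $u \in \mathcal{D}^{1,p}_0(\mathbb{R}^N)$ with $\int_{\mathbb{R}^N} |g||u|^p\,dx=1$ and $$\frac{\int_{\mathbb{R}^N} |\nabla u|^p\,dx}{\exp\left(\frac{1}{\gamma} \int_{\mathbb{R}^N} |g||u|^p \log |u|^p\,dx \right)} = \frac{1}{C_B(g,\gamma)}.$$
   Context: $\mathcal{D}^{1,p}_0(\mathbb{R}^N)$ is the Beppo-Levi space: the completion of $C_c^\infty(\mathbb{R}^N)$ with respect to the norm $\left[\int_{\mathbb{R}^N} |\nabla u|^p\,dx\right]^{1/p}$. For $F \subset\subset \mathbb{R}^N$, the $p$-capacity of $F$ with respect to $\mathbb{R}^N$ is $\mathrm{Cap}_p(F)=\inf\left\{\int_{\mathbb{R}^N} |\nabla u|^p\,dx : u \in \mathcal{D}^{1,p}_0(\mathbb{R}^N),\ u \geq 1 \text{ on } F\right\}$. For $1<p\le r\le p^*$, $$\|g\|_{p,r} = \sup_{F \subset\subset \mathbb{R}^N} \frac{\int_F |g|\,dx}{[\mathrm{Cap}_p(F)]^{r/p}}, \qquad \mathcal{H}_{p,r}(\mathbb{R}^N)=\left\{g \in L^1_{loc}(\mathbb{R}^N):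 \|g\|_{p,r}<\infty\right\},$$ and $\mathcal{F}_{p,r}(\mathbb{R}^N)$ is the closure of $C_c^\infty(\mathbb{R}^N)$ in $\mathcal{H}_{p,r}(\mathbb{R}^N)$ with respect to $\|\cdot\|_{p,r}$; in particular $\mathcal{F}_{p,p}(\mathbb{R}^N)$ is the case $r=p$. $C_B(g,\gamma)$ is the best constant in the weighted logarithmic Sobolev inequality with weight $g$ and parameter $\gamma$, given by $$\frac{1}{C_B(g,\gamma)} = \inf \left\{\frac{\int_{\mathbb{R}^N} |\nabla u|^p\,dx}{\exp\left(\frac{1}{\gamma} \int_{\mathbb{R}^N} |g||u|^p \log |u|^p\,dx \right)} : u \in \mathcal{D}^{1,p}_0(\mathbb{R}^N),\ \int_{\mathbb{R}^N} |g||u|^p\,dx =1 \right\}.$$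
   Formalization: The weight g is additionally assumed not to vanish almost everywhere; for g = 0 no u satisfies the constraint ∫|g||u|^p dx = 1, so the infimum is over the empty set and the claim fails. *)

theory Defs
  imports "HOL-Analysis.Analysis"
begin

section \<open>Test functions\<close>

definition partial :: "'a::euclidean_space \<Rightarrow> ('a \<Rightarrow> real) \<Rightarrow> 'a \<Rightarrow> real" where
  "partial i f x = frechet_derivative f (at x) i"

primrec Ck :: "nat \<Rightarrow> ('a::euclidean_space \<Rightarrow> real) \<Rightarrow> bool" where
  "Ck 0 f \<longleftrightarrow> continuous_on UNIV f"
| "Ck (Suc k) f \<longleftrightarrow> f differentiable_on UNIV \<and> (\<forall>i\<in>Basis. Ck k (partial i f))"

definition test_fun :: "('a::euclidean_space \<Rightarrow> real) \<Rightarrow> bool" where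
  "test_fun \<phi> \<longleftrightarrow> (\<forall>k. Ck k \<phi>) \<and> compact (closure {x. \<phi> x \<noteq> 0})"

definition grad :: "('a::euclidean_space \<Rightarrow> real) \<Rightarrow> 'a \<Rightarrow> 'a" where
  "grad f x = (\<Sum>i\<in>Basis. partial i f x *\<^sub>R i)"

section \<open>Locally integrable functions and weak gradients\<close>

definition L1loc :: "('a::euclidean_space \<Rightarrow> 'b::euclidean_space) \<Rightarrow> bool" where
  "L1loc f \<longleftrightarrow> f \<in> borel_measurable lebesgue \<and>
     (\<forall>K. compact K \<longrightarrow> set_integrable lebesgue K f)"

definition has_weak_grad :: "('a::euclidean_space \<Rightarrow> real) \<Rightarrow> ('a \<Rightarrow> 'a) \<Rightarrow> bool" where
  "has_weak_grad u V \<longleftrightarrow> L1loc u \<and> L1loc V \<and>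
     (\<forall>\<phi>. test_fun \<phi> \<longrightarrow> (\<forall>i\<in>Basis.
        (LINT x|lebesgue. u x * partial i \<phi> x) = - (LINT x|lebesgue. (V x \<bullet> i) * \<phi> x)))"

text \<open>A weak gradient is unique only up to a null set; some representative is chosen.\<close>

definition weak_grad :: "('a::euclidean_space \<Rightarrow> real) \<Rightarrow> 'a \<Rightarrow> 'a" where
  "weak_grad u = (SOME V. has_weak_grad u V)"

section \<open>The Beppo-Levi space\<close>

definition grad_norm :: "real \<Rightarrow> ('a::euclidean_space \<Rightarrow> real) \<Rightarrow> real" where
  "grad_norm p \<phi> = (LINT x|lebesgue. norm (grad \<phi> x) powr p) powr (1 / p)"

text \<open>The completion of the test functions under \<open>grad_norm p\<close>, for \<open>1 < p < N\<close>, realised as a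
  space of functions: by the Sobolev inequality, a Cauchy sequence of test functions converges
  in \<open>L\<^sup>1\<close> on compact sets, its limit determines its class in the completion, and its gradients
  converge in \<open>L\<^sup>p\<close> to the weak gradient of that limit. Elements are representatives:
  the set is closed under changes on null sets.\<close>

definition beppo_levi :: "real \<Rightarrow> ('a::euclidean_space \<Rightarrow> real) set" where
  "beppo_levi p = {u. L1loc u \<and> (\<exists>\<phi> :: nat \<Rightarrow> 'a \<Rightarrow> real.
      (\<forall>k. test_fun (\<phi> k)) \<and>
      (\<forall>e>0. \<exists>M. \<forall>m\<ge>M. \<forall>n\<ge>M. grad_norm p (\<lambda>x. \<phi> m x - \<phi> n x) < e) \<and>
      (\<forall>K. compact K \<longrightarrow> (\<lambda>k. LINT x:K|lebesgue. \<bar>\<phi> k x - u x\<bar>) \<longlonglongrightarrow> 0))}"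

definition energy :: "real \<Rightarrow> ('a::euclidean_space \<Rightarrow> real) \<Rightarrow> real" where
  "energy p u = (LINT x|lebesgue. norm (weak_grad u x) powr p)"

section \<open>Capacity and the weight spaces\<close>

text \<open>Used for relatively compact \<open>F\<close> only, for which the infimum is over a nonempty set.
  As \<open>u\<close> is a class of functions, the condition on \<open>F\<close> is read almost everywhere.\<close>

definition Cap :: "real \<Rightarrow> 'a::euclidean_space set \<Rightarrow> real" where
  "Cap p F = Inf {energy p u | u. u \<in> beppo_levi p \<and> (AE x in lebesgue. x \<in> F \<longrightarrow> u x \<ge> 1)}"

text \<open>In \<open>ennreal\<close>, \<open>a / 0\<close> is infinite for \<open>a > 0\<close>, and \<open>0 / 0 = 0\<close>, so null sets \<open>F\<close> do not
  contribute to the supremum.\<close>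

definition weight_norm :: "real \<Rightarrow> real \<Rightarrow> ('a::euclidean_space \<Rightarrow> real) \<Rightarrow> ennreal" where
  "weight_norm p r g =
     (SUP F\<in>{F. F \<in> sets lebesgue \<and> compact (closure F)}.
        (\<integral>\<^sup>+x\<in>F. ennreal \<bar>g x\<bar> \<partial>lebesgue) / ennreal (Cap p F powr (r / p)))"

definition H_space :: "real \<Rightarrow> real \<Rightarrow> ('a::euclidean_space \<Rightarrow> real) set" where
  "H_space p r = {g. L1loc g \<and> weight_norm p r g < \<infinity>}"

definition F_space :: "real \<Rightarrow> real \<Rightarrow> ('a::euclidean_space \<Rightarrow> real) set" where
  "F_space p r = {g \<in> H_space p r.
     \<forall>e>0. \<exists>\<phi>. test_fun \<phi> \<and> weight_norm p r (\<lambda>x. g x - \<phi> x) < ennreal e}"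

section \<open>The best constant\<close>

text \<open>The logarithmic integral can be \<open>-\<infinity>\<close> for admissible \<open>u\<close> (then the quotient below is \<open>\<infinity>\<close>),
  so it is not a Bochner integral, which would be \<open>0\<close> in that case.\<close>

definition log_integral :: "real \<Rightarrow> ('a::euclidean_space \<Rightarrow> real) \<Rightarrow> ('a \<Rightarrow> real) \<Rightarrow> ereal" where
  "log_integral p g u =
     enn2ereal (\<integral>\<^sup>+x. ennreal (\<bar>g x\<bar> * \<bar>u x\<bar> powr p * ln (\<bar>u x\<bar> powr p)) \<partial>lebesgue)
   - enn2ereal (\<integral>\<^sup>+x. ennreal (- (\<bar>g x\<bar> * \<bar>u x\<bar> powr p * ln (\<bar>u x\<bar> powr p))) \<partial>lebesgue)"

fun exp_ereal :: "ereal \<Rightarrow> ennreal" where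
  "exp_ereal (ereal t) = ennreal (exp t)"
| "exp_ereal PInfty = \<infinity>"
| "exp_ereal MInfty = 0"

definition log_quotient ::
    "real \<Rightarrow> ('a::euclidean_space \<Rightarrow> real) \<Rightarrow> real \<Rightarrow> ('a \<Rightarrow> real) \<Rightarrow> ennreal" where
  "log_quotient p g \<gamma> u =
     ennreal (energy p u) / exp_ereal (ereal (1 / \<gamma>) * log_integral p g u)"

definition C_B :: "real \<Rightarrow> ('a::euclidean_space \<Rightarrow> real) \<Rightarrow> real \<Rightarrow> ennreal" where
  "C_B p g \<gamma> = 1 / (INF u\<in>{u \<in> beppo_levi p. (LINT x|lebesgue. \<bar>g x\<bar> * \<bar>u x\<bar> powr p) = 1}.
     log_quotient p g \<gamma> u)"

end

theory Submission
  imports Defs "HOL-Library.Diagonal_Subsequence"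
begin

text \<open>
  The quotient is minimised directly. Write \<open>E\<close> for the energy and \<open>L\<close> for the logarithmic
  integral, and call \<open>u\<close> admissible if it lies in the Beppo-Levi space and
  \<open>\<integral> |g| |u|^p = 1\<close>. Three facts are needed.

  \<^emph>\<open>Coercivity.\<close> A multiple of \<open>u\<close> competes for the capacity of a superlevel set of \<open>u\<close>, so that
  \<open>Cap {u \<ge> t} \<le> t^(-p) E\<close>, and finiteness of the \<open>(p,r)\<close> norm of \<open>g\<close> makes the \<open>|g|\<close>-mass
  of \<open>{|u| \<ge> t}\<close> at most \<open>C t^(-r) E^(r/p)\<close>. Since \<open>r > p\<close>, the contribution to \<open>L\<close>
  of \<open>{|u| > T}\<close> exceeds \<open>p ln T\<close> times its mass by at most \<open>C T^(p-r) E^(r/p)\<close>; the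
  rest of the unit mass contributes at most \<open>p ln T\<close> per unit. The choice \<open>T^(r-p) = E^(r/p)\<close>
  gives \<open>L \<le> r/(r-p) ln E + C\<close> (lemma \<open>log_upper_bound\<close>). As \<open>\<gamma> > r/(r-p)\<close>, the quotient
  \<open>E / exp (L/\<gamma>)\<close> dominates a positive power of \<open>E\<close>, and minimising sequences have bounded energy.

  \<^emph>\<open>Compactness.\<close> A sequence of bounded energy has a subsequence that converges almost everywhere
  to an element of the space whose energy is at most the limit of the energies (lemma \<open>beppo_levi_compact\<close>).
  Hardy's inequality bounds the local \<open>L\<^sup>1\<close> norms, an estimate for translates then gives local
  compactness in \<open>L\<^sup>1\<close>, and weak compactness is replaced by uniform convexity: midpoint averages of
  the tails with almost least energy form a Cauchy sequence for the energy and have the same limit.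

  \<^emph>\<open>Passage to the limit.\<close> The constraint survives because \<open>g\<close> is close to a test function \<open>\<psi>\<close> in
  the \<open>(p,p)\<close> norm: Maz'ya's strong capacitary inequality bounds \<open>\<integral> |g - \<psi>| |u|^p\<close> by a small
  multiple of \<open>E\<close>, dominated convergence handles \<open>\<psi>\<close> and bounded values of \<open>u\<close>, and the large values
  carry little mass uniformly (lemma \<open>weighted_mass_limit\<close>). For the logarithm, the part of the
  integrand where \<open>|u| < T\<close> is \<open>p ln T |g| |u|^p\<close> minus a nonnegative function, to which Fatou's
  lemma applies, and the part where \<open>|u| > T\<close> is uniformly small; hence \<open>L\<close> is upper semicontinuous
  along the sequence (lemma \<open>log_integral_limit\<close>). The limit is admissible and its quotient is at
  most the infimum.

  Capacities are estimated with test functions only. The resulting integral inequalities pass to the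
  whole space by Fatou's lemma (lemma \<open>beppo_levi_transfer\<close>), so truncations of general elements of
  the space never have to be formed.
\<close>

section \<open>Smooth functions and a smooth step\<close>

definition smooth :: "('a::euclidean_space \<Rightarrow> real) \<Rightarrow> bool" where
  "smooth f \<longleftrightarrow> (\<forall>k. Ck k f)"

lemma partial_eq:
  assumes "(f has_derivative D) (at x)"
  shows "partial i f x = D i"
  using frechet_derivative_at[OF assms] by (simp add: partial_def)

lemma Ck_Suc_imp: "Ck (Suc k) f \<Longrightarrow> Ck k f"
proof (induction k arbitrary: f)
  case 0
  then show ?case by (simp add: differentiable_imp_continuous_on)
next
  case (Suc k)
  then show ?case by simp
qed

lemma Ck_has_derivative:
  assumes "Ck (Suc k) f"
  shows "(f has_derivative (\<lambda>h. grad f x \<bullet> h)) (at x)"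
proof -
  have d: "(f has_derivative frechet_derivative f (at x)) (at x)"
    using assms by (simp add: differentiable_on_def frechet_derivative_works)
  then have lin: "linear (frechet_derivative f (at x))"
    by (rule has_derivative_linear)
  have "frechet_derivative f (at x) h = grad f x \<bullet> h" for h
  proof -
    have "frechet_derivative f (at x) h = frechet_derivative f (at x) (\<Sum>i\<in>Basis. (h \<bullet> i) *\<^sub>R i)"
      by (simp add: euclidean_representation)
    also have "\<dots> = (\<Sum>i\<in>Basis. (h \<bullet> i) * partial i f x)"
      by (simp add: linear_sum[OF lin] linear_cmul[OF lin] partial_def)
    also have "\<dots> = grad f x \<bullet> h"
      unfolding inner_commute[of "grad f x" h] by (simp add: grad_def inner_sum_right mult.commute)
    finally show ?thesis .
  qed
  then show ?thesis using d by (metis (no_types, lifting) ext)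
qed

lemma Ck_SucI:
  assumes "\<And>x. (f has_derivative D x) (at x)" and "\<And>i. i \<in> Basis \<Longrightarrow> Ck k (\<lambda>x. D x i)"
  shows "Ck (Suc k) f"
proof -
  have "partial i f = (\<lambda>x. D x i)" for i
    using partial_eq[OF assms(1)] by (rule ext)
  then show ?thesis
    using assms by (auto simp: differentiable_on_def differentiable_def)
qed

lemma grad_inner_Basis: "i \<in> Basis \<Longrightarrow> grad f x \<bullet> i = partial i f x"
  by (simp add: grad_def inner_sum_left_Basis)

lemma Ck_grad: "Ck (Suc k) f \<Longrightarrow> i \<in> Basis \<Longrightarrow> Ck k (\<lambda>x. grad f x \<bullet> i)"
  by (simp add: grad_inner_Basis)

lemma Ck_const: "Ck k (\<lambda>x. c)"
proof (induction k arbitrary: c)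
  case (Suc k)
  show ?case by (rule Ck_SucI[where D = "\<lambda>_ _. 0"]) (auto intro: Suc)
qed simp

lemma Ck_inner: "Ck k (\<lambda>x. x \<bullet> a)"
proof (cases k)
  case (Suc j)
  show ?thesis unfolding Suc
    by (rule Ck_SucI[where D = "\<lambda>_ h. h \<bullet> a"]) (auto intro!: Ck_const derivative_eq_intros)
qed (auto intro!: continuous_intros)

lemma Ck_add: "Ck k f \<Longrightarrow> Ck k g \<Longrightarrow> Ck k (\<lambda>x. f x + g x)"
proof (induction k arbitrary: f g)
  case (Suc k)
  show ?case
    by (rule Ck_SucI[where D = "\<lambda>x h. grad f x \<bullet> h + grad g x \<bullet> h"])
      (auto intro!: Suc.IH Ck_grad Suc.prems has_derivative_add Ck_has_derivative[OF Suc.prems(1)]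
        Ck_has_derivative[OF Suc.prems(2)])
qed (auto intro!: continuous_intros)

lemma Ck_mult: "Ck k f \<Longrightarrow> Ck k g \<Longrightarrow> Ck k (\<lambda>x. f x * g x)"
proof (induction k arbitrary: f g)
  case (Suc k)
  note k = Ck_Suc_imp[OF Suc.prems(1)] Ck_Suc_imp[OF Suc.prems(2)]
  show ?case
    by (rule Ck_SucI[where D = "\<lambda>x h. f x * (grad g x \<bullet> h) + (grad f x \<bullet> h) * g x"])
      (auto intro!: Ck_add Suc.IH Ck_grad Suc.prems k has_derivative_mult Ck_has_derivative[OF Suc.prems(1)]
        Ck_has_derivative[OF Suc.prems(2)])
qed (auto intro!: continuous_intros)

lemma smooth_imp_Ck: "smooth f \<Longrightarrow> Ck k f" by (simp add: smooth_def)

lemma smooth_has_derivative: "smooth f \<Longrightarrow> (f has_derivative (\<lambda>h. grad f x \<bullet> h)) (at x)"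
  by (rule Ck_has_derivative) (rule smooth_imp_Ck)

lemma smooth_const [intro]: "smooth (\<lambda>x. c)" by (simp add: smooth_def Ck_const)
lemma smooth_inner [intro]: "smooth (\<lambda>x. x \<bullet> a)" by (simp add: smooth_def Ck_inner)
lemma smooth_add [intro]: "smooth f \<Longrightarrow> smooth g \<Longrightarrow> smooth (\<lambda>x. f x + g x)" by (simp add: smooth_def Ck_add)
lemma smooth_mult [intro]: "smooth f \<Longrightarrow> smooth g \<Longrightarrow> smooth (\<lambda>x. f x * g x)" by (simp add: smooth_def Ck_mult)
lemma smooth_diff [intro]: "smooth f \<Longrightarrow> smooth g \<Longrightarrow> smooth (\<lambda>x. f x - g x)"
  using smooth_add[of f "\<lambda>x. (-1) * g x"] smooth_mult[OF smooth_const, of g "-1"] by simp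
lemma smooth_sum [intro]: "(\<And>i. i \<in> I \<Longrightarrow> smooth (f i)) \<Longrightarrow> smooth (\<lambda>x. \<Sum>i\<in>I. f i x)"
  by (induction I rule: infinite_finite_induct) auto
lemma smooth_prod [intro]: "(\<And>i. i \<in> I \<Longrightarrow> smooth (f i)) \<Longrightarrow> smooth (\<lambda>x. \<Prod>i\<in>I. f i x)"
  by (induction I rule: infinite_finite_induct) auto

lemma smooth_partial: "smooth f \<Longrightarrow> i \<in> Basis \<Longrightarrow> smooth (partial i f)"
  unfolding smooth_def by (metis Ck.simps(2))

lemma smooth_continuous: "smooth f \<Longrightarrow> continuous_on A f"
  unfolding smooth_def by (metis Ck.simps(1) continuous_on_subset subset_UNIV)

lemma smooth_continuous_grad: "smooth f \<Longrightarrow> continuous_on A (grad f)"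
  unfolding grad_def[abs_def] by (intro continuous_intros smooth_continuous smooth_partial)

lemma grad_eqI: "(f has_derivative (\<lambda>h. v \<bullet> h)) (at x) \<Longrightarrow> grad f x = v"
  unfolding grad_def using partial_eq[of f "\<lambda>h. v \<bullet> h" x]
  by (simp add: euclidean_representation)

lemma grad_add: "smooth f \<Longrightarrow> smooth g \<Longrightarrow> grad (\<lambda>x. f x + g x) x = grad f x + grad g x"
  by (rule grad_eqI) (auto simp: inner_add_left intro!: has_derivative_add smooth_has_derivative)

lemma grad_diff: "smooth f \<Longrightarrow> smooth g \<Longrightarrow> grad (\<lambda>x. f x - g x) x = grad f x - grad g x"
  by (rule grad_eqI) (auto simp: inner_diff_left intro!: has_derivative_diff smooth_has_derivative)

lemma grad_cmult: "smooth f \<Longrightarrow> grad (\<lambda>x. c * f x) x = c *\<^sub>R grad f x"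
  by (rule grad_eqI) (auto intro!: derivative_eq_intros smooth_has_derivative)

lemma grad_compose:
  assumes "(h has_real_derivative h') (at (f x))" and "smooth f"
  shows "grad (\<lambda>x. h (f x)) x = h' *\<^sub>R grad f x"
proof (rule grad_eqI)
  have "(h \<circ> f has_derivative (\<lambda>v. h' * v) \<circ> (\<lambda>v. grad f x \<bullet> v)) (at x)"
    using assms(1) unfolding has_field_derivative_def
    by (intro diff_chain_at smooth_has_derivative assms)
  then show "((\<lambda>x. h (f x)) has_derivative (\<bullet>) (h' *\<^sub>R grad f x)) (at x)"
    by (simp add: o_def fun_eq_iff[symmetric] inner_scaleR_left[abs_def])
qed

text \<open>\<open>flat 0\<close> is \<open>exp (-1/t)\<close> continued by zero. The derivative of each member of the family is a linear
combination of two others, so smoothness of all of them follows by one induction on the order.\<close>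
definition flat :: "nat \<Rightarrow> real \<Rightarrow> real" where
  "flat m t = (if t > 0 then inverse t ^ m * exp (- inverse t) else 0)"

lemma flat_tendsto_0: "((\<lambda>t. flat m t) \<longlongrightarrow> 0) (at 0)"
proof -
  have "((\<lambda>s. s ^ m / exp s) \<longlongrightarrow> (0::real)) at_top"
    by (rule tendsto_power_div_exp_0)
  then have "((\<lambda>t. inverse t ^ m / exp (inverse t)) \<longlongrightarrow> (0::real)) (at_right 0)"
    by (rule filterlim_compose) (rule filterlim_inverse_at_top_right)
  moreover have "\<forall>\<^sub>F t in at_right 0. inverse t ^ m / exp (inverse t) = flat m t"
    unfolding eventually_at_right_field by (auto intro!: exI[of _ 1] simp: flat_def exp_minus divide_inverse)
  ultimately have r: "(flat m \<longlongrightarrow> 0) (at_right 0)"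
    by (rule Lim_transform_eventually)
  have "\<forall>\<^sub>F t in at_left 0. 0 = flat m t"
    unfolding eventually_at_left_field by (auto intro!: exI[of _ "-1"] simp: flat_def)
  then have l: "(flat m \<longlongrightarrow> 0) (at_left 0)"
    by (rule Lim_transform_eventually[OF tendsto_const])
  show ?thesis using l r by (simp add: filterlim_split_at)
qed

lemma flat_has_derivative:
  "(flat m has_real_derivative (flat (m + 2) t - m * flat (m + 1) t)) (at t)"
proof -
  consider "t > 0" | "t < 0" | "t = 0" by linarith
  then show ?thesis
  proof cases
    case 1
    have "((\<lambda>t. inverse t ^ m * exp (- inverse t)) has_real_derivative
        (flat (m + 2) t - m * flat (m + 1) t)) (at t)"
    proof (rule DERIV_cong)
      show "((\<lambda>t. inverse t ^ m * exp (- inverse t)) has_real_derivative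
          (m * inverse t ^ (m - 1) * (- (inverse t * inverse t))) * exp (- inverse t)
          + inverse t ^ m * (exp (- inverse t) * (inverse t * inverse t))) (at t)"
        using 1 by (auto intro!: derivative_eq_intros simp: algebra_simps)
      show "(m * inverse t ^ (m - 1) * (- (inverse t * inverse t))) * exp (- inverse t)
          + inverse t ^ m * (exp (- inverse t) * (inverse t * inverse t))
          = flat (m + 2) t - m * flat (m + 1) t"
        using 1 by (cases m) (simp_all add: flat_def algebra_simps)
    qed
    then show ?thesis
      by (rule has_field_derivative_transform_within_open[of _ _ _ "{0<..}"]) (use 1 in \<open>auto simp: flat_def\<close>)
  next
    case 2
    have "((\<lambda>t. 0) has_real_derivative (flat (m + 2) t - m * flat (m + 1) t)) (at t)"
      using 2 by (simp add: flat_def)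
    then show ?thesis
      by (rule has_field_derivative_transform_within_open[of _ _ _ "{..<0}"]) (use 2 in \<open>auto simp: flat_def\<close>)
  next
    case 3
    \<comment> \<open>At the origin the difference quotient of \<open>flat m\<close> is again a member of the family.\<close>
    have "flat m h / h = flat (Suc m) h" for h
      by (simp add: flat_def field_simps)
    then have "((\<lambda>h. (flat m (0 + h) - flat m 0) / h) \<longlongrightarrow> 0) (at 0)"
      using flat_tendsto_0[of "Suc m"] by (simp add: flat_def[of m 0])
    then show ?thesis
      unfolding DERIV_def 3 by (simp add: flat_def)
  qed
qed

lemma Ck_flat: "Ck k f \<Longrightarrow> Ck k (\<lambda>x. flat m (f x))"
proof (induction k arbitrary: m)
  case 0
  have "continuous_on UNIV (flat m)"
    using flat_has_derivative DERIV_isCont by (blast intro: continuous_at_imp_continuous_on)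
  with 0 show ?case
    by (auto intro: continuous_on_compose2)
next
  case (Suc k)
  have f: "Ck k f" using Suc.prems by (rule Ck_Suc_imp)
  show ?case
  proof (rule Ck_SucI)
    fix x
    show "((\<lambda>x. flat m (f x)) has_derivative
        (\<lambda>h. (flat (m + 2) (f x) + (- real m) * flat (m + 1) (f x)) * (grad f x \<bullet> h))) (at x)"
      using diff_chain_at[OF Ck_has_derivative[OF Suc.prems]
          flat_has_derivative[of m "f x", unfolded has_field_derivative_def]]
      by (simp add: o_def algebra_simps)
  next
    fix i :: 'a assume "i \<in> Basis"
    then show "Ck k (\<lambda>x. (flat (m + 2) (f x) + (- real m) * flat (m + 1) (f x)) * (grad f x \<bullet> i))"
      by (intro Ck_mult Ck_add Ck_const Suc.IH f Ck_grad Suc.prems)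
  qed
qed

text \<open>The outer argument is at most \<open>0\<close> for \<open>t \<le> 1\<close> and equals \<open>1\<close> for \<open>t \<ge> 2\<close>, so this composition of two
flat functions is \<open>0\<close> on the left of the transition interval and \<open>1\<close> on its right.\<close>
definition step :: "real \<Rightarrow> real" where
  "step t = exp 1 * flat 0 (1 - exp 1 * flat 0 (2 - t))"

definition step' :: "real \<Rightarrow> real" where
  "step' t = exp 1 * flat 2 (1 - exp 1 * flat 0 (2 - t)) * (exp 1 * flat 2 (2 - t))"

lemma step_has_derivative: "(step has_real_derivative step' t) (at t)"
proof -
  have d: "(flat 0 has_real_derivative flat 2 s) (at s)" for s
    using flat_has_derivative[of 0 s] by (simp add: numeral_2_eq_2)
  have "((\<lambda>t. 1 - exp 1 * flat 0 (2 - t)) has_real_derivative exp 1 * flat 2 (2 - t)) (at t)"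
  proof -
    have "((\<lambda>t. flat 0 (2 - t)) has_real_derivative flat 2 (2 - t) * (- 1)) (at t)"
      by (rule DERIV_chain2[where f = "flat 0", OF d]) (auto intro!: derivative_eq_intros)
    from DERIV_diff[OF DERIV_const DERIV_cmult[OF this]] show ?thesis by simp
  qed
  from DERIV_cmult[OF DERIV_chain2[where f = "flat 0", OF d this]] show ?thesis
    unfolding step_def[abs_def] step'_def by (simp add: mult.assoc)
qed

lemma smooth_step [intro]: "smooth f \<Longrightarrow> smooth (\<lambda>x. step (f x))"
proof -
  assume f: "smooth f"
  have "smooth (\<lambda>x. flat 0 (2 - f x))"
    using smooth_diff[OF smooth_const f, of 2] by (simp add: smooth_def Ck_flat)
  then have "smooth (\<lambda>x. 1 - exp 1 * flat 0 (2 - f x))"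
    by (intro smooth_diff smooth_mult smooth_const)
  then have "smooth (\<lambda>x. flat 0 (1 - exp 1 * flat 0 (2 - f x)))" by (simp add: smooth_def Ck_flat)
  then show "smooth (\<lambda>x. step (f x))" 
    unfolding step_def by (intro smooth_mult smooth_const)
qed

lemma flat_nonneg: "0 \<le> flat m t" by (simp add: flat_def)

lemma flat_0_mono: "s \<le> t \<Longrightarrow> flat 0 s \<le> flat 0 t"
  by (auto simp: flat_def le_imp_inverse_le)

lemma flat_0_ge:
  assumes "t \<le> 1"
  shows "1 \<le> exp 1 * flat 0 (2 - t)"
proof -
  have "flat 0 1 \<le> flat 0 (2 - t)" using assms by (intro flat_0_mono) auto
  then show ?thesis by (simp add: flat_def exp_minus field_simps split: if_splits)
qed

lemma step_eq_0: "t \<le> 1 \<Longrightarrow> step t = 0"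
  using flat_0_ge[of t] by (simp add: step_def flat_def[of 0 "1 - _"])

lemma step'_eq_0: "t \<le> 1 \<or> 2 \<le> t \<Longrightarrow> step' t = 0"
proof (elim disjE)
  assume "t \<le> 1"
  then show ?thesis using flat_0_ge[of t] by (simp add: step'_def flat_def[of 2 "1 - _"])
qed (simp add: step'_def flat_def)

lemma step_eq_1: "2 \<le> t \<Longrightarrow> step t = 1"
  by (simp add: step_def flat_def exp_minus)

lemma step_range: "0 \<le> step t" "step t \<le> 1"
proof -
  show "0 \<le> step t" by (simp add: step_def flat_nonneg)
  have "flat 0 (1 - exp 1 * flat 0 (2 - t)) \<le> flat 0 1" by (rule flat_0_mono) (simp add: flat_nonneg)
  then show "step t \<le> 1" by (simp add: step_def flat_def[of 0 1] exp_minus field_simps)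
qed

lemma flat_2_le: "flat 2 t \<le> 2"
proof (cases "t > 0")
  case True
  have "(inverse t)\<^sup>2 / 2 \<le> exp (inverse t)"
    using exp_lower_Taylor_quadratic[of "inverse t"] True positive_imp_inverse_positive[OF True] by linarith
  then show ?thesis using True by (simp add: flat_def exp_minus field_simps)
qed (simp add: flat_def)

text \<open>The constant is crude. What matters is one bound for the smooth truncations at all levels.\<close>
lemma step'_range: "0 \<le> step' t" "step' t \<le> 36"
proof -
  show "0 \<le> step' t" by (simp add: step'_def flat_nonneg)
  have "exp 1 * flat 2 s \<le> 6" for s
    using mult_mono[OF exp_le flat_2_le[of s]] by (simp add: flat_nonneg) 
  then show "step' t \<le> 36" unfolding step'_def
    using mult_mono[of "exp 1 * flat 2 (1 - exp 1 * flat 0 (2 - t))" 6 "exp 1 * flat 2 (2 - t)" 6] by (simp add: flat_nonneg)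
qed

section \<open>Test functions and weak gradients\<close>

lemma borel_lebesgueI [intro]: "f \<in> borel_measurable borel \<Longrightarrow> f \<in> borel_measurable lebesgue"
  by (rule measurable_completion) simp

lemma continuous_lebesgue: "continuous_on UNIV f \<Longrightarrow> f \<in> borel_measurable lebesgue"
  by (intro borel_lebesgueI borel_measurable_continuous_onI)

lemma cball_lebesgue [measurable]: "cball a (R::real) \<in> sets lebesgue"
  by auto

lemma box_lebesgue [measurable]: "box a b \<in> sets lebesgue"
  by (simp add: borel_open)

lemma continuous_bounded_support:
  fixes f :: "'a::euclidean_space \<Rightarrow> 'b::euclidean_space"
  assumes "continuous_on UNIV f" and "\<And>x. R < norm x \<Longrightarrow> f x = 0"
  shows "\<exists>C>0. \<forall>x. norm (f x) \<le> C"
proof -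
  have "compact (f ` cball 0 R)"
    by (rule compact_continuous_image) (auto intro: continuous_on_subset assms(1))
  from compact_imp_bounded[OF this] obtain C where C: "\<And>y. y \<in> f ` cball 0 R \<Longrightarrow> norm y \<le> C"
    unfolding bounded_iff by blast
  have "norm (f x) \<le> \<bar>C\<bar> + 1" for x
  proof (cases "norm x \<le> R")
    case True
    then have "norm (f x) \<le> C" by (intro C) auto
    then show ?thesis by linarith
  next
    case False
    then have "f x = 0" by (intro assms(2)) auto
    then show ?thesis by simp
  qed
  then show ?thesis by (intro exI[of _ "\<bar>C\<bar> + 1"]) auto
qed

lemma continuous_set_integrable:
  fixes f :: "'a::euclidean_space \<Rightarrow> 'b::euclidean_space"
  assumes "continuous_on UNIV f" "compact K"
  shows "set_integrable lebesgue K f"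
proof -
  have "integrable lborel (\<lambda>x. indicator K x *\<^sub>R f x)"
    using assms by (intro borel_integrable_compact) (auto intro: continuous_on_subset)
  then show ?thesis
    unfolding set_integrable_def by (subst integrable_completion) auto
qed

lemma continuous_L1loc: "continuous_on UNIV f \<Longrightarrow> L1loc f"
  by (simp add: L1loc_def continuous_set_integrable continuous_lebesgue)

lemma continuous_bounded_support_integrable:
  fixes f :: "'a::euclidean_space \<Rightarrow> 'b::euclidean_space"
  assumes "continuous_on UNIV f" and "\<And>x. R < norm x \<Longrightarrow> f x = 0"
  shows "integrable lebesgue f"
proof -
  have "indicator (cball 0 R) x *\<^sub>R f x = f x" for x
    using assms(2)[of x] by (auto simp: indicator_def not_le)
  then show ?thesis
    using continuous_set_integrable[OF assms(1) compact_cball[of 0 R]] by (simp add: set_integrable_def)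
qed

lemma test_fun_iff:
  "test_fun \<phi> \<longleftrightarrow> smooth \<phi> \<and> (\<exists>R. \<forall>x. R < norm x \<longrightarrow> \<phi> x = 0)"
proof -
  have "bounded {x. \<phi> x \<noteq> 0} \<longleftrightarrow> (\<exists>R. \<forall>x. R < norm x \<longrightarrow> \<phi> x = 0)"
    unfolding bounded_iff by (auto simp: not_le[symmetric])
  then show ?thesis by (simp add: test_fun_def smooth_def)
qed

lemma test_fun_smooth: "test_fun \<phi> \<Longrightarrow> smooth \<phi>" by (simp add: test_fun_iff)

lemma test_fun_supportE:
  assumes "test_fun \<phi>"
  obtains R where "R > 0" "\<And>x. R < norm x \<Longrightarrow> \<phi> x = 0" "\<And>x. R < norm x \<Longrightarrow> grad \<phi> x = 0"
    "\<And>x i. R < norm x \<Longrightarrow> partial i \<phi> x = 0"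
proof -
  obtain R where R: "\<And>x. R < norm x \<Longrightarrow> \<phi> x = 0" using assms by (auto simp: test_fun_iff)
  have op: "open {x::'a. \<bar>R\<bar> + 1 < norm x}" by (intro open_Collect_less continuous_intros)
  have d: "(\<phi> has_derivative (\<lambda>_. 0)) (at x)" if "\<bar>R\<bar> + 1 < norm x" for x
  proof (rule has_derivative_transform_within_open[OF _ op])
    show "((\<lambda>_. 0) has_derivative (\<lambda>_. 0)) (at x)" by simp
    show "x \<in> {x. \<bar>R\<bar> + 1 < norm x}" using that by simp
    fix y :: 'a assume "y \<in> {x. \<bar>R\<bar> + 1 < norm x}"
    then show "0 = \<phi> y" using R[of y] by simp
  qed
  have "partial i \<phi> x = 0" if "\<bar>R\<bar> + 1 < norm x" for i x
    using partial_eq[OF d[OF that], of i] by simp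
  then show ?thesis
    by (intro that[of "\<bar>R\<bar> + 1"]) (auto simp: grad_def R)
qed

lemma test_fun_add: "test_fun f \<Longrightarrow> test_fun g \<Longrightarrow> test_fun (\<lambda>x. f x + g x)"
proof -
  assume f: "test_fun f" and g: "test_fun g"
  obtain R where R: "\<And>x. R < norm x \<Longrightarrow> f x = 0" using f by (auto simp: test_fun_iff)
  obtain S where S: "\<And>x. S < norm x \<Longrightarrow> g x = 0" using g by (auto simp: test_fun_iff)
  show ?thesis
    using f g R S by (auto simp: test_fun_iff intro!: exI[of _ "max R S"])
qed

lemma test_fun_mult: "smooth f \<Longrightarrow> test_fun g \<Longrightarrow> test_fun (\<lambda>x. f x * g x)"
  by (auto simp: test_fun_iff)

lemma test_fun_cmult: "test_fun g \<Longrightarrow> test_fun (\<lambda>x. c * g x)"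
  by (rule test_fun_mult) auto

lemma test_fun_diff: "test_fun f \<Longrightarrow> test_fun g \<Longrightarrow> test_fun (\<lambda>x. f x - g x)"
  using test_fun_add[of f "\<lambda>x. (-1) * g x"] test_fun_cmult[of g "-1"] by simp

lemma smooth_cmult: "smooth f \<Longrightarrow> smooth (\<lambda>x. c * f x)"
  by (rule smooth_mult) auto

lemma test_fun_step: "test_fun f \<Longrightarrow> test_fun (\<lambda>x. step (c * f x))"
proof -
  assume f: "test_fun f"
  then obtain R where "\<And>x. R < norm x \<Longrightarrow> f x = 0" by (auto simp: test_fun_iff)
  moreover have "smooth (\<lambda>x. step (c * f x))"
    using f by (intro smooth_step smooth_cmult test_fun_smooth)
  ultimately show ?thesis by (auto simp: test_fun_iff step_eq_0 intro!: exI[of _ R])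
qed

lemma test_fun_continuous: "test_fun f \<Longrightarrow> continuous_on A f"
  by (simp add: smooth_continuous test_fun_smooth)

lemma test_fun_continuous_grad: "test_fun f \<Longrightarrow> continuous_on A (grad f)"
  by (simp add: smooth_continuous_grad test_fun_smooth)

lemma test_fun_measurable: "test_fun f \<Longrightarrow> f \<in> borel_measurable borel" "test_fun f \<Longrightarrow> grad f \<in> borel_measurable borel"
  by (simp_all add: borel_measurable_continuous_onI test_fun_continuous test_fun_continuous_grad)

text \<open>For a test function this is the energy, by lemma \<open>energy_test_fun\<close> below; until then weak gradients
are kept out of the computations.\<close>
definition dirichlet :: "real \<Rightarrow> ('a::euclidean_space \<Rightarrow> real) \<Rightarrow> real" where
  "dirichlet p \<phi> = (LINT x|lebesgue. norm (grad \<phi> x) powr p)"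

lemma grad_powr_integrable:
  assumes "test_fun \<phi>" "0 < p"
  shows "integrable lebesgue (\<lambda>x. norm (grad \<phi> x) powr p)"
proof -
  obtain R where R: "\<And>x. R < norm x \<Longrightarrow> grad \<phi> x = 0" using test_fun_supportE[OF assms(1)] by metis
  show ?thesis
  proof (rule continuous_bounded_support_integrable)
    show "continuous_on UNIV (\<lambda>x. norm (grad \<phi> x) powr p)"
      using assms by (intro continuous_on_powr' continuous_intros test_fun_continuous_grad) auto
  qed (use R in auto)
qed

lemma dirichlet_nonneg: "0 \<le> dirichlet p \<phi>" by (simp add: dirichlet_def)

lemma nn_integral_dirichlet:
  assumes "test_fun \<phi>" "0 < p"
  shows "(\<integral>\<^sup>+x. ennreal (norm (grad \<phi> x) powr p) \<partial>lebesgue) = ennreal (dirichlet p \<phi>)"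
  unfolding dirichlet_def using grad_powr_integrable[OF assms] by (intro nn_integral_eq_integral) auto

lemma dirichlet_cmult:
  assumes "test_fun \<phi>" shows "dirichlet p (\<lambda>x. c * \<phi> x) = \<bar>c\<bar> powr p * dirichlet p \<phi>"
  using assms by (simp add: dirichlet_def grad_cmult test_fun_smooth powr_mult)

lemma integral_translation:
  fixes f :: "'a::euclidean_space \<Rightarrow> real"
  assumes "f \<in> borel_measurable borel"
  shows "(LINT x|lborel. f (x + v)) = (LINT x|lborel. f x)"
proof -
  have "(LINT x|lborel. f x) = (LINT x|distr lborel borel ((+) v). f x)" by (simp add: lborel_distr_plus)
  also have "\<dots> = (LINT x|lborel. f (v + x))" using assms by (subst integral_distr) auto
  finally show ?thesis by (simp add: add.commute)
qed

text \<open>The difference quotients have integral zero by translation invariance, and they are dominated because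
the derivative is bounded. Only the derivative in the direction \<open>v\<close> enters, so the lemma also applies to
products with \<open>|\<phi>|^p\<close>, which need not be smooth.\<close>
lemma integral_directional_derivative_eq_0:
  fixes f D :: "'a::euclidean_space \<Rightarrow> real"
  assumes cont: "continuous_on UNIV f" and supp: "\<And>x. R < norm x \<Longrightarrow> f x = 0"
    and deriv: "\<And>x. ((\<lambda>t. f (x + t *\<^sub>R v)) has_real_derivative D x) (at 0)"
    and bound: "\<And>x. \<bar>D x\<bar> \<le> C"
  shows "integrable lebesgue D" "(LINT x|lebesgue. D x) = 0"
proof -
  have [measurable]: "f \<in> borel_measurable borel" by (rule borel_measurable_continuous_onI[OF cont])
  define t :: "nat \<Rightarrow> real" where "t n = inverse (real (Suc n))" for n
  have t: "t n > 0" "t n \<le> 1" for n by (simp_all add: t_def field_simps)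
  have t0: "t \<longlonglongrightarrow> 0" unfolding t_def[abs_def] by (rule LIMSEQ_inverse_real_of_nat)
  define d where "d n x = (f (x + t n *\<^sub>R v) - f x) / t n" for n x
  have lim: "(\<lambda>n. d n x) \<longlonglongrightarrow> D x" for x
  proof -
    have "((\<lambda>h. (f (x + h *\<^sub>R v) - f x) / h) \<longlongrightarrow> D x) (at 0)"
      using deriv[of x] unfolding DERIV_def by simp
    moreover have "filterlim t (at 0) sequentially"
      using t0 t(1) by (auto simp: filterlim_at less_imp_neq[THEN not_sym])
    ultimately show ?thesis unfolding d_def by (rule filterlim_compose)
  qed
  have line: "((\<lambda>t. f (x + t *\<^sub>R v)) has_real_derivative D (x + s *\<^sub>R v)) (at s)" for x s
  proof -
    have "((\<lambda>t. f ((x + s *\<^sub>R v) + (t - s) *\<^sub>R v)) has_real_derivative D (x + s *\<^sub>R v)) (at s)"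
      using DERIV_shift[of "\<lambda>t. f ((x + s *\<^sub>R v) + t *\<^sub>R v)" "D (x + s *\<^sub>R v)" s "-s"] deriv[of "x + s *\<^sub>R v"]
      by simp
    then show ?thesis by (simp add: algebra_simps)
  qed
  have C: "C \<ge> 0" using bound[of 0] by linarith
  have bd: "\<bar>d n x\<bar> \<le> C" for n x
  proof -
    have "\<exists>z>0. z < t n \<and> f (x + t n *\<^sub>R v) - f (x + 0 *\<^sub>R v) = (t n - 0) * D (x + z *\<^sub>R v)"
      by (rule MVT2) (use t in \<open>auto intro: line\<close>)
    then obtain z where "f (x + t n *\<^sub>R v) - f x = t n * D (x + z *\<^sub>R v)" by auto
    then have "d n x = D (x + z *\<^sub>R v)" using t(1)[of n] by (simp add: d_def)
    then show ?thesis using bound by simp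
  qed
  have sup: "d n x = 0" if "R + norm v < norm x" for n x
  proof -
    have "norm x \<le> norm (x + t n *\<^sub>R v) + norm (t n *\<^sub>R v)"
      using norm_triangle_ineq4[of "x + t n *\<^sub>R v" "t n *\<^sub>R v"] by simp
    also have "norm (t n *\<^sub>R v) \<le> norm v" using t[of n] by (simp add: mult_left_le_one_le)
    finally have "R < norm (x + t n *\<^sub>R v)" using that by linarith
    moreover have "R < norm x" using that norm_ge_zero[of v] by linarith
    ultimately show ?thesis by (simp add: d_def supp)
  qed
  have dom: "norm (d n x) \<le> C * indicator (cball 0 (R + norm v)) x" for n x
    using bd[of n x] sup[of x n] C by (auto simp: indicator_def not_le)
  have [measurable]: "d n \<in> borel_measurable borel" for n unfolding d_def[abs_def] by measurable
  have [measurable]: "D \<in> borel_measurable borel"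
    by (rule borel_measurable_LIMSEQ_real[where u = d]) (auto intro: lim)
  have int_d: "(LINT x|lborel. d n x) = 0" for n
  proof -
    have i: "integrable lborel f"
      using continuous_bounded_support_integrable[OF cont supp] by (simp add: integrable_completion)
    then have "integrable lborel (\<lambda>x. f (x + t n *\<^sub>R v))"
      using integrable_distr_eq[of "(+) (t n *\<^sub>R v)" lborel borel f]
      by (simp add: lborel_distr_plus add.commute)
    with i show ?thesis by (simp add: d_def integral_translation)
  qed
  have w: "integrable lborel (\<lambda>x::'a. C * indicator (cball 0 (R + norm v)) x)"
    using borel_integrable_compact[OF compact_cball continuous_on_const, of 0 "R + norm v" C]
    by (simp add: mult.commute)
  have "integrable lborel D"
    by (rule integrable_dominated_convergence[where s = d, OF _ _ w]) (use dom lim in auto)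
  then show "integrable lebesgue D" by (simp add: integrable_completion)
  have "(\<lambda>n. LINT x|lborel. d n x) \<longlonglongrightarrow> (LINT x|lborel. D x)"
    by (rule integral_dominated_convergence[OF _ _ w]) (use dom lim in auto)
  then have "(LINT x|lborel. D x) = 0" by (simp add: int_d LIMSEQ_const_iff)
  then show "(LINT x|lebesgue. D x) = 0" by (simp add: integral_completion)
qed

lemma has_derivative_line:
  assumes "(f has_derivative D) (at x)"
  shows "((\<lambda>t. f (x + t *\<^sub>R v)) has_real_derivative D v) (at 0)"
proof -
  have "((\<lambda>t. x + t *\<^sub>R v) has_derivative (\<lambda>t. t *\<^sub>R v)) (at (0::real))"
    by (auto intro!: derivative_eq_intros)
  then have "(f \<circ> (\<lambda>t. x + t *\<^sub>R v) has_derivative D \<circ> (\<lambda>t. t *\<^sub>R v)) (at 0)"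
    using assms by (intro diff_chain_at) auto
  moreover have "D \<circ> (\<lambda>t. t *\<^sub>R v) = (*) (D v)"
    using linear_cmul[OF has_derivative_linear[OF assms]] by (auto simp: fun_eq_iff mult.commute)
  ultimately show ?thesis
    unfolding has_field_derivative_def by (simp add: o_def[of f])
qed

lemma integral_partial_eq_0:
  assumes "test_fun \<phi>" "i \<in> Basis"
  shows "integrable lebesgue (partial i \<phi>)" "(LINT x|lebesgue. partial i \<phi> x) = 0"
proof -
  have c: "continuous_on UNIV (partial i \<phi>)"
    by (intro smooth_continuous smooth_partial test_fun_smooth assms)
  obtain R where R: "\<And>x. R < norm x \<Longrightarrow> \<phi> x = 0" "\<And>x. R < norm x \<Longrightarrow> partial i \<phi> x = 0"
    using test_fun_supportE[OF assms(1)] by metis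
  obtain C where C: "\<And>x. norm (partial i \<phi> x) \<le> C" using continuous_bounded_support[OF c R(2)] by blast
  have d: "((\<lambda>t. \<phi> (x + t *\<^sub>R i)) has_real_derivative partial i \<phi> x) (at 0)" for x
    using has_derivative_line[OF smooth_has_derivative[OF test_fun_smooth[OF assms(1)]], of x i]
    by (simp add: grad_inner_Basis[OF assms(2)])
  note * = integral_directional_derivative_eq_0[OF test_fun_continuous[OF assms(1)] R(1) d]
  show "integrable lebesgue (partial i \<phi>)" by (rule *) (use C in auto)
  show "(LINT x|lebesgue. partial i \<phi> x) = 0" by (rule *) (use C in auto)
qed

lemma L1loc_mult_integrable:
  fixes V :: "'a::euclidean_space \<Rightarrow> 'b::euclidean_space"
  assumes "L1loc V" "continuous_on UNIV w" "\<And>x. R < norm x \<Longrightarrow> w x = (0::real)"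
  shows "integrable lebesgue (\<lambda>x. w x *\<^sub>R V x)"
proof -
  obtain C where C: "\<And>x. norm (w x) \<le> C" using continuous_bounded_support[OF assms(2,3)] by blast
  have i: "integrable lebesgue (\<lambda>x. indicator (cball 0 R) x *\<^sub>R V x)"
    using assms(1) by (auto simp: L1loc_def set_integrable_def)
  have [measurable]: "w \<in> borel_measurable lebesgue" "V \<in> borel_measurable lebesgue"
    using assms continuous_lebesgue by (auto simp: L1loc_def)
  show ?thesis
  proof (rule Bochner_Integration.integrable_bound[OF integrable_scaleR_right[OF i, of C]])
    show "AE x in lebesgue. norm (w x *\<^sub>R V x) \<le> norm (C *\<^sub>R (indicator (cball 0 R) x *\<^sub>R V x))"
    proof (rule AE_I2)
      fix x
      show "norm (w x *\<^sub>R V x) \<le> norm (C *\<^sub>R (indicator (cball 0 R) x *\<^sub>R V x))"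
        using C[of x] assms(3)[of x] by (cases "norm x \<le> R") (auto intro!: mult_right_mono)
    qed
  qed measurable
qed

text \<open>The positive and the negative part of \<open>f\<close> are densities of two measures that agree on boxes, and boxes
generate the Borel sets and are stable under intersection.\<close>
lemma box_integrals_0_imp_AE_0:
  fixes f :: "'a::euclidean_space \<Rightarrow> real"
  assumes "L1loc f" and box: "\<And>a b. (LINT x|lebesgue. indicator (box a b) x * f x) = 0"
  shows "AE x in lebesgue. f x = 0"
proof -
  have f_meas[measurable]: "f \<in> borel_measurable lebesgue" using assms by (simp add: L1loc_def)
  obtain f' where [measurable]: "f' \<in> borel_measurable lborel" and ae: "AE x in lborel. f x = f' x"
    using completion_ex_borel_measurable_real[OF f_meas] by blast
  have ae': "AE x in lebesgue. f x = f' x" using ae by (rule AE_completion)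
  have [measurable]: "f' \<in> borel_measurable lebesgue" by (rule borel_lebesgueI) simp
  have int: "integrable lborel (\<lambda>x. indicator (box a b) x * f' x)" for a b :: 'a
  proof -
    have "set_integrable lebesgue (cbox a b) f" using assms by (simp add: L1loc_def)
    then have "set_integrable lebesgue (box a b) f"
      by (rule set_integrable_subset) (auto simp: box_subset_cbox)
    then have "integrable lebesgue (\<lambda>x. indicator (box a b) x * f x)" by (simp add: set_integrable_def)
    then have "integrable lebesgue (\<lambda>x. indicator (box a b) x * f' x)"
      by (rule integrable_cong_AE_imp) (use ae' in auto)
    then show ?thesis by (simp add: integrable_completion)
  qed
  have zero: "(LINT x|lborel. indicator (box a b) x * f' x) = 0" for a b :: 'a
  proof -
    have "(LINT x|lebesgue. indicator (box a b) x * f x) = (LINT x|lebesgue. indicator (box a b) x * f' x)"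
      by (rule integral_cong_AE) (use ae' in auto)
    then show ?thesis using box[of a b] by (simp add: integral_completion)
  qed
  have fin: "(\<integral>\<^sup>+x. ennreal (indicator (box a b) x * f' x) \<partial>lborel) \<noteq> \<infinity>" for a b :: 'a
    using int[of a b] by (auto simp: real_integrable_def)
  have "(\<integral>\<^sup>+x. ennreal (indicator (box a b) x * f' x) \<partial>lborel)
      = (\<integral>\<^sup>+x. ennreal (- (indicator (box a b) x * f' x)) \<partial>lborel)" for a b :: 'a
  proof -
    have "enn2real (\<integral>\<^sup>+x. ennreal (indicator (box a b) x * f' x) \<partial>lborel)
      = enn2real (\<integral>\<^sup>+x. ennreal (- (indicator (box a b) x * f' x)) \<partial>lborel)"
      using zero[of a b] real_lebesgue_integral_def[OF int[of a b]] by simp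
    moreover have "(\<integral>\<^sup>+x. ennreal (- (indicator (box a b) x * f' x)) \<partial>lborel) \<noteq> \<infinity>"
      using int[of a b] by (auto simp: real_integrable_def)
    moreover have "s = t" if "enn2real s = enn2real t" "s \<noteq> \<infinity>" "t \<noteq> \<infinity>" for s t
      using that by (cases s; cases t) auto
    ultimately show ?thesis using fin[of a b] by blast
  qed
  note eq0 = this
  have dens: "emeasure (density lborel (\<lambda>x. ennreal (h x))) (box a b)
      = (\<integral>\<^sup>+x. ennreal (indicator (box a b) x * h x) \<partial>lborel)"
    if "h \<in> borel_measurable lborel" for a b :: 'a and h
  proof -
    have "emeasure (density lborel (\<lambda>x. ennreal (h x))) (box a b)
      = (\<integral>\<^sup>+x. ennreal (h x) * indicator (box a b) x \<partial>lborel)"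
      using that by (intro emeasure_density) auto
    also have "\<dots> = (\<integral>\<^sup>+x. ennreal (indicator (box a b) x * h x) \<partial>lborel)"
      by (rule nn_integral_cong) (simp split: split_indicator)
    finally show ?thesis .
  qed
  have eq: "emeasure (density lborel (\<lambda>x. ennreal (f' x))) (box a b)
      = emeasure (density lborel (\<lambda>x. ennreal (- f' x))) (box a b)"
    and fin': "emeasure (density lborel (\<lambda>x. ennreal (f' x))) (box a b) \<noteq> \<infinity>" for a b :: 'a
    using fin[of a b] eq0[of a b] by (simp_all add: dens)
  let ?E = "range (\<lambda>(a, b). box a b::'a set)"
  let ?A = "\<lambda>n::nat. box (- (real n *\<^sub>R One)) (real n *\<^sub>R One) :: 'a set"
  have "density lborel (\<lambda>x. ennreal (f' x)) = density lborel (\<lambda>x. ennreal (- f' x))"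
  proof (rule measure_eqI_generator_eq)
    show "Int_stable ?E" by (auto simp: Int_stable_def box_Int_box)
    show "range ?A \<subseteq> ?E" "(\<Union>i. ?A i) = UNIV" unfolding UN_box_eq_UNIV by auto
    show "emeasure (density lborel (\<lambda>x. ennreal (f' x))) X = emeasure (density lborel (\<lambda>x. ennreal (- f' x))) X"
      if "X \<in> ?E" for X using that eq by auto
    show "emeasure (density lborel (\<lambda>x. ennreal (f' x))) (?A i) \<noteq> \<infinity>" for i by (rule fin')
  qed (simp_all add: borel_eq_box)
  then have "AE x in lborel. ennreal (f' x) = ennreal (- f' x)"
    by (subst (asm) sigma_finite_measure.density_unique_iff[OF sigma_finite_lborel]) auto
  then have "AE x in lborel. f' x = 0"
  proof eventually_elim
    case (elim x)
    then show ?case by (cases "f' x \<ge> 0") (auto simp: ennreal_neg ennreal_eq_0_iff)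
  qed
  then have "AE x in lebesgue. f' x = 0" by (rule AE_completion)
  then show ?thesis using ae' by eventually_elim simp
qed

text \<open>A product of one-dimensional steps, one for each face. Inside the open box every factor is eventually
\<open>1\<close>; outside, some factor vanishes for every \<open>k\<close>.\<close>
lemma box_indicator_approx:
  fixes a b :: "'a::euclidean_space"
  defines "\<psi> \<equiv> \<lambda>k x. \<Prod>i\<in>Basis. step (real k * (x \<bullet> i - a \<bullet> i)) * step (real k * (b \<bullet> i - x \<bullet> i))"
  shows "test_fun (\<psi> k)" "0 \<le> \<psi> k x" "\<psi> k x \<le> indicator (box a b) x"
    "(\<lambda>k. \<psi> k x) \<longlonglongrightarrow> indicator (box a b) x"
proof -
  show nn: "0 \<le> \<psi> k x" for k x unfolding \<psi>_def by (intro prod_nonneg) (simp add: step_range)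
  have out: "\<psi> k x = 0" if nb: "x \<notin> box a b" for k x
  proof -
    obtain i where i: "i \<in> Basis" "x \<bullet> i \<le> a \<bullet> i \<or> b \<bullet> i \<le> x \<bullet> i"
      using nb unfolding mem_box by (meson not_less)
    then have "real k * (x \<bullet> i - a \<bullet> i) \<le> 1 \<or> real k * (b \<bullet> i - x \<bullet> i) \<le> 1"
      by (metis diff_le_0_iff_le mult_nonneg_nonpos of_nat_0_le_iff order_trans zero_le_one)
    then have "step (real k * (x \<bullet> i - a \<bullet> i)) * step (real k * (b \<bullet> i - x \<bullet> i)) = 0"
      by (auto simp: step_eq_0)
    then show ?thesis unfolding \<psi>_def using i by (intro prod_zero) auto
  qed
  have "\<psi> k x \<le> 1" unfolding \<psi>_def
    by (intro prod_le_1) (simp add: step_range mult_le_one)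
  then show "\<psi> k x \<le> indicator (box a b) x" using out[of x k] by (auto simp: indicator_def)
  have "smooth (\<psi> k)" unfolding \<psi>_def
    by (intro smooth_prod smooth_mult smooth_step smooth_diff smooth_const smooth_inner)
  moreover obtain R where "\<forall>x\<in>box a b. norm x \<le> R" using bounded_box bounded_iff by metis
  moreover from this have "\<psi> k x = 0" if "R < norm x" for x using that out[of x k] by (meson not_le)
  ultimately show "test_fun (\<psi> k)" by (auto simp: test_fun_iff)
  show "(\<lambda>k. \<psi> k x) \<longlonglongrightarrow> indicator (box a b) x"
  proof (cases "x \<in> box a b")
    case False
    then show ?thesis by (simp add: out)
  next
    case True
    have "(\<lambda>k. step (real k * c)) \<longlonglongrightarrow> 1" if "c > 0" for c
    proof (rule tendsto_eventually)
      show "\<forall>\<^sub>F k in sequentially. step (real k * c) = 1"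
        using eventually_ge_at_top[of "nat \<lceil>2 / c\<rceil>"]
      proof eventually_elim
        case (elim k)
        then have "2 / c \<le> real k" by linarith
        then show ?case using that by (intro step_eq_1) (simp add: field_simps)
      qed
    qed
    then have "(\<lambda>k. \<psi> k x) \<longlonglongrightarrow> (\<Prod>i\<in>(Basis::'a set). 1 * 1)"
      unfolding \<psi>_def using True by (intro tendsto_prod tendsto_mult) (auto simp: mem_box)
    then show ?thesis using True by simp
  qed
qed

text \<open>The fundamental lemma of the calculus of variations: test functions approximate indicators of boxes.\<close>
lemma test_fun_orthogonal_imp_AE_0:
  fixes f :: "'a::euclidean_space \<Rightarrow> real"
  assumes f: "L1loc f" and orth: "\<And>\<psi>. test_fun \<psi> \<Longrightarrow> (LINT x|lebesgue. \<psi> x * f x) = 0"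
  shows "AE x in lebesgue. f x = 0"
proof (rule box_integrals_0_imp_AE_0[OF f])
  fix a b :: 'a
  define \<psi> where "\<psi> k x = (\<Prod>i\<in>Basis. step (real k * (x \<bullet> i - a \<bullet> i)) * step (real k * (b \<bullet> i - x \<bullet> i)))" for k x
  note psi = box_indicator_approx[where a = a and b = b, folded \<psi>_def]
  have [measurable]: "f \<in> borel_measurable lebesgue" using f by (simp add: L1loc_def)
  have [measurable]: "\<psi> k \<in> borel_measurable lebesgue" for k
    using test_fun_measurable(1)[OF psi(1)] by auto
  have i: "integrable lebesgue (\<lambda>x. indicator (cbox a b) x *\<^sub>R f x)"
    using f by (auto simp: L1loc_def set_integrable_def)
  have "(\<lambda>k. LINT x|lebesgue. \<psi> k x * f x) \<longlonglongrightarrow> (LINT x|lebesgue. indicator (box a b) x * f x)"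
  proof (rule integral_dominated_convergence[OF _ _ integrable_norm[OF i]])
    show "AE x in lebesgue. (\<lambda>k. \<psi> k x * f x) \<longlonglongrightarrow> indicator (box a b) x * f x"
      by (intro AE_I2 tendsto_mult psi tendsto_const)
    fix k
    show "AE x in lebesgue. norm (\<psi> k x * f x) \<le> norm (indicator (cbox a b) x *\<^sub>R f x)"
    proof (rule AE_I2)
      fix x
      have "\<psi> k x \<le> indicator (cbox a b) x"
        using psi(3)[of k x] box_subset_cbox[of a b]
        by (cases "x \<in> box a b"; cases "x \<in> cbox a b") auto
      then show "norm (\<psi> k x * f x) \<le> norm (indicator (cbox a b) x *\<^sub>R f x)"
        using psi(2)[of k x] by (simp add: abs_mult mult_right_mono)
    qed
    show "(\<lambda>x. \<psi> k x * f x) \<in> borel_measurable lebesgue"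
      by (rule borel_measurable_times) measurable
  qed measurable
  then show "(LINT x|lebesgue. indicator (box a b) x * f x) = 0"
    by (simp add: orth psi(1) LIMSEQ_const_iff)
qed

lemma L1loc_inner: "L1loc V \<Longrightarrow> L1loc (\<lambda>x. V x \<bullet> i)"
  unfolding L1loc_def
  by (auto simp: set_integrable_def intro!: borel_measurable_inner integrable_inner_left)
    (metis (mono_tags, lifting) Bochner_Integration.integrable_cong inner_scaleR_left integrable_inner_left real_scaleR_def)

lemma L1loc_diff: "L1loc V \<Longrightarrow> L1loc W \<Longrightarrow> L1loc (\<lambda>x. V x - W x)"
  unfolding L1loc_def by (auto intro: set_integral_diff)

lemma has_weak_grad_unique:
  fixes u :: "'a::euclidean_space \<Rightarrow> real"
  assumes V: "has_weak_grad u V" and W: "has_weak_grad u W"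
  shows "AE x in lebesgue. V x = W x"
proof -
  have L: "L1loc V" "L1loc W" using assms by (auto simp: has_weak_grad_def)
  have "AE x in lebesgue. (V x - W x) \<bullet> i = 0" if i: "i \<in> Basis" for i
  proof (rule test_fun_orthogonal_imp_AE_0)
    show "L1loc (\<lambda>x. (V x - W x) \<bullet> i)" by (intro L1loc_inner L1loc_diff L)
    fix \<psi> :: "'a \<Rightarrow> real" assume t: "test_fun \<psi>"
    obtain R where R: "\<And>x. R < norm x \<Longrightarrow> \<psi> x = 0" using test_fun_supportE[OF t] by metis
    have "integrable lebesgue (\<lambda>x. \<psi> x * (V x \<bullet> i))" "integrable lebesgue (\<lambda>x. \<psi> x * (W x \<bullet> i))"
      using L1loc_mult_integrable[OF L1loc_inner test_fun_continuous[OF t] R] L by auto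
    moreover have "(LINT x|lebesgue. \<psi> x * (V x \<bullet> i)) = (LINT x|lebesgue. \<psi> x * (W x \<bullet> i))"
      using V W t i by (auto simp: has_weak_grad_def mult.commute)
    ultimately show "(LINT x|lebesgue. \<psi> x * ((V x - W x) \<bullet> i)) = 0"
      by (simp add: inner_diff_left right_diff_distrib)
  qed
  then have "AE x in lebesgue. \<forall>i\<in>Basis. (V x - W x) \<bullet> i = 0"
    by (intro AE_finite_allI) auto
  then show ?thesis
  proof eventually_elim
    case (elim x)
    then have "V x - W x = 0" by (subst euclidean_all_zero_iff[symmetric]) auto
    then show ?case by simp
  qed
qed

text \<open>The energy does not depend on which representative of the weak gradient has been chosen.\<close>
lemma energy_eq:
  assumes "has_weak_grad u V"
  shows "energy p u = (LINT x|lebesgue. norm (V x) powr p)"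
proof -
  have w: "has_weak_grad u (weak_grad u)" unfolding weak_grad_def by (rule someI[of "has_weak_grad u", OF assms])
  have [measurable]: "V \<in> borel_measurable lebesgue" "weak_grad u \<in> borel_measurable lebesgue"
    using assms w by (auto simp: has_weak_grad_def L1loc_def)
  show ?thesis unfolding energy_def
    by (rule integral_cong_AE) (use has_weak_grad_unique[OF assms w] in \<open>auto\<close>)
qed

lemma test_fun_has_weak_grad:
  assumes "test_fun \<phi>" shows "has_weak_grad \<phi> (grad \<phi>)"
  unfolding has_weak_grad_def
proof (intro conjI allI impI ballI)
  show "L1loc \<phi>" "L1loc (grad \<phi>)"
    using assms by (auto intro!: continuous_L1loc test_fun_continuous test_fun_continuous_grad)
  fix \<psi> :: "'a \<Rightarrow> real" and i :: 'a assume psi: "test_fun \<psi>" and i: "i \<in> Basis"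
  note s = test_fun_smooth[OF psi] test_fun_smooth[OF assms]
  have eq: "partial i (\<lambda>x. \<phi> x * \<psi> x) x = \<phi> x * partial i \<psi> x + (grad \<phi> x \<bullet> i) * \<psi> x" for x
    using partial_eq[OF has_derivative_mult[OF smooth_has_derivative[OF s(2)] smooth_has_derivative[OF s(1)]], of i x]
    by (simp add: grad_inner_Basis i)
  obtain R where R: "\<And>x. R < norm x \<Longrightarrow> \<psi> x = 0" "\<And>x. R < norm x \<Longrightarrow> partial i \<psi> x = 0"
    using test_fun_supportE[OF psi] by metis
  have c: "continuous_on UNIV \<phi>" "continuous_on UNIV \<psi>" "continuous_on UNIV (partial i \<psi>)"
    "continuous_on UNIV (grad \<phi>)"
    using s i by (auto intro: smooth_continuous smooth_continuous_grad smooth_partial)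
  have "integrable lebesgue (\<lambda>x. \<phi> x * partial i \<psi> x)"
    by (rule continuous_bounded_support_integrable)
      (use R in \<open>auto intro!: continuous_intros c\<close>)
  moreover have "integrable lebesgue (\<lambda>x. (grad \<phi> x \<bullet> i) * \<psi> x)"
    by (rule continuous_bounded_support_integrable)
      (use R in \<open>auto intro!: continuous_intros c\<close>)
  moreover have "(LINT x|lebesgue. \<phi> x * partial i \<psi> x + (grad \<phi> x \<bullet> i) * \<psi> x) = 0"
    using integral_partial_eq_0(2)[OF test_fun_mult[OF s(2) psi] i] by (simp add: eq)
  ultimately show "(LINT x|lebesgue. \<phi> x * partial i \<psi> x) = - (LINT x|lebesgue. (grad \<phi> x \<bullet> i) * \<psi> x)"
    by simp
qed

lemma energy_test_fun: "test_fun \<phi> \<Longrightarrow> energy p \<phi> = dirichlet p \<phi>"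
  by (simp add: energy_eq[OF test_fun_has_weak_grad] dirichlet_def)

lemma test_fun_beppo_levi: "test_fun \<phi> \<Longrightarrow> \<phi> \<in> beppo_levi p"
proof -
  assume t: "test_fun \<phi>"
  have "grad_norm p (\<lambda>x::'a. 0) = 0"
  proof -
    have "grad (\<lambda>x::'a. 0) x = 0" for x by (rule grad_eqI) simp
    then show ?thesis by (simp add: grad_norm_def)
  qed
  then show ?thesis unfolding beppo_levi_def
    using t by (auto intro!: exI[of _ "\<lambda>_. \<phi>"] continuous_L1loc test_fun_continuous)
qed

section \<open>Convexity of powers and convergence in local \<open>L\<^sup>1\<close>\<close>

text \<open>Strict convexity of \<open>s^p\<close> in the form of the tangent at \<open>m\<close>. Minkowski's inequality, Young's
inequality and uniform convexity are all drawn from it.\<close>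
lemma powr_tangent_less:
  assumes "1 < p" "0 < m" "0 \<le> s" "s \<noteq> m"
  shows "m powr p + p * m powr (p - 1) * (s - m) < s powr (p::real)"
proof (cases "s = 0")
  case True
  have "m powr p = m * m powr (p - 1)" using assms by (simp add: powr_mult_base)
  moreover have "m powr p < p * m powr p" using assms by simp
  ultimately show ?thesis using True assms by (simp add: algebra_simps)
next
  case False
  then have s: "s > 0" using assms by simp
  have d: "((\<lambda>x. x powr p) has_real_derivative p * x powr (p - 1)) (at x)" if "x > 0" for x
    using that by (rule has_real_derivative_powr)
  show ?thesis
  proof (cases "s < m")
    case True
    obtain z where z: "s < z" "z < m" "m powr p - s powr p = (m - s) * (p * z powr (p - 1))"
      using MVT2[OF True, of "\<lambda>x. x powr p" "\<lambda>x. p * x powr (p - 1)"] d s by auto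
    have "z powr (p - 1) < m powr (p - 1)" using z s assms by (intro powr_less_mono2) auto
    then have "(m - s) * (p * z powr (p - 1)) < (m - s) * (p * m powr (p - 1))"
      using True assms by (intro mult_strict_left_mono) auto
    then show ?thesis using z(3) by (simp add: algebra_simps)
  next
    case False
    then have lt: "m < s" using assms by simp
    obtain z where z: "m < z" "z < s" "s powr p - m powr p = (s - m) * (p * z powr (p - 1))"
      using MVT2[OF lt, of "\<lambda>x. x powr p" "\<lambda>x. p * x powr (p - 1)"] d assms by auto
    have "m powr (p - 1) < z powr (p - 1)" using z assms by (intro powr_less_mono2) auto
    then have "(s - m) * (p * m powr (p - 1)) < (s - m) * (p * z powr (p - 1))"
      using lt assms by (intro mult_strict_left_mono) auto
    then show ?thesis using z(3) by (simp add: algebra_simps)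
  qed
qed

lemma powr_tangent_le:
  assumes "1 < p" "0 < m" "0 \<le> s"
  shows "m powr p + p * m powr (p - 1) * (s - m) \<le> s powr (p::real)"
  using powr_tangent_less[OF assms] by (cases "s = m") auto

text \<open>Jensen's inequality for the values \<open>x/a\<close> and \<open>y/b\<close> with the weights \<open>a\<close> and \<open>b\<close>: add the tangents at
\<open>(x+y)/(a+b)\<close>.\<close>
lemma powr_add_le_weighted:
  fixes p :: real
  assumes "1 < p" "0 < a" "0 < b" "0 \<le> x" "0 \<le> y"
  shows "(x + y) powr p \<le> (a + b) powr (p - 1) * (a powr (1 - p) * x powr p + b powr (1 - p) * y powr p)"
proof (cases "x + y = 0")
  case True
  then show ?thesis using assms by (simp add: add_nonneg_eq_0_iff)
next
  case False
  define m where "m = (x + y) / (a + b)"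
  have m: "m > 0" using False assms by (simp add: m_def add_nonneg_eq_0_iff order_less_le)
  have 1: "a * (m powr p + p * m powr (p - 1) * (x / a - m)) \<le> a * (x / a) powr p"
    using assms m by (intro mult_left_mono powr_tangent_le) auto
  have 2: "b * (m powr p + p * m powr (p - 1) * (y / b - m)) \<le> b * (y / b) powr p"
    using assms m by (intro mult_left_mono powr_tangent_le) auto
  have e: "a * (m powr p + p * m powr (p - 1) * (x / a - m)) + b * (m powr p + p * m powr (p - 1) * (y / b - m))
      = (a + b) * m powr p + p * m powr (p - 1) * (x + y - (a + b) * m)"
    using assms by (simp add: field_simps)
  have "x + y - (a + b) * m = 0" using assms by (simp add: m_def)
  with e 1 2 have 3: "(a + b) * m powr p \<le> a * (x / a) powr p + b * (y / b) powr p" by simp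
  have 4: "c * (z / c) powr p = c powr (1 - p) * z powr p" if "c > 0" "z \<ge> 0" for c z
    using that by (simp add: powr_divide powr_diff)
  have "(x + y) powr p = ((a + b) * m) powr p" using assms by (simp add: m_def)
  also have "\<dots> = (a + b) powr (p - 1) * ((a + b) * m powr p)"
    using assms m by (simp add: powr_mult powr_diff)
  also have "\<dots> \<le> (a + b) powr (p - 1) * (a * (x / a) powr p + b * (y / b) powr p)"
    by (intro mult_left_mono 3) auto
  finally show ?thesis using 4 assms by simp
qed

text \<open>With \<open>a\<close> and \<open>b\<close> slightly larger than the two norms, the weighted inequality for powers integrates to
the bound \<open>a + b\<close>. Strictly larger weights also cover norms that vanish.\<close>
lemma powr_minkowski:
  fixes f g :: "'a \<Rightarrow> 'b::{real_normed_vector,second_countable_topology}" and p :: real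
  assumes "1 < p" and [measurable]: "f \<in> borel_measurable M" "g \<in> borel_measurable M"
    and f: "integrable M (\<lambda>x. norm (f x) powr p)" and g: "integrable M (\<lambda>x. norm (g x) powr p)"
  shows "integrable M (\<lambda>x. norm (f x + g x) powr p)"
    "(LINT x|M. norm (f x + g x) powr p) powr (1/p)
      \<le> (LINT x|M. norm (f x) powr p) powr (1/p) + (LINT x|M. norm (g x) powr p) powr (1/p)"
proof -
  have pt: "norm (f x + g x) powr p
      \<le> (a + b) powr (p - 1) * (a powr (1 - p) * norm (f x) powr p + b powr (1 - p) * norm (g x) powr p)"
    if "a > 0" "b > 0" for a b x
  proof -
    have "norm (f x + g x) powr p \<le> (norm (f x) + norm (g x)) powr p"
      using assms(1) by (intro powr_mono2 norm_triangle_ineq) auto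
    also have "\<dots> \<le> (a + b) powr (p - 1) * (a powr (1 - p) * norm (f x) powr p + b powr (1 - p) * norm (g x) powr p)"
      using that assms(1) by (intro powr_add_le_weighted) auto
    finally show ?thesis .
  qed
  have int: "integrable M (\<lambda>x. (a + b) powr (p - 1) * (a powr (1 - p) * norm (f x) powr p + b powr (1 - p) * norm (g x) powr p))"
    for a b :: real
    by (intro integrable_mult_right Bochner_Integration.integrable_add f g)
  show fg: "integrable M (\<lambda>x. norm (f x + g x) powr p)"
    by (rule Bochner_Integration.integrable_bound[OF int[of 1 1]]) (use pt[of 1 1] in auto)
  define I J where "I = (LINT x|M. norm (f x) powr p)" and "J = (LINT x|M. norm (g x) powr p)"
  have IJ: "I \<ge> 0" "J \<ge> 0" by (simp_all add: I_def J_def)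
  have le: "(LINT x|M. norm (f x + g x) powr p) powr (1/p) \<le> a + b"
    if "a > I powr (1/p)" "b > J powr (1/p)" for a b
  proof -
    have pos: "a > 0" "b > 0"
      using le_less_trans[OF powr_ge_zero that(1)] le_less_trans[OF powr_ge_zero that(2)] by auto
    have pw: "(z powr (1/p)) powr p = z" if "z \<ge> 0" for z using that assms(1) by (simp add: powr_powr)
    have "I \<le> a powr p" using powr_mono2[of p "I powr (1/p)" a] that IJ assms(1) by (simp add: pw)
    moreover have "J \<le> b powr p" using powr_mono2[of p "J powr (1/p)" b] that IJ assms(1) by (simp add: pw)
    ultimately have "a powr (1 - p) * I + b powr (1 - p) * J \<le> a powr (1 - p) * a powr p + b powr (1 - p) * b powr p"
      by (intro add_mono mult_left_mono) auto
    also have "\<dots> = a + b" using pos by (simp add: powr_add[symmetric])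
    finally have *: "a powr (1 - p) * I + b powr (1 - p) * J \<le> a + b" .
    have "(LINT x|M. norm (f x + g x) powr p)
      \<le> (LINT x|M. (a + b) powr (p - 1) * (a powr (1 - p) * norm (f x) powr p + b powr (1 - p) * norm (g x) powr p))"
      by (intro integral_mono fg int pt pos)
    also have "\<dots> = (a + b) powr (p - 1) * (a powr (1 - p) * I + b powr (1 - p) * J)"
      using f g by (simp add: I_def J_def)
    also have "\<dots> \<le> (a + b) powr (p - 1) * (a + b)" using * by (intro mult_left_mono) auto
    also have "\<dots> = (a + b) powr p" using pos by (simp add: powr_diff)
    finally have "(LINT x|M. norm (f x + g x) powr p) powr (1/p) \<le> ((a + b) powr p) powr (1/p)"
      using assms(1) by (intro powr_mono2) auto
    then show ?thesis using pos assms(1) by (simp add: powr_powr)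
  qed
  have "(LINT x|M. norm (f x + g x) powr p) powr (1/p) \<le> I powr (1/p) + J powr (1/p) + e" if "e > 0" for e
    using le[of "I powr (1/p) + e/2" "J powr (1/p) + e/2"] that by (simp add: field_simps)
  then have "(LINT x|M. norm (f x + g x) powr p) powr (1/p) \<le> I powr (1/p) + J powr (1/p)"
    by (rule field_le_epsilon)
  then show "(LINT x|M. norm (f x + g x) powr p) powr (1/p)
      \<le> (LINT x|M. norm (f x) powr p) powr (1/p) + (LINT x|M. norm (g x) powr p) powr (1/p)"
    by (simp add: I_def J_def)
qed

lemma ennreal_tendsto_0_iff:
  fixes f :: "'a \<Rightarrow> ennreal"
  shows "(f \<longlongrightarrow> 0) F \<longleftrightarrow> (\<forall>e>0. \<forall>\<^sub>F x in F. f x < ennreal e)"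
proof
  assume "(f \<longlongrightarrow> 0) F"
  then show "\<forall>e>0. \<forall>\<^sub>F x in F. f x < ennreal e" by (auto simp: order_tendsto_iff)
next
  assume *: "\<forall>e>0. \<forall>\<^sub>F x in F. f x < ennreal e"
  show "(f \<longlongrightarrow> 0) F"
  proof (rule order_tendstoI)
    fix a :: ennreal assume "0 < a"
    then obtain e where e: "e > 0" "ennreal e \<le> a"
      by (cases a) (auto intro: that[of 1])
    have "\<forall>\<^sub>F x in F. f x < ennreal e" using * e by blast
    then show "\<forall>\<^sub>F x in F. f x < a" by eventually_elim (use e in auto)
  qed auto
qed

lemma nn_integral_fatou_bound:
  fixes h :: "nat \<Rightarrow> 'a \<Rightarrow> ennreal"
  assumes "\<And>n. h n \<in> borel_measurable M" and "AE x in M. k x \<le> liminf (\<lambda>n. h n x)"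
    and "\<forall>\<^sub>F n in sequentially. (\<integral>\<^sup>+x. h n x \<partial>M) \<le> c n" and "c \<longlonglongrightarrow> C"
  shows "(\<integral>\<^sup>+x. k x \<partial>M) \<le> C"
proof -
  have "(\<integral>\<^sup>+x. k x \<partial>M) \<le> (\<integral>\<^sup>+x. liminf (\<lambda>n. h n x) \<partial>M)" by (intro nn_integral_mono_AE assms)
  also have "\<dots> \<le> liminf (\<lambda>n. \<integral>\<^sup>+x. h n x \<partial>M)" by (intro nn_integral_liminf assms)
  also have "\<dots> \<le> liminf c" by (intro Liminf_mono assms)
  also have "\<dots> = C" using assms(4) by (intro lim_imp_Liminf) auto
  finally show ?thesis .
qed

lemma nn_integral_fatou_tendsto:
  fixes h :: "nat \<Rightarrow> 'a \<Rightarrow> ennreal"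
  assumes "\<And>n. h n \<in> borel_measurable M" and "AE x in M. (\<lambda>n. h n x) \<longlonglongrightarrow> k x"
    and "\<forall>\<^sub>F n in sequentially. (\<integral>\<^sup>+x. h n x \<partial>M) \<le> C"
  shows "(\<integral>\<^sup>+x. k x \<partial>M) \<le> C"
proof (rule nn_integral_fatou_bound[OF assms(1) _ assms(3) tendsto_const])
  show "AE x in M. k x \<le> liminf (\<lambda>n. h n x)"
    using assms(2) by eventually_elim (simp add: lim_imp_Liminf)
qed

text \<open>The \<open>L\<^sup>1\<close> distance on a ball. With values in \<open>ennreal\<close> it needs no integrability assumption.\<close>
definition ldist :: "real \<Rightarrow> ('a::euclidean_space \<Rightarrow> 'b::euclidean_space) \<Rightarrow> ('a \<Rightarrow> 'b) \<Rightarrow> ennreal" where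
  "ldist R f g = (\<integral>\<^sup>+x\<in>cball 0 R. ennreal (norm (f x - g x)) \<partial>lebesgue)"

definition L1loc_tendsto :: "(nat \<Rightarrow> 'a::euclidean_space \<Rightarrow> 'b::euclidean_space) \<Rightarrow> ('a \<Rightarrow> 'b) \<Rightarrow> bool" where
  "L1loc_tendsto f u \<longleftrightarrow> (\<forall>R. (\<lambda>n. ldist R (f n) u) \<longlonglongrightarrow> 0)"

lemma L1loc_measurable: "L1loc f \<Longrightarrow> f \<in> borel_measurable lebesgue" by (simp add: L1loc_def)

lemma ldist_commute: "ldist R f g = ldist R g f"
  by (simp add: ldist_def norm_minus_commute)

lemma ldist_triangle:
  assumes [measurable]: "f \<in> borel_measurable lebesgue" "g \<in> borel_measurable lebesgue" "h \<in> borel_measurable lebesgue"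
  shows "ldist R f h \<le> ldist R f g + ldist R g h"
proof -
  have "ldist R f h \<le> (\<integral>\<^sup>+x. ennreal (norm (f x - g x)) * indicator (cball 0 R) x
      + ennreal (norm (g x - h x)) * indicator (cball 0 R) x \<partial>lebesgue)"
    unfolding ldist_def
  proof (rule nn_integral_mono)
    fix x
    have "ennreal (norm (f x - h x)) \<le> ennreal (norm (f x - g x)) + ennreal (norm (g x - h x))"
      using norm_triangle_ineq[of "f x - g x" "g x - h x"] by (simp flip: ennreal_plus)
    then show "ennreal (norm (f x - h x)) * indicator (cball 0 R) x
      \<le> ennreal (norm (f x - g x)) * indicator (cball 0 R) x + ennreal (norm (g x - h x)) * indicator (cball 0 R) x"
      by (auto split: split_indicator)
  qed
  also have "\<dots> = ldist R f g + ldist R g h" unfolding ldist_def by (rule nn_integral_add) measurable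
  finally show ?thesis .
qed

lemma ldist_mono: "R \<le> S \<Longrightarrow> ldist R f g \<le> ldist S f g"
  unfolding ldist_def by (intro nn_integral_mono) (auto split: split_indicator)

lemma L1loc_iff:
  fixes f :: "'a::euclidean_space \<Rightarrow> 'b::euclidean_space"
  shows "L1loc f \<longleftrightarrow> f \<in> borel_measurable lebesgue \<and> (\<forall>R. ldist R f (\<lambda>_. 0) < \<infinity>)"
proof (safe)
  assume f: "L1loc f"
  then show "f \<in> borel_measurable lebesgue" by (rule L1loc_measurable)
  fix R
  have "integrable lebesgue (\<lambda>x. indicator (cball 0 R) x *\<^sub>R f x)"
    using f by (auto simp: L1loc_def set_integrable_def)
  then have "(\<integral>\<^sup>+x. ennreal (norm (indicator (cball 0 R) x *\<^sub>R f x)) \<partial>lebesgue) < \<infinity>"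
    by (simp add: integrable_iff_bounded)
  also have "(\<integral>\<^sup>+x. ennreal (norm (indicator (cball 0 R) x *\<^sub>R f x)) \<partial>lebesgue) = ldist R f (\<lambda>_. 0)"
    unfolding ldist_def by (intro nn_integral_cong) (simp split: split_indicator)
  finally show "ldist R f (\<lambda>_. 0) < \<infinity>" .
next
  assume [measurable]: "f \<in> borel_measurable lebesgue" and fin: "\<forall>R. ldist R f (\<lambda>_. 0) < \<infinity>"
  have "set_integrable lebesgue K f" if "compact K" for K
  proof -
    from compact_imp_bounded[OF that] obtain R where R: "\<And>x. x \<in> K \<Longrightarrow> norm x \<le> R" unfolding bounded_iff by blast
    then have R: "K \<subseteq> cball 0 R" by auto
    have "(\<integral>\<^sup>+x. ennreal (norm (indicator (cball 0 R) x *\<^sub>R f x)) \<partial>lebesgue) = ldist R f (\<lambda>_. 0)"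
      unfolding ldist_def by (intro nn_integral_cong) (simp split: split_indicator)
    then have "set_integrable lebesgue (cball 0 R) f"
      using fin by (simp add: set_integrable_def integrable_iff_bounded)
    then show ?thesis by (rule set_integrable_subset) (use that R in \<open>auto simp: borel_compact\<close>)
  qed
  then show "L1loc f" by (simp add: L1loc_def)
qed

lemma ldist_eq_0_imp_AE:
  assumes [measurable]: "f \<in> borel_measurable lebesgue" "g \<in> borel_measurable lebesgue"
    and 0: "\<And>R. ldist R f g = 0"
  shows "AE x in lebesgue. f x = g x"
proof -
  have "AE x in lebesgue. ennreal (norm (f x - g x)) * indicator (cball 0 (real n)) x = 0" for n :: nat
    using 0[of n] unfolding ldist_def by (subst (asm) nn_integral_0_iff_AE) auto
  then have "AE x in lebesgue. \<forall>n::nat. ennreal (norm (f x - g x)) * indicator (cball 0 (real n)) x = 0"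
    by (subst AE_all_countable) blast
  then show ?thesis
  proof eventually_elim
    case (elim x)
    obtain n :: nat where "norm x \<le> n" using real_arch_simple by blast
    then show ?case using elim[rule_format, of n] by simp
  qed
qed

text \<open>The \<open>k\<close>-th increment of the subsequence is at most \<open>(1/2)^k\<close> on the ball of radius \<open>k\<close>. The increments,
each cut off to its ball, are then summable in \<open>L\<^sup>1\<close> of the whole space, hence almost everywhere, and
every point lies in all but finitely many of the balls. One choice thus serves all balls at once.\<close>
lemma L1loc_Cauchy_convergent:
  fixes f :: "nat \<Rightarrow> 'a::euclidean_space \<Rightarrow> 'b::euclidean_space"
  assumes f: "\<And>n. L1loc (f n)"
    and cauchy: "\<And>R e. 0 < e \<Longrightarrow> \<exists>M. \<forall>m\<ge>M. \<forall>n\<ge>M. ldist R (f m) (f n) \<le> ennreal e"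
  obtains u s where "L1loc u" "strict_mono s" "AE x in lebesgue. (\<lambda>n. f (s n) x) \<longlonglongrightarrow> u x"
    "L1loc_tendsto f u"
proof -
  have [measurable]: "f n \<in> borel_measurable lebesgue" for n using f by (rule L1loc_measurable)
  have "\<exists>M. \<forall>m\<ge>M. \<forall>n\<ge>M. ldist (real k) (f m) (f n) \<le> ennreal ((1/2)^k)" for k :: nat
    by (rule cauchy) simp
  then obtain N where N: "\<And>k m n. m \<ge> N k \<Longrightarrow> n \<ge> N k \<Longrightarrow> ldist (real k) (f m) (f n) \<le> ennreal ((1/2)^k)"
    by metis
  define s where "s k = (\<Sum>i\<le>k. Suc (N i))" for k
  have s: "strict_mono s" unfolding s_def strict_mono_Suc_iff by simp
  have sN: "N k \<le> s k" for k
    using sum_nonneg_leq_bound[of "{..k}" "\<lambda>i. Suc (N i)" "s k" k] unfolding s_def by force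
  define D where "D k x = norm (f (s (Suc k)) x - f (s k) x) * indicator (cball 0 (real k)) x" for k x
  have [measurable]: "D k \<in> borel_measurable lebesgue" for k unfolding D_def[abs_def] by measurable
  have D: "(\<integral>\<^sup>+x. ennreal (D k x) \<partial>lebesgue) \<le> ennreal ((1/2)^k)" for k
  proof -
    have "(\<integral>\<^sup>+x. ennreal (D k x) \<partial>lebesgue) = ldist (real k) (f (s (Suc k))) (f (s k))"
      unfolding ldist_def D_def by (intro nn_integral_cong) (simp split: split_indicator)
    also have "\<dots> \<le> ennreal ((1/2)^k)"
      using sN[of k] strict_mono_less_eq[OF s, of k "Suc k"] by (intro N) auto
    finally show ?thesis .
  qed
  have "(\<integral>\<^sup>+x. (\<Sum>k. ennreal (D k x)) \<partial>lebesgue) = (\<Sum>k. \<integral>\<^sup>+x. ennreal (D k x) \<partial>lebesgue)"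
    by (rule nn_integral_suminf) measurable
  also have "\<dots> \<le> (\<Sum>k. ennreal ((1/2)^k))" by (intro suminf_le D) auto
  also have "\<dots> = ennreal (\<Sum>k. (1/2)^k)" by (intro suminf_ennreal2) auto
  also have "\<dots> < \<infinity>" by simp
  finally have "AE x in lebesgue. (\<Sum>k. ennreal (D k x)) \<noteq> \<infinity>"
    by (intro nn_integral_PInf_AE) auto
  then have conv: "AE x in lebesgue. convergent (\<lambda>k. f (s k) x)"
  proof eventually_elim
    case (elim x)
    then have "summable (\<lambda>k. D k x)" by (intro summable_suminf_not_top) (auto simp: D_def)
    moreover obtain K :: nat where K: "norm x \<le> K" using real_arch_simple by blast
    have "\<forall>\<^sub>F k in sequentially. D k x = norm (f (s (Suc k)) x - f (s k) x)"
      using eventually_ge_at_top[of K]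
    proof eventually_elim
      case (elim k)
      then have "norm x \<le> real k" using K by linarith
      then show ?case by (simp add: D_def)
    qed
    ultimately have "summable (\<lambda>k. norm (f (s (Suc k)) x - f (s k) x))"
      by (simp add: summable_cong)
    then have "summable (\<lambda>k. f (s (Suc k)) x - f (s k) x)" by (rule summable_norm_cancel)
    then have "convergent (\<lambda>n. (\<Sum>k<n. f (s (Suc k)) x - f (s k) x))" by (simp add: summable_iff_convergent)
    then have "convergent (\<lambda>n. (f (s n) x - f (s 0) x) + f (s 0) x)"
      unfolding sum_lessThan_telescope[of "\<lambda>k. f (s k) x"] by (intro convergent_add convergent_const)
    then show ?case by simp
  qed
  define u where "u x = lim (\<lambda>k. f (s k) x)" for x
  have [measurable]: "u \<in> borel_measurable lebesgue" unfolding u_def[abs_def] by measurable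
  have ae: "AE x in lebesgue. (\<lambda>k. f (s k) x) \<longlonglongrightarrow> u x"
    using conv by eventually_elim (simp add: u_def convergent_LIMSEQ_iff)
  have close: "\<exists>M. \<forall>n\<ge>M. ldist R (f n) u \<le> ennreal e" if e: "e > 0" for R e
  proof -
    obtain M where M: "\<And>m n. m \<ge> M \<Longrightarrow> n \<ge> M \<Longrightarrow> ldist R (f m) (f n) \<le> ennreal e" using cauchy[OF e] by metis
    have "ldist R (f n) u \<le> ennreal e" if "n \<ge> M" for n
      unfolding ldist_def
    proof (rule nn_integral_fatou_tendsto)
      show "AE x in lebesgue. (\<lambda>k. ennreal (norm (f n x - f (s k) x)) * indicator (cball 0 R) x)
          \<longlonglongrightarrow> ennreal (norm (f n x - u x)) * indicator (cball 0 R) x"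
        using ae
      proof eventually_elim
        case (elim x)
        have "(\<lambda>k. ennreal (norm (f n x - f (s k) x))) \<longlonglongrightarrow> ennreal (norm (f n x - u x))"
          by (intro tendsto_ennrealI tendsto_norm tendsto_diff tendsto_const elim)
        then show ?case by (auto split: split_indicator)
      qed
      show "\<forall>\<^sub>F k in sequentially. set_nn_integral lebesgue (cball 0 R) (\<lambda>x. ennreal (norm (f n x - f (s k) x))) \<le> ennreal e"
        using eventually_ge_at_top[of M]
      proof eventually_elim
        case (elim k)
        then have "s k \<ge> M" using seq_suble[OF s, of k] by simp
        then show ?case using M[OF that, of "s k"] by (simp add: ldist_def)
      qed
    qed measurable
    then show ?thesis by blast
  qed
  have "L1loc u" unfolding L1loc_iff
  proof safe
    fix R
    obtain M where M: "ldist R (f M) u \<le> ennreal 1" using close[of 1 R] by auto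
    have "ldist R u (\<lambda>_. 0) \<le> ldist R u (f M) + ldist R (f M) (\<lambda>_. 0)" by (intro ldist_triangle) measurable
    also have "\<dots> < \<infinity>" using M f[of M] by (auto simp: L1loc_iff ldist_commute[of R u] less_top[symmetric] top_unique)
    finally show "ldist R u (\<lambda>_. 0) < \<infinity>" .
  qed measurable
  moreover have "L1loc_tendsto f u" unfolding L1loc_tendsto_def ennreal_tendsto_0_iff
  proof safe
    fix R e :: real assume "e > 0"
    then obtain M where M: "\<forall>n\<ge>M. ldist R (f n) u \<le> ennreal (e/2)" using close[of "e/2" R] by auto
    show "\<forall>\<^sub>F n in sequentially. ldist R (f n) u < ennreal e"
      using eventually_ge_at_top[of M]
    proof eventually_elim
      case (elim n)
      then have "ldist R (f n) u \<le> ennreal (e/2)" using M by blast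
      also have "\<dots> < ennreal e" using \<open>e > 0\<close> by (intro ennreal_lessI) auto
      finally show ?case .
    qed
  qed
  ultimately show ?thesis using that s ae by blast
qed

lemma L1loc_tendsto_Cauchy:
  assumes f: "\<And>n. L1loc (f n)" and u: "L1loc u" and lim: "L1loc_tendsto f u" and e: "0 < e"
  shows "\<exists>M. \<forall>m\<ge>M. \<forall>n\<ge>M. ldist R (f m) (f n) \<le> ennreal e"
proof -
  have "\<forall>\<^sub>F n in sequentially. ldist R (f n) u < ennreal (e/2)"
    using lim e unfolding L1loc_tendsto_def ennreal_tendsto_0_iff by simp
  then obtain M where M: "\<And>n. n \<ge> M \<Longrightarrow> ldist R (f n) u < ennreal (e/2)"
    unfolding eventually_sequentially by blast
  have "ldist R (f m) (f n) \<le> ennreal e" if "m \<ge> M" "n \<ge> M" for m n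
  proof -
    have "ldist R (f m) (f n) \<le> ldist R (f m) u + ldist R u (f n)"
      by (intro ldist_triangle L1loc_measurable f u)
    also have "\<dots> \<le> ennreal (e/2) + ennreal (e/2)"
      using M[OF that(1)] M[OF that(2)] by (intro add_mono) (auto simp: ldist_commute[of R u])
    also have "\<dots> = ennreal e" using e by (simp flip: ennreal_plus)
    finally show ?thesis .
  qed
  then show ?thesis by blast
qed

lemma L1loc_tendsto_AE_subseq:
  assumes f: "\<And>n. L1loc (f n)" and u: "L1loc u" and lim: "L1loc_tendsto f u"
  obtains s where "strict_mono s" "AE x in lebesgue. (\<lambda>n. f (s n) x) \<longlonglongrightarrow> u x"
proof -
  obtain v s where v: "L1loc v" "strict_mono s" "AE x in lebesgue. (\<lambda>n. f (s n) x) \<longlonglongrightarrow> v x" "L1loc_tendsto f v"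
    using L1loc_Cauchy_convergent[OF f L1loc_tendsto_Cauchy[OF assms]] by metis
  have "AE x in lebesgue. u x = v x"
  proof (rule ldist_eq_0_imp_AE)
    fix R
    have "(\<lambda>n. ldist R (f n) u + ldist R (f n) v) \<longlonglongrightarrow> 0 + 0"
      using lim v(4) unfolding L1loc_tendsto_def by (intro tendsto_add) auto
    moreover have "ldist R u v \<le> ldist R (f n) u + ldist R (f n) v" for n
      using ldist_triangle[of u "f n" v R] L1loc_measurable f u v(1) by (metis ldist_commute)
    ultimately have "ldist R u v \<le> 0 + 0" by (intro LIMSEQ_le_const) auto
    then show "ldist R u v = 0" by simp
  qed (use u v L1loc_measurable in auto)
  with v(3) have "AE x in lebesgue. (\<lambda>n. f (s n) x) \<longlonglongrightarrow> u x" by eventually_elim simp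
  then show ?thesis using that v(2) by blast
qed

lemma L1loc_tendsto_iff_set_integral:
  fixes u :: "'a::euclidean_space \<Rightarrow> real"
  assumes f: "\<And>n. L1loc (f n)" and u: "L1loc u"
  shows "L1loc_tendsto f u \<longleftrightarrow> (\<forall>K. compact K \<longrightarrow> (\<lambda>k. LINT x:K|lebesgue. \<bar>f k x - u x\<bar>) \<longlonglongrightarrow> 0)"
proof -
  have [measurable]: "f n \<in> borel_measurable lebesgue" "u \<in> borel_measurable lebesgue" for n
    using f u by (auto intro: L1loc_measurable)
  have int: "set_integrable lebesgue K (\<lambda>x. \<bar>f n x - u x\<bar>)" if "compact K" for K n
    using set_integrable_abs[OF set_integral_diff(1)[of lebesgue K "f n" u]] f u that by (auto simp: L1loc_def)
  have eq: "ldist R (f n) u = ennreal (LINT x:cball 0 R|lebesgue. \<bar>f n x - u x\<bar>)" for R n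
  proof -
    have "ldist R (f n) u = (\<integral>\<^sup>+x. ennreal (indicator (cball 0 R) x *\<^sub>R \<bar>f n x - u x\<bar>) \<partial>lebesgue)"
      unfolding ldist_def by (intro nn_integral_cong) (simp split: split_indicator)
    also have "\<dots> = ennreal (LINT x|lebesgue. indicator (cball 0 R) x *\<^sub>R \<bar>f n x - u x\<bar>)"
      using int[OF compact_cball] unfolding set_integrable_def by (intro nn_integral_eq_integral) auto
    finally show ?thesis by (simp add: set_lebesgue_integral_def)
  qed
  have nn: "0 \<le> (LINT x:K|lebesgue. \<bar>f n x - u x\<bar>)" for K n
    unfolding set_lebesgue_integral_def by (intro integral_nonneg_AE) auto
  have iff: "(\<lambda>n. ldist R (f n) u) \<longlonglongrightarrow> 0 \<longleftrightarrow> (\<lambda>n. LINT x:cball 0 R|lebesgue. \<bar>f n x - u x\<bar>) \<longlonglongrightarrow> 0" for R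
    unfolding eq ennreal_0[symmetric] by (rule tendsto_ennreal_iff) (use nn in auto)
  show ?thesis
  proof
    assume "\<forall>K. compact K \<longrightarrow> (\<lambda>k. LINT x:K|lebesgue. \<bar>f k x - u x\<bar>) \<longlonglongrightarrow> 0"
    then show "L1loc_tendsto f u" unfolding L1loc_tendsto_def iff by auto
  next
    assume L: "L1loc_tendsto f u"
    show "\<forall>K. compact K \<longrightarrow> (\<lambda>k. LINT x:K|lebesgue. \<bar>f k x - u x\<bar>) \<longlonglongrightarrow> 0"
    proof safe
      fix K :: "'a set" assume K: "compact K"
      from compact_imp_bounded[OF K] obtain R where R: "\<And>x. x \<in> K \<Longrightarrow> norm x \<le> R" unfolding bounded_iff by blast
    then have R: "K \<subseteq> cball 0 R" by auto
      show "(\<lambda>k. LINT x:K|lebesgue. \<bar>f k x - u x\<bar>) \<longlonglongrightarrow> 0"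
      proof (rule tendsto_sandwich[of "\<lambda>_. 0"])
        show "(\<lambda>n. LINT x:cball 0 R|lebesgue. \<bar>f n x - u x\<bar>) \<longlonglongrightarrow> 0"
          using L iff by (simp add: L1loc_tendsto_def)
        show "\<forall>\<^sub>F n in sequentially. (LINT x:K|lebesgue. \<bar>f n x - u x\<bar>) \<le> (LINT x:cball 0 R|lebesgue. \<bar>f n x - u x\<bar>)"
          using R int[OF K] int[OF compact_cball] K unfolding set_lebesgue_integral_def set_integrable_def
          by (intro always_eventually allI integral_mono) (auto split: split_indicator)
      qed (use nn in auto)
    qed
  qed
qed

text \<open>Bounds a local \<open>L\<^sup>1\<close> distance by a global \<open>L\<^sup>p\<close> distance and an error proportional to an arbitrarily
small \<open>e\<close>.\<close>
lemma norm_le_powr_split: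
  assumes "1 \<le> p" "0 < e" "0 \<le> a"
  shows "a \<le> e + e powr (1 - p) * a powr (p::real)"
proof (cases "a \<le> e")
  case True
  then show ?thesis using assms by (simp add: add_increasing2)
next
  case False
  have "a = a powr (1 - p) * a powr p" using False assms by (simp flip: powr_add)
  also have "\<dots> \<le> e powr (1 - p) * a powr p"
    using False assms by (intro mult_right_mono powr_mono2') auto
  finally show ?thesis using assms by linarith
qed

lemma ldist_le_powr:
  fixes f g :: "'a::euclidean_space \<Rightarrow> 'b::euclidean_space"
  assumes "1 \<le> p" "0 < e" and [measurable]: "f \<in> borel_measurable lebesgue" "g \<in> borel_measurable lebesgue"
  shows "ldist R f g \<le> ennreal (e * measure lebesgue (cball (0::'a) R))
     + ennreal (e powr (1 - p)) * (\<integral>\<^sup>+x. ennreal (norm (f x - g x) powr p) \<partial>lebesgue)"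
proof -
  have "ldist R f g \<le> (\<integral>\<^sup>+x. ennreal e * indicator (cball 0 R) x
      + ennreal (e powr (1 - p)) * ennreal (norm (f x - g x) powr p) \<partial>lebesgue)"
    unfolding ldist_def
  proof (rule nn_integral_mono)
    fix x
    have "ennreal (norm (f x - g x)) \<le> ennreal e + ennreal (e powr (1 - p)) * ennreal (norm (f x - g x) powr p)"
      using norm_le_powr_split[OF assms(1,2), of "norm (f x - g x)"] assms(2)
      by (simp flip: ennreal_plus ennreal_mult)
    then show "ennreal (norm (f x - g x)) * indicator (cball 0 R) x \<le> ennreal e * indicator (cball 0 R) x
      + ennreal (e powr (1 - p)) * ennreal (norm (f x - g x) powr p)"
      by (auto split: split_indicator)
  qed
  also have "\<dots> = ennreal e * emeasure lebesgue (cball (0::'a) R)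
     + ennreal (e powr (1 - p)) * (\<integral>\<^sup>+x. ennreal (norm (f x - g x) powr p) \<partial>lebesgue)"
    by (simp add: nn_integral_add nn_integral_cmult nn_integral_cmult_indicator)
  also have "emeasure lebesgue (cball (0::'a) R) = ennreal (measure lebesgue (cball (0::'a) R))"
    by (intro emeasure_eq_ennreal_measure fmeasurableD2 lmeasurable_cball)
  finally show ?thesis using assms(2) by (simp add: ennreal_mult)
qed

text \<open>The Riesz-Fischer theorem. The limit comes from local \<open>L\<^sup>1\<close> convergence, and Fatou's lemma along the
subsequence that converges almost everywhere upgrades it to convergence in \<open>L\<^sup>p\<close>.\<close>
lemma Lp_Cauchy_convergent:
  fixes V :: "nat \<Rightarrow> 'a::euclidean_space \<Rightarrow> 'b::euclidean_space"
  assumes p: "1 \<le> p" and V: "\<And>n. L1loc (V n)"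
    and cauchy: "\<And>e. 0 < e \<Longrightarrow> \<exists>M. \<forall>m\<ge>M. \<forall>n\<ge>M. (\<integral>\<^sup>+x. ennreal (norm (V m x - V n x) powr p) \<partial>lebesgue) \<le> ennreal e"
  obtains W where "L1loc W" "L1loc_tendsto V W" "(\<lambda>n. \<integral>\<^sup>+x. ennreal (norm (V n x - W x) powr p) \<partial>lebesgue) \<longlonglongrightarrow> 0"
proof -
  have [measurable]: "V n \<in> borel_measurable lebesgue" for n using V by (rule L1loc_measurable)
  have "\<exists>M. \<forall>m\<ge>M. \<forall>n\<ge>M. ldist R (V m) (V n) \<le> ennreal e" if e: "0 < e" for R e
  proof -
    define B where "B = measure lebesgue (cball (0::'a) R)"
    define d where "d = e / 2 / (B + 1)"
    have B: "B \<ge> 0" by (simp add: B_def)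
    have d: "d > 0" using e B by (simp add: d_def)
    have dB: "d * B \<le> e / 2" using e B by (simp add: d_def field_simps)
    define d' where "d' = e / 2 / d powr (1 - p)"
    have d': "d' > 0" using e d by (simp add: d'_def)
    obtain M where M: "\<And>m n. m \<ge> M \<Longrightarrow> n \<ge> M \<Longrightarrow> (\<integral>\<^sup>+x. ennreal (norm (V m x - V n x) powr p) \<partial>lebesgue) \<le> ennreal d'"
      using cauchy[OF d'] by metis
    have "ldist R (V m) (V n) \<le> ennreal e" if "m \<ge> M" "n \<ge> M" for m n
    proof -
      have "ldist R (V m) (V n) \<le> ennreal (d * B) + ennreal (d powr (1 - p)) * (\<integral>\<^sup>+x. ennreal (norm (V m x - V n x) powr p) \<partial>lebesgue)"
        unfolding B_def by (rule ldist_le_powr) (use p d in auto)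
      also have "\<dots> \<le> ennreal (e / 2) + ennreal (d powr (1 - p)) * ennreal d'"
        using M[OF that] dB by (intro add_mono mult_left_mono ennreal_leI) auto
      also have "ennreal (d powr (1 - p)) * ennreal d' = ennreal (d powr (1 - p) * d')"
        using d' by (intro ennreal_mult[symmetric]) auto
      also have "d powr (1 - p) * d' = e / 2" using d by (simp add: d'_def)
      also have "ennreal (e / 2) + ennreal (e / 2) = ennreal (e / 2 + e / 2)"
        using e by (intro ennreal_plus[symmetric]) auto
      finally show ?thesis by simp
    qed
    then show ?thesis by blast
  qed
  then obtain W s where W: "L1loc W" "strict_mono s" "AE x in lebesgue. (\<lambda>n. V (s n) x) \<longlonglongrightarrow> W x" "L1loc_tendsto V W"
    by (rule L1loc_Cauchy_convergent[OF V])
  have [measurable]: "W \<in> borel_measurable lebesgue" using W(1) by (rule L1loc_measurable)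
  have "(\<lambda>n. \<integral>\<^sup>+x. ennreal (norm (V n x - W x) powr p) \<partial>lebesgue) \<longlonglongrightarrow> 0"
    unfolding ennreal_tendsto_0_iff
  proof safe
    fix e :: real assume e: "e > 0"
    obtain M where M: "\<And>m n. m \<ge> M \<Longrightarrow> n \<ge> M \<Longrightarrow> (\<integral>\<^sup>+x. ennreal (norm (V m x - V n x) powr p) \<partial>lebesgue) \<le> ennreal (e/2)"
      using cauchy[of "e/2"] e by auto
    show "\<forall>\<^sub>F n in sequentially. (\<integral>\<^sup>+x. ennreal (norm (V n x - W x) powr p) \<partial>lebesgue) < ennreal e"
      using eventually_ge_at_top[of M]
    proof eventually_elim
      case (elim n)
      have "(\<integral>\<^sup>+x. ennreal (norm (V n x - W x) powr p) \<partial>lebesgue) \<le> ennreal (e/2)"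
      proof (rule nn_integral_fatou_tendsto)
        show "AE x in lebesgue. (\<lambda>k. ennreal (norm (V n x - V (s k) x) powr p)) \<longlonglongrightarrow> ennreal (norm (V n x - W x) powr p)"
          using W(3)
        proof eventually_elim
          case (elim x)
          have "(\<lambda>k. norm (V n x - V (s k) x) powr p) \<longlonglongrightarrow> norm (V n x - W x) powr p"
            using p by (intro tendsto_powr2 tendsto_norm tendsto_diff elim tendsto_const) auto
          then show ?case by (rule tendsto_ennrealI)
        qed
        show "\<forall>\<^sub>F k in sequentially. (\<integral>\<^sup>+x. ennreal (norm (V n x - V (s k) x) powr p) \<partial>lebesgue) \<le> ennreal (e/2)"
          using eventually_ge_at_top[of M]
        proof eventually_elim
          case (elim k)
          then have "s k \<ge> M" using seq_suble[OF W(2), of k] by simp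
          then show ?case using M[OF \<open>M \<le> n\<close>] by blast
        qed
      qed measurable
      also have "\<dots> < ennreal e" using e by (intro ennreal_lessI) auto
      finally show ?case .
    qed
  qed
  then show ?thesis using that W by blast
qed

section \<open>The energy as a limit over test functions\<close>

lemma L1loc_tendsto_integral:
  fixes f :: "nat \<Rightarrow> 'a::euclidean_space \<Rightarrow> 'b::euclidean_space"
  assumes f: "\<And>n. L1loc (f n)" and u: "L1loc u" and lim: "L1loc_tendsto f u"
    and w: "continuous_on UNIV w" "\<And>x. R < norm x \<Longrightarrow> w x = (0::real)"
  shows "(\<lambda>n. LINT x|lebesgue. w x *\<^sub>R f n x) \<longlonglongrightarrow> (LINT x|lebesgue. w x *\<^sub>R u x)"
proof (rule tendsto_L1_int)
  show "integrable lebesgue (\<lambda>x. w x *\<^sub>R f n x)" for n by (rule L1loc_mult_integrable[OF f w])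
  show "integrable lebesgue (\<lambda>x. w x *\<^sub>R u x)" by (rule L1loc_mult_integrable[OF u w])
  obtain C where C: "C > 0" "\<And>x. norm (w x) \<le> C" using continuous_bounded_support[OF w] by blast
  have [measurable]: "f n \<in> borel_measurable lebesgue" "u \<in> borel_measurable lebesgue" for n
    using f u by (auto intro: L1loc_measurable)
  have le: "(\<integral>\<^sup>+x. ennreal (norm (w x *\<^sub>R f n x - w x *\<^sub>R u x)) \<partial>lebesgue) \<le> ennreal C * ldist R (f n) u" for n
  proof -
    have "(\<integral>\<^sup>+x. ennreal (norm (w x *\<^sub>R f n x - w x *\<^sub>R u x)) \<partial>lebesgue)
      \<le> (\<integral>\<^sup>+x. ennreal C * (ennreal (norm (f n x - u x)) * indicator (cball 0 R) x) \<partial>lebesgue)"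
    proof (rule nn_integral_mono)
      fix x
      have e: "norm (w x *\<^sub>R f n x - w x *\<^sub>R u x) = norm (w x) * norm (f n x - u x)"
        by (simp flip: scaleR_diff_right)
      show "ennreal (norm (w x *\<^sub>R f n x - w x *\<^sub>R u x)) \<le> ennreal C * (ennreal (norm (f n x - u x)) * indicator (cball 0 R) x)"
      proof (cases "norm x \<le> R")
        case True
        have "norm (w x) * norm (f n x - u x) \<le> C * norm (f n x - u x)"
          by (intro mult_right_mono C) auto
        then show ?thesis using True C(1) unfolding e by (simp add: ennreal_mult[symmetric])
      next
        case False
        then show ?thesis by (simp add: w(2))
      qed
    qed
    also have "\<dots> = ennreal C * ldist R (f n) u" unfolding ldist_def by (rule nn_integral_cmult) measurable
    finally show ?thesis .
  qed
  have "(\<lambda>n. ennreal C * ldist R (f n) u) \<longlonglongrightarrow> ennreal C * 0"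
    using lim by (intro ennreal_tendsto_cmult) (auto simp: L1loc_tendsto_def)
  then have l: "(\<lambda>n. ennreal C * ldist R (f n) u) \<longlonglongrightarrow> 0" by simp
  show "(\<lambda>n. \<integral>\<^sup>+x. ennreal (norm (w x *\<^sub>R f n x - w x *\<^sub>R u x)) \<partial>lebesgue) \<longlonglongrightarrow> 0"
    by (rule tendsto_sandwich[OF _ _ tendsto_const l]) (auto intro!: always_eventually le)
qed

lemma weak_grad_limit:
  fixes u :: "'a::euclidean_space \<Rightarrow> real"
  assumes t: "\<And>k. test_fun (\<phi> k)" and u: "L1loc u" "L1loc_tendsto \<phi> u"
    and W: "L1loc W" "L1loc_tendsto (\<lambda>k. grad (\<phi> k)) W"
  shows "has_weak_grad u W"
  unfolding has_weak_grad_def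
proof (intro conjI allI impI ballI u W)
  fix \<psi> :: "'a \<Rightarrow> real" and i :: 'a assume psi: "test_fun \<psi>" and i: "i \<in> Basis"
  obtain R where R: "\<And>x. R < norm x \<Longrightarrow> \<psi> x = 0" "\<And>x. R < norm x \<Longrightarrow> partial i \<psi> x = 0"
    using test_fun_supportE[OF psi] by metis
  have L: "L1loc (\<phi> k)" "L1loc (grad (\<phi> k))" for k
    using t by (auto intro: continuous_L1loc test_fun_continuous test_fun_continuous_grad)
  have "(\<lambda>k. LINT x|lebesgue. partial i \<psi> x *\<^sub>R \<phi> k x) \<longlonglongrightarrow> (LINT x|lebesgue. partial i \<psi> x *\<^sub>R u x)"
    by (rule L1loc_tendsto_integral[OF L(1) u _ R(2)])
      (intro smooth_continuous smooth_partial test_fun_smooth psi i)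
  then have 1: "(\<lambda>k. LINT x|lebesgue. \<phi> k x * partial i \<psi> x) \<longlonglongrightarrow> (LINT x|lebesgue. u x * partial i \<psi> x)"
    by (simp add: mult.commute)
  have "(\<lambda>k. LINT x|lebesgue. \<psi> x *\<^sub>R grad (\<phi> k) x) \<longlonglongrightarrow> (LINT x|lebesgue. \<psi> x *\<^sub>R W x)"
    by (rule L1loc_tendsto_integral[OF L(2) W _ R(1)]) (rule test_fun_continuous[OF psi])
  then have "(\<lambda>k. (LINT x|lebesgue. \<psi> x *\<^sub>R grad (\<phi> k) x) \<bullet> i) \<longlonglongrightarrow> (LINT x|lebesgue. \<psi> x *\<^sub>R W x) \<bullet> i"
    by (intro tendsto_inner tendsto_const)
  moreover have "(LINT x|lebesgue. \<psi> x *\<^sub>R V x) \<bullet> i = (LINT x|lebesgue. (V x \<bullet> i) * \<psi> x)" if "L1loc V" for V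
    using L1loc_mult_integrable[OF that test_fun_continuous[OF psi] R(1)]
    by (subst integral_inner_left[symmetric]) (auto simp: mult.commute)
  ultimately have 2: "(\<lambda>k. LINT x|lebesgue. (grad (\<phi> k) x \<bullet> i) * \<psi> x) \<longlonglongrightarrow> (LINT x|lebesgue. (W x \<bullet> i) * \<psi> x)"
    using L W by simp
  have "(LINT x|lebesgue. \<phi> k x * partial i \<psi> x) = - (LINT x|lebesgue. (grad (\<phi> k) x \<bullet> i) * \<psi> x)" for k
    using test_fun_has_weak_grad[OF t[of k]] psi i by (auto simp: has_weak_grad_def)
  with 1 have "(\<lambda>k. - (LINT x|lebesgue. (grad (\<phi> k) x \<bullet> i) * \<psi> x)) \<longlonglongrightarrow> (LINT x|lebesgue. u x * partial i \<psi> x)"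
    by simp
  from LIMSEQ_unique[OF this tendsto_minus[OF 2]]
  show "(LINT x|lebesgue. u x * partial i \<psi> x) = - (LINT x|lebesgue. (W x \<bullet> i) * \<psi> x)" .
qed

lemma grad_norm_dirichlet: "grad_norm p \<phi> = dirichlet p \<phi> powr (1/p)"
  by (simp add: grad_norm_def dirichlet_def)

text \<open>The gradients converge in \<open>L\<^sup>p\<close> to a limit that is the weak gradient of \<open>u\<close>, since both sides of the
integration by parts formula pass to the limit; Minkowski's inequality makes the norms converge.\<close>
lemma dirichlet_Cauchy_limit:
  fixes u :: "'a::euclidean_space \<Rightarrow> real"
  assumes p: "1 < p" and t: "\<And>k. test_fun (\<phi> k)" and u: "L1loc u" "L1loc_tendsto \<phi> u"
    and cauchy: "\<And>e. 0 < e \<Longrightarrow> \<exists>M. \<forall>m\<ge>M. \<forall>n\<ge>M. dirichlet p (\<lambda>x. \<phi> m x - \<phi> n x) < e"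
  shows "u \<in> beppo_levi p" "(\<lambda>k. dirichlet p (\<phi> k)) \<longlonglongrightarrow> energy p u"
proof -
  have L: "L1loc (\<phi> k)" "L1loc (grad (\<phi> k))" for k
    using t by (auto intro: continuous_L1loc test_fun_continuous test_fun_continuous_grad)
  show "u \<in> beppo_levi p"
    unfolding beppo_levi_def mem_Collect_eq
  proof (intro conjI exI[of _ \<phi>] allI impI)
    fix e :: real assume e: "e > 0"
    obtain M where M: "\<And>m n. m \<ge> M \<Longrightarrow> n \<ge> M \<Longrightarrow> dirichlet p (\<lambda>x. \<phi> m x - \<phi> n x) < e powr p"
      using cauchy[of "e powr p"] e by auto
    have "grad_norm p (\<lambda>x. \<phi> m x - \<phi> n x) < e" if "m \<ge> M" "n \<ge> M" for m n
    proof -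
      have "grad_norm p (\<lambda>x. \<phi> m x - \<phi> n x) < (e powr p) powr (1/p)"
        unfolding grad_norm_dirichlet using M[OF that] p by (intro powr_less_mono2 dirichlet_nonneg) auto
      then show ?thesis using e p by (simp add: powr_powr)
    qed
    then show "\<exists>M. \<forall>m\<ge>M. \<forall>n\<ge>M. grad_norm p (\<lambda>x. \<phi> m x - \<phi> n x) < e" by blast
  next
    fix K :: "'a set" assume "compact K"
    then show "(\<lambda>k. LINT x:K|lebesgue. \<bar>\<phi> k x - u x\<bar>) \<longlonglongrightarrow> 0"
      using L1loc_tendsto_iff_set_integral[of \<phi> u, OF L(1) u(1)] u(2) by simp
  qed (fact u t)+
  have nn: "(\<integral>\<^sup>+x. ennreal (norm (grad (\<phi> m) x - grad (\<phi> n) x) powr p) \<partial>lebesgue)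
      = ennreal (dirichlet p (\<lambda>x. \<phi> m x - \<phi> n x))" for m n
    using nn_integral_dirichlet[OF test_fun_diff[OF t t], of p m n] p
    by (simp add: grad_diff test_fun_smooth t)
  have c: "\<exists>M. \<forall>m\<ge>M. \<forall>n\<ge>M. (\<integral>\<^sup>+x. ennreal (norm (grad (\<phi> m) x - grad (\<phi> n) x) powr p) \<partial>lebesgue) \<le> ennreal e"
    if e: "0 < e" for e
    unfolding nn using cauchy[OF e] by (meson ennreal_leI less_imp_le)
  obtain W where W: "L1loc W" "L1loc_tendsto (\<lambda>k. grad (\<phi> k)) W"
    "(\<lambda>n. \<integral>\<^sup>+x. ennreal (norm (grad (\<phi> n) x - W x) powr p) \<partial>lebesgue) \<longlonglongrightarrow> 0"
    by (rule Lp_Cauchy_convergent[OF less_imp_le[OF p] L(2) c])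
  have energy: "energy p u = (LINT x|lebesgue. norm (W x) powr p)"
    by (rule energy_eq[OF weak_grad_limit[OF t u W(1,2)]])
  have [measurable]: "grad (\<phi> k) \<in> borel_measurable lebesgue" "W \<in> borel_measurable lebesgue" for k
    using L W by (auto intro: L1loc_measurable)
  define \<delta> where "\<delta> n = (LINT x|lebesgue. norm (grad (\<phi> n) x - W x) powr p)" for n
  have fin: "\<forall>\<^sub>F n in sequentially. (\<integral>\<^sup>+x. ennreal (norm (grad (\<phi> n) x - W x) powr p) \<partial>lebesgue) < ennreal 1"
    using W(3)[unfolded ennreal_tendsto_0_iff, rule_format, of 1] by simp
  then have int: "\<forall>\<^sub>F n in sequentially. integrable lebesgue (\<lambda>x. norm (grad (\<phi> n) x - W x) powr p)"
    by eventually_elim (auto simp: integrable_iff_bounded elim: less_trans)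
  have "\<forall>\<^sub>F n in sequentially. (\<integral>\<^sup>+x. ennreal (norm (grad (\<phi> n) x - W x) powr p) \<partial>lebesgue) = ennreal (\<delta> n)"
    using int by eventually_elim (simp add: \<delta>_def nn_integral_eq_integral)
  from Lim_transform_eventually[OF W(3) this] have \<delta>: "\<delta> \<longlonglongrightarrow> 0"
    by (subst (asm) ennreal_0[symmetric], subst (asm) tendsto_ennreal_iff) (auto simp: \<delta>_def)
  have "(\<lambda>n. \<delta> n powr (1/p)) \<longlonglongrightarrow> 0 powr (1/p)"
    using p by (intro tendsto_powr2[OF \<delta> tendsto_const]) (auto simp: \<delta>_def)
  then have \<delta>': "(\<lambda>n. \<delta> n powr (1/p)) \<longlonglongrightarrow> 0" by simp
  have intg: "integrable lebesgue (\<lambda>x. norm (grad (\<phi> n) x) powr p)" for n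
    using grad_powr_integrable[OF t] p by simp
  have "\<forall>\<^sub>F n in sequentially. norm (dirichlet p (\<phi> n) powr (1/p) - energy p u powr (1/p)) \<le> \<delta> n powr (1/p)"
    using int
  proof eventually_elim
    case (elim n)
    have i2: "integrable lebesgue (\<lambda>x. norm (W x - grad (\<phi> n) x) powr p)"
      using elim by (simp add: norm_minus_commute)
    have iW: "integrable lebesgue (\<lambda>x. norm (W x) powr p)"
      using powr_minkowski(1)[OF p _ _ intg[of n] i2] by simp
    have "energy p u powr (1/p) \<le> dirichlet p (\<phi> n) powr (1/p) + \<delta> n powr (1/p)"
      using powr_minkowski(2)[OF p _ _ intg[of n] i2]
      by (simp add: energy dirichlet_def \<delta>_def norm_minus_commute)
    moreover have "dirichlet p (\<phi> n) powr (1/p) \<le> energy p u powr (1/p) + \<delta> n powr (1/p)"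
      using powr_minkowski(2)[OF p _ _ iW elim] by (simp add: energy dirichlet_def \<delta>_def)
    ultimately show ?case by (simp add: abs_le_iff)
  qed
  from Lim_null_comparison[OF this \<delta>']
  have "(\<lambda>n. dirichlet p (\<phi> n) powr (1/p)) \<longlonglongrightarrow> energy p u powr (1/p)"
    by (simp add: LIM_zero_iff)
  from tendsto_powr2[OF this tendsto_const[of p]]
  have "(\<lambda>n. (dirichlet p (\<phi> n) powr (1/p)) powr p) \<longlonglongrightarrow> (energy p u powr (1/p)) powr p"
    using p by simp
  moreover have "energy p u \<ge> 0" by (simp add: energy_def)
  ultimately show "(\<lambda>n. dirichlet p (\<phi> n)) \<longlonglongrightarrow> energy p u"
    using p by (simp add: powr_powr dirichlet_nonneg)
qed

lemma beppo_levi_approx: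
  fixes u :: "'a::euclidean_space \<Rightarrow> real"
  assumes p: "1 < p" and u: "u \<in> beppo_levi p"
  obtains \<phi> where "\<And>k. test_fun (\<phi> k)" "L1loc_tendsto \<phi> u" "(\<lambda>k. dirichlet p (\<phi> k)) \<longlonglongrightarrow> energy p u"
proof -
  obtain \<phi> where t: "\<And>k. test_fun (\<phi> k)"
    and c: "\<And>e. e > 0 \<Longrightarrow> \<exists>M. \<forall>m\<ge>M. \<forall>n\<ge>M. grad_norm p (\<lambda>x. \<phi> m x - \<phi> n x) < e"
    and l: "\<And>K. compact K \<Longrightarrow> (\<lambda>k. LINT x:K|lebesgue. \<bar>\<phi> k x - u x\<bar>) \<longlonglongrightarrow> 0"
    using u unfolding beppo_levi_def by blast
  have L: "L1loc u" using u by (simp add: beppo_levi_def)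
  have L': "L1loc (\<phi> k)" for k using t by (auto intro: continuous_L1loc test_fun_continuous)
  have lim: "L1loc_tendsto \<phi> u" using L1loc_tendsto_iff_set_integral[of \<phi> u, OF L' L] l by blast
  have "\<exists>M. \<forall>m\<ge>M. \<forall>n\<ge>M. dirichlet p (\<lambda>x. \<phi> m x - \<phi> n x) < e" if e: "0 < e" for e
  proof -
    obtain M where M: "\<And>m n. m \<ge> M \<Longrightarrow> n \<ge> M \<Longrightarrow> grad_norm p (\<lambda>x. \<phi> m x - \<phi> n x) < e powr (1/p)"
      using c[of "e powr (1/p)"] e by auto
    have "dirichlet p (\<lambda>x. \<phi> m x - \<phi> n x) < e" if "m \<ge> M" "n \<ge> M" for m n
    proof -
      have "(dirichlet p (\<lambda>x. \<phi> m x - \<phi> n x) powr (1/p)) powr p < (e powr (1/p)) powr p"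
        using M[OF that] p unfolding grad_norm_dirichlet by (subst powr_less_mono2) auto
      then show ?thesis using e p by (simp add: powr_powr dirichlet_nonneg)
    qed
    then show ?thesis by blast
  qed
  from dirichlet_Cauchy_limit(2)[OF p t L lim this] show ?thesis using that t lim by blast
qed

section \<open>Uniform convexity and weak limits\<close>

lemma norm_midpoint_powr_less:
  fixes a b :: "'a::euclidean_space"
  assumes p: "1 < p" and ne: "a \<noteq> b"
  shows "norm ((1/2) *\<^sub>R (a + b)) powr p < (norm a powr p + norm b powr p) / 2"
proof -
  define m where "m = (norm a + norm b) / 2"
  have m: "m > 0" using ne unfolding m_def by (metis add_nonneg_eq_0_iff add_nonneg_nonneg half_gt_zero less_eq_real_def norm_eq_zero norm_ge_zero)
  have le: "norm ((1/2) *\<^sub>R (a + b)) \<le> m" using norm_triangle_ineq[of a b] by (simp add: m_def)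
  show ?thesis
  proof (cases "norm a = norm b")
    case False
    have "m powr p + p * m powr (p - 1) * (norm a - m) < norm a powr p"
      using p m False by (intro powr_tangent_less) (auto simp: m_def)
    moreover have "m powr p + p * m powr (p - 1) * (norm b - m) < norm b powr p"
      using p m False by (intro powr_tangent_less) (auto simp: m_def)
    moreover have "p * m powr (p - 1) * (norm a - m) + p * m powr (p - 1) * (norm b - m) = 0"
      unfolding distrib_left[symmetric] by (simp add: m_def)
    ultimately have "m powr p < (norm a powr p + norm b powr p) / 2" by (simp add: field_simps)
    then show ?thesis using powr_mono2[OF _ _ le, of p] p by simp
  next
    case True
    have "norm (a + b) \<noteq> norm a + norm b"
    proof
      assume "norm (a + b) = norm a + norm b"
      then have "norm a *\<^sub>R b = norm b *\<^sub>R a" by (simp add: norm_triangle_eq)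
      then show False using True ne by auto
    qed
    then have "norm (a + b) < norm a + norm b" using norm_triangle_ineq[of a b] by linarith
    then have "norm ((1/2) *\<^sub>R (a + b)) < norm a" using True by simp
    then have "norm ((1/2) *\<^sub>R (a + b)) powr p < norm a powr p" using p by (intro powr_less_mono2) auto
    then show ?thesis using True by simp
  qed
qed

lemma norm_midpoint_powr_le:
  fixes a b :: "'a::euclidean_space"
  assumes p: "1 < p"
  shows "norm ((1/2) *\<^sub>R (a + b)) powr p \<le> (norm a powr p + norm b powr p) / 2"
  using norm_midpoint_powr_less[OF p, of a b] by (cases "a = b") (auto simp flip: scaleR_2)

text \<open>Uniform convexity as a pointwise inequality. By homogeneity it suffices to treat pairs with
\<open>|a|^p + |b|^p = 1\<close>. Those with \<open>|a - b|^p \<ge> e\<close> form a compact set on which the convexity gap is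
positive, hence bounded below by a constant; for the others the first term is enough.\<close>
lemma norm_powr_uniformly_convex:
  fixes p e :: real
  assumes p: "1 < p" and e: "0 < e"
  obtains C where "C > 0" "\<And>a b :: 'a::euclidean_space.
    norm (a - b) powr p \<le> e * (norm a powr p + norm b powr p)
      + C * ((norm a powr p + norm b powr p) / 2 - norm ((1/2) *\<^sub>R (a + b)) powr p)"
proof -
  define S where "S z = norm (fst z) powr p + norm (snd z) powr p" for z :: "'a \<times> 'a"
  define F where "F z = S z / 2 - norm ((1/2) *\<^sub>R (fst z + snd z)) powr p" for z :: "'a \<times> 'a"
  define K where "K = {z. S z = 1 \<and> e \<le> norm (fst z - snd z) powr p}"
  have contS: "continuous_on UNIV S" unfolding S_def[abs_def]
    using p by (intro continuous_intros continuous_on_powr') auto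
  have contF: "continuous_on UNIV F" unfolding F_def[abs_def]
    using p by (intro continuous_intros continuous_on_powr' contS) auto
  have cl: "closed K" unfolding K_def
    using p by (intro closed_Collect_conj closed_Collect_eq closed_Collect_le contS continuous_intros continuous_on_powr') auto
  have unit: "norm (fst z) \<le> 1" "norm (snd z) \<le> 1" if "S z = 1" for z
  proof -
    have "x \<le> 1" if "x powr p \<le> 1" "x \<ge> 0" for x
    proof (rule ccontr)
      assume "\<not> x \<le> 1"
      then have "1 < x powr p" using p by (intro gr_one_powr) auto
      then show False using that by linarith
    qed
    moreover have "norm (fst z) powr p \<le> 1" "norm (snd z) powr p \<le> 1"
      using that powr_ge_zero[of "norm (fst z)" p] powr_ge_zero[of "norm (snd z)" p] unfolding S_def
      by linarith+
    ultimately show "norm (fst z) \<le> 1" "norm (snd z) \<le> 1" by auto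
  qed
  have "K \<subseteq> cball 0 1 \<times> cball 0 1" using unit by (auto simp: K_def mem_Times_iff)
  then have "bounded K" by (rule bounded_subset[rotated]) (intro bounded_Times bounded_cball)
  with cl have comp: "compact K" by (simp add: compact_eq_bounded_closed)
  have nonneg: "F z \<ge> 0" for z using norm_midpoint_powr_le[OF p, of "fst z" "snd z"] by (simp add: F_def S_def)
  obtain c where c: "c > 0" "\<And>z. z \<in> K \<Longrightarrow> c \<le> F z"
  proof (cases "K = {}")
    case True
    then show ?thesis using that[of 1] by simp
  next
    case False
    obtain z0 where z0: "z0 \<in> K" "\<And>z. z \<in> K \<Longrightarrow> F z0 \<le> F z"
      using continuous_attains_inf[OF comp False continuous_on_subset[OF contF]] by auto
    have "fst z0 \<noteq> snd z0" using z0(1) e by (auto simp: K_def)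
    then have "F z0 > 0" using norm_midpoint_powr_less[OF p, of "fst z0" "snd z0"] by (simp add: F_def S_def)
    then show ?thesis using that z0 by blast
  qed
  \<comment> \<open>On the compact set \<open>|a - b|^p \<le> 2^p\<close>, because both norms are at most \<open>1\<close>.\<close>
  define C where "C = 2 powr p / c"
  have unit_case: "norm (fst z - snd z) powr p \<le> e + C * F z" if z: "S z = 1" for z
  proof (cases "z \<in> K")
    case True
    have "norm (fst z - snd z) \<le> 2" using unit[OF z] norm_triangle_ineq4[of "fst z" "snd z"] by simp
    then have "norm (fst z - snd z) powr p \<le> 2 powr p" using p by (intro powr_mono2) auto
    also have "\<dots> = C * c" using c by (simp add: C_def)
    also have "\<dots> \<le> C * F z" using c(1) c(2)[OF True] by (intro mult_left_mono) (auto simp: C_def)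
    finally show ?thesis using e by simp
  next
    case False
    then have "norm (fst z - snd z) powr p < e" using z by (auto simp: K_def)
    moreover have "C * F z \<ge> 0" using nonneg c by (simp add: C_def)
    ultimately show ?thesis by simp
  qed
  show ?thesis
  proof (rule that[of C])
    show "C > 0" using c by (simp add: C_def)
    fix a b :: 'a
    show "norm (a - b) powr p \<le> e * (norm a powr p + norm b powr p)
      + C * ((norm a powr p + norm b powr p) / 2 - norm ((1/2) *\<^sub>R (a + b)) powr p)"
    proof (cases "a = 0 \<and> b = 0")
      case True
      then show ?thesis by simp
    next
      case False
      define s where "s = norm a powr p + norm b powr p"
      have s: "s > 0" using False by (auto simp: s_def intro: add_pos_nonneg add_nonneg_pos)
      define l where "l = s powr (- (1/p))"
      have l: "l > 0" using s by (simp add: l_def)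
      have "- (1/p) * p = - 1" using p by simp
      then have lp: "l powr p = 1 / s" unfolding l_def powr_powr using s by (simp add: powr_neg_one)
      have sc: "norm (l *\<^sub>R x) powr p = norm x powr p / s" for x :: 'a
        using l lp by (simp add: powr_mult)
      have S1: "S (l *\<^sub>R a, l *\<^sub>R b) = 1"
        unfolding S_def fst_conv snd_conv sc add_divide_distrib[symmetric] using s by (simp add: s_def)
      have "norm (l *\<^sub>R a - l *\<^sub>R b) powr p \<le> e + C * F (l *\<^sub>R a, l *\<^sub>R b)"
        using unit_case[OF S1] by simp
      also have "F (l *\<^sub>R a, l *\<^sub>R b) = (s / 2 - norm ((1/2) *\<^sub>R (a + b)) powr p) / s"
      proof -
        have e: "(1/2) *\<^sub>R (l *\<^sub>R a + l *\<^sub>R b) = l *\<^sub>R ((1/2) *\<^sub>R (a + b))" by (simp add: algebra_simps)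
        show ?thesis using s unfolding F_def S1 fst_conv snd_conv e sc by (simp add: diff_divide_distrib)
      qed
      also have "l *\<^sub>R a - l *\<^sub>R b = l *\<^sub>R (a - b)" by (simp add: algebra_simps)
      finally have "norm (a - b) powr p / s \<le> e + C * (s / 2 - norm ((1/2) *\<^sub>R (a + b)) powr p) / s"
        unfolding sc by simp
      then show ?thesis using s by (simp add: s_def[symmetric] field_simps)
    qed
  qed
qed

text \<open>Uniform convexity compares two functions with their midpoint only, so closure under midpoints takes
the place of the convex hull.\<close>
inductive_set midhull :: "('a \<Rightarrow> real) set \<Rightarrow> ('a \<Rightarrow> real) set" for S where
  base: "f \<in> S \<Longrightarrow> f \<in> midhull S"
| mid: "f \<in> midhull S \<Longrightarrow> g \<in> midhull S \<Longrightarrow> (\<lambda>x. (f x + g x) / 2) \<in> midhull S"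

lemma test_fun_midpoint:
  assumes "test_fun f" "test_fun g"
  shows "test_fun (\<lambda>x. (f x + g x) / 2)"
  using test_fun_cmult[OF test_fun_add[OF assms], of "1/2"] by simp

lemma midhull_mono: "S \<subseteq> T \<Longrightarrow> midhull S \<subseteq> midhull T"
proof
  fix f assume "S \<subseteq> T" "f \<in> midhull S"
  from this(2,1) show "f \<in> midhull T" by induction (blast intro: midhull.intros)+
qed

lemma midhull_test_fun: "f \<in> midhull S \<Longrightarrow> (\<And>f. f \<in> S \<Longrightarrow> test_fun f) \<Longrightarrow> test_fun f"
  by (induction rule: midhull.induct) (auto intro: test_fun_midpoint)

lemma ldist_midpoint:
  fixes f g u :: "'a::euclidean_space \<Rightarrow> real"
  assumes [measurable]: "f \<in> borel_measurable lebesgue" "g \<in> borel_measurable lebesgue" "u \<in> borel_measurable lebesgue"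
    and "ldist R f u \<le> c" "ldist R g u \<le> c"
  shows "ldist R (\<lambda>x. (f x + g x) / 2) u \<le> c"
proof -
  have "ldist R (\<lambda>x. (f x + g x) / 2) u \<le> (\<integral>\<^sup>+x. ennreal (1/2) * (ennreal (norm (f x - u x)) * indicator (cball 0 R) x)
     + ennreal (1/2) * (ennreal (norm (g x - u x)) * indicator (cball 0 R) x) \<partial>lebesgue)"
    unfolding ldist_def
  proof (rule nn_integral_mono)
    fix x
    have "ennreal (norm ((f x + g x) / 2 - u x)) \<le> ennreal ((1/2) * norm (f x - u x) + (1/2) * norm (g x - u x))"
      by (rule ennreal_leI) (simp add: field_simps abs_if)
    also have "\<dots> = ennreal (1/2) * ennreal (norm (f x - u x)) + ennreal (1/2) * ennreal (norm (g x - u x))"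
      by (simp only: ennreal_mult[symmetric] ennreal_plus[symmetric] norm_ge_zero zero_le_divide_1_iff zero_le_numeral
          mult_nonneg_nonneg)
    finally show "ennreal (norm ((f x + g x) / 2 - u x)) * indicator (cball 0 R) x
      \<le> ennreal (1/2) * (ennreal (norm (f x - u x)) * indicator (cball 0 R) x)
     + ennreal (1/2) * (ennreal (norm (g x - u x)) * indicator (cball 0 R) x)"
      by (auto split: split_indicator)
  qed
  also have "\<dots> = ennreal (1/2) * ldist R f u + ennreal (1/2) * ldist R g u"
    unfolding ldist_def by (simp add: nn_integral_add nn_integral_cmult)
  also have "\<dots> \<le> ennreal (1/2) * c + ennreal (1/2) * c"
    by (intro add_mono mult_left_mono assms) auto
  also have "\<dots> = c"
    unfolding distrib_right[symmetric] by (subst ennreal_plus[symmetric]) auto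
  finally show ?thesis .
qed

lemma dirichlet_midpoint:
  fixes p e C :: real and f g :: "'a::euclidean_space \<Rightarrow> real"
  assumes p: "1 < p" and f: "test_fun f" and g: "test_fun g"
    and C: "\<And>a b :: 'a. norm (a - b) powr p \<le> e * (norm a powr p + norm b powr p)
      + C * ((norm a powr p + norm b powr p) / 2 - norm ((1/2) *\<^sub>R (a + b)) powr p)"
  shows "dirichlet p (\<lambda>x. f x - g x) \<le> e * (dirichlet p f + dirichlet p g)
     + C * ((dirichlet p f + dirichlet p g) / 2 - dirichlet p (\<lambda>x. (f x + g x) / 2))"
proof -
  have m: "test_fun (\<lambda>x. (f x + g x) / 2)" by (intro test_fun_midpoint f g)
  have s: "smooth f" "smooth g" "smooth (\<lambda>x. f x + g x)"
    using f g by (auto intro: test_fun_smooth test_fun_add)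
  have gm: "grad (\<lambda>x. (f x + g x) / 2) x = (1/2) *\<^sub>R (grad f x + grad g x)" for x
    using grad_cmult[OF s(3), of "1/2" x] s by (simp add: grad_add)
  have gd: "grad (\<lambda>x. f x - g x) x = grad f x - grad g x" for x by (simp add: grad_diff s)
  have i: "integrable lebesgue (\<lambda>x. norm (grad f x) powr p)" "integrable lebesgue (\<lambda>x. norm (grad g x) powr p)"
    "integrable lebesgue (\<lambda>x. norm (grad (\<lambda>x. (f x + g x) / 2) x) powr p)"
    "integrable lebesgue (\<lambda>x. norm (grad (\<lambda>x. f x - g x) x) powr p)"
    using p by (auto intro!: grad_powr_integrable f g m test_fun_diff)
  have "dirichlet p (\<lambda>x. f x - g x) \<le> (LINT x|lebesgue. e * (norm (grad f x) powr p + norm (grad g x) powr p)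
      + C * ((norm (grad f x) powr p + norm (grad g x) powr p) / 2 - norm (grad (\<lambda>x. (f x + g x) / 2) x) powr p))"
    unfolding dirichlet_def
  proof (rule integral_mono[OF i(4)])
    show "norm (grad (\<lambda>x. f x - g x) x) powr p \<le> e * (norm (grad f x) powr p + norm (grad g x) powr p)
      + C * ((norm (grad f x) powr p + norm (grad g x) powr p) / 2 - norm (grad (\<lambda>x. (f x + g x) / 2) x) powr p)" for x
      unfolding gd gm by (rule C)
  qed (use i in auto)
  also have "\<dots> = e * (dirichlet p f + dirichlet p g)
     + C * ((dirichlet p f + dirichlet p g) / 2 - dirichlet p (\<lambda>x. (f x + g x) / 2))"
    unfolding dirichlet_def using i by simp
  finally show ?thesis .
qed

text \<open>Let \<open>m k\<close> be the infimum of the energies of the iterated midpoints of \<open>w k, w (k+1), \<dots>\<close>. It increases to some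
\<open>l \<le> e\<close>. If \<open>v k\<close> almost attains \<open>m k\<close>, the midpoint of two late \<open>v i\<close>, \<open>v j\<close> cannot have much less
energy than they have, so by uniform convexity the \<open>v k\<close> form a Cauchy sequence for the energy. They
still converge to \<open>u\<close>, because small distances to \<open>u\<close> are inherited by midpoints.\<close>
lemma beppo_levi_weak_limit:
  fixes u :: "'a::euclidean_space \<Rightarrow> real"
  assumes p: "1 < p" and t: "\<And>n. test_fun (w n)" and u: "L1loc u" and lim: "L1loc_tendsto w u"
    and e: "(\<lambda>n. dirichlet p (w n)) \<longlonglongrightarrow> e"
  shows "u \<in> beppo_levi p \<and> energy p u \<le> e"
proof -
  define H where "H k = midhull (w ` {k..})" for k
  have Ht: "test_fun f" if "f \<in> H k" for f k
    using midhull_test_fun[of f "w ` {k..}"] that t by (auto simp: H_def)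
  have Hmono: "H n \<subseteq> H k" if "k \<le> n" for k n
    unfolding H_def using that by (intro midhull_mono) auto
  define m where "m k = Inf (dirichlet p ` H k)" for k
  have bdd: "bdd_below (dirichlet p ` H k)" for k
    by (intro bdd_belowI[of _ 0]) (auto simp: dirichlet_nonneg)
  have m_le: "m k \<le> dirichlet p f" if "f \<in> H k" for f k
    unfolding m_def using that by (intro cInf_lower bdd) auto
  have wH: "w n \<in> H k" if "k \<le> n" for n k unfolding H_def using that by (intro midhull.base) auto
  have m_mono: "m k \<le> m n" if "k \<le> n" for k n
    unfolding m_def using wH[of n n] Hmono[OF that] by (intro cInf_superset_mono bdd image_mono) auto
  have m_e: "m k \<le> e" for k
    by (rule LIMSEQ_le_const[OF e]) (auto intro!: exI[of _ k] m_le wH)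
  obtain l where l: "m \<longlonglongrightarrow> l" "\<And>k. m k \<le> l"
    using incseq_convergent[of m e] m_mono m_e by (auto simp: incseq_def)
  have le: "l \<le> e" using l(1) m_e by (intro LIMSEQ_le_const2) auto
  have "\<exists>f\<in>H k. dirichlet p f < m k + inverse (real (Suc k))" for k
  proof -
    have "Inf (dirichlet p ` H k) < m k + inverse (real (Suc k))" by (simp add: m_def)
    then show ?thesis using cInf_lessD[of "dirichlet p ` H k"] wH[of k k] by blast
  qed
  then obtain v where v: "\<And>k. v k \<in> H k" "\<And>k. dirichlet p (v k) < m k + inverse (real (Suc k))" by metis
  have vt: "test_fun (v k)" for k using Ht v by blast
  have inv0: "(\<lambda>k. inverse (real (Suc k))) \<longlonglongrightarrow> 0" by (rule LIMSEQ_inverse_real_of_nat)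
  have dv: "(\<lambda>k. dirichlet p (v k)) \<longlonglongrightarrow> l"
  proof (rule tendsto_sandwich[OF _ _ l(1)])
    show "(\<lambda>k. m k + inverse (real (Suc k))) \<longlonglongrightarrow> l" using tendsto_add[OF l(1) inv0] by simp
    show "\<forall>\<^sub>F k in sequentially. m k \<le> dirichlet p (v k)" by (intro always_eventually allI m_le v)
    show "\<forall>\<^sub>F k in sequentially. dirichlet p (v k) \<le> m k + inverse (real (Suc k))"
      by (intro always_eventually allI less_imp_le v)
  qed
  have meas: "f \<in> borel_measurable lebesgue" if "test_fun f" for f :: "'a \<Rightarrow> real"
    using test_fun_measurable(1)[OF that] by auto
  have limv: "L1loc_tendsto v u" unfolding L1loc_tendsto_def ennreal_tendsto_0_iff
  proof safe
    fix R d :: real assume d: "d > 0"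
    have "\<forall>\<^sub>F n in sequentially. ldist R (w n) u < ennreal (d/2)"
      using lim d unfolding L1loc_tendsto_def ennreal_tendsto_0_iff by simp
    then obtain N where N: "\<And>n. n \<ge> N \<Longrightarrow> ldist R (w n) u < ennreal (d/2)"
      unfolding eventually_sequentially by blast
    have all: "ldist R f u \<le> ennreal (d/2)" if "f \<in> H N" for f
      using that unfolding H_def
    proof (induction rule: midhull.induct)
      case (base f)
      then show ?case using N by (auto intro: less_imp_le)
    next
      case (mid f g)
      then show ?case by (intro ldist_midpoint meas Ht[of _ N] L1loc_measurable u) (auto simp: H_def)
    qed
    show "\<forall>\<^sub>F n in sequentially. ldist R (v n) u < ennreal d"
      using eventually_ge_at_top[of N]
    proof eventually_elim
      case (elim n)
      then have "ldist R (v n) u \<le> ennreal (d/2)" using all v(1)[of n] Hmono by blast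
      also have "\<dots> < ennreal d" using d by (intro ennreal_lessI) auto
      finally show ?case .
    qed
  qed
  have "\<exists>M. \<forall>i\<ge>M. \<forall>j\<ge>M. dirichlet p (\<lambda>x. v i x - v j x) < d" if d: "0 < d" for d
  proof -
    have e0: "e \<ge> 0" using e dirichlet_nonneg by (intro LIMSEQ_le_const) auto
    \<comment> \<open>The term with \<open>d'\<close> meets two energies of at most \<open>e + 1\<close>, which leaves half of \<open>d\<close> for the convexity gap.\<close>
    define d' where "d' = d / (4 * (e + 1))"
    have d': "d' > 0" using d e0 by (simp add: d'_def)
    obtain C where C: "C > 0" "\<And>a b :: 'a. norm (a - b) powr p \<le> d' * (norm a powr p + norm b powr p)
      + C * ((norm a powr p + norm b powr p) / 2 - norm ((1/2) *\<^sub>R (a + b)) powr p)"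
      using norm_powr_uniformly_convex[OF p d'] by blast
    have "(\<lambda>k. C * (l - m k + inverse (real (Suc k)))) \<longlonglongrightarrow> C * (l - l + 0)"
      by (intro tendsto_intros l inv0)
    then have "\<forall>\<^sub>F k in sequentially. C * (l - m k + inverse (real (Suc k))) < d / 2"
      using d by (intro order_tendstoD(2)[of _ "C * (l - l + 0)"]) auto
    then obtain M where M: "C * (l - m M + inverse (real (Suc M))) < d / 2"
      unfolding eventually_sequentially by blast
    have "dirichlet p (\<lambda>x. v i x - v j x) < d" if ij: "i \<ge> M" "j \<ge> M" for i j
    proof -
      have b: "dirichlet p (v k) \<le> l + inverse (real (Suc M))" if "k \<ge> M" for k
      proof -
        have "inverse (real (Suc k)) \<le> inverse (real (Suc M))" using that by (intro le_imp_inverse_le) auto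
        then show ?thesis using v(2)[of k] l(2)[of k] by linarith
      qed
      have b1: "dirichlet p (v k) \<le> e + 1" if "k \<ge> M" for k
      proof -
        have "inverse (real (Suc M)) \<le> 1" by (simp add: field_simps)
        then show ?thesis using b[OF that] le by linarith
      qed
      have "v i \<in> H M" "v j \<in> H M" using v(1) Hmono ij by blast+
      then have "(\<lambda>x. (v i x + v j x) / 2) \<in> H M" unfolding H_def by (rule midhull.mid)
      then have mM: "m M \<le> dirichlet p (\<lambda>x. (v i x + v j x) / 2)" by (rule m_le)
      then have "(dirichlet p (v i) + dirichlet p (v j)) / 2 - dirichlet p (\<lambda>x. (v i x + v j x) / 2)
          \<le> l - m M + inverse (real (Suc M))"
      proof -
        have "(a + b) / 2 - c \<le> l - i + k" if "i \<le> c" "a \<le> l + k" "b \<le> l + k" for a b c i k :: real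
        proof -
          have "(a + b) / 2 \<le> l + k" using add_mono[OF that(2,3)] by (simp add: field_simps)
          from diff_mono[OF this that(1)] show ?thesis by (simp add: algebra_simps)
        qed
        then show ?thesis using b[OF ij(1)] b[OF ij(2)] mM by blast
      qed
      then have "C * ((dirichlet p (v i) + dirichlet p (v j)) / 2 - dirichlet p (\<lambda>x. (v i x + v j x) / 2)) < d / 2"
        using M mult_left_mono[of _ _ C] C(1) by (meson le_less_trans less_imp_le)
      moreover have "d' * (dirichlet p (v i) + dirichlet p (v j)) \<le> d' * (2 * (e + 1))"
        using b1[OF ij(1)] b1[OF ij(2)] d' by (intro mult_left_mono) auto
      moreover have "d' * (2 * (e + 1)) = d / 2" using e0 by (simp add: d'_def field_simps)
      moreover have "dirichlet p (\<lambda>x. v i x - v j x) \<le> d' * (dirichlet p (v i) + dirichlet p (v j))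
        + C * ((dirichlet p (v i) + dirichlet p (v j)) / 2 - dirichlet p (\<lambda>x. (v i x + v j x) / 2))"
        by (rule dirichlet_midpoint[OF p vt vt C(2)])
      ultimately show ?thesis by linarith
    qed
    then show ?thesis by blast
  qed
  note c = dirichlet_Cauchy_limit[OF p vt u limv this]
  have "energy p u = l" by (rule LIMSEQ_unique[OF c(2) dv])
  then show ?thesis using c(1) le by simp
qed

section \<open>Hardy's inequality and local bounds\<close>

text \<open>The function \<open>|s|^(p-1) sgn s\<close>, in a form whose continuity at \<open>0\<close> is apparent.\<close>
definition signed_powr :: "real \<Rightarrow> real \<Rightarrow> real" where
  "signed_powr p s = max s 0 powr (p - 1) - max (- s) 0 powr (p - 1)"

lemma abs_signed_powr: "1 < p \<Longrightarrow> \<bar>signed_powr p s\<bar> = \<bar>s\<bar> powr (p - 1)"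
  by (cases "s \<ge> 0") (auto simp: signed_powr_def max_def)

lemma continuous_signed_powr: "1 < p \<Longrightarrow> continuous_on UNIV f \<Longrightarrow> continuous_on UNIV (\<lambda>x. signed_powr p (f x))"
  unfolding signed_powr_def by (intro continuous_intros continuous_on_powr') auto

lemma abs_powr_has_derivative:
  assumes p: "1 < p"
  shows "((\<lambda>s. \<bar>s\<bar> powr p) has_real_derivative p * signed_powr p s) (at s)"
proof -
  consider "s > 0" | "s < 0" | "s = 0" by linarith
  then show ?thesis
  proof cases
    case 1
    have "((\<lambda>s. s powr p) has_real_derivative p * signed_powr p s) (at s)"
      using has_real_derivative_powr[OF 1, of p] 1 by (simp add: signed_powr_def max_def)
    then show ?thesis
      by (rule has_field_derivative_transform_within_open[of _ _ _ "{0<..}"]) (use 1 in auto)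
  next
    case 2
    have "((\<lambda>s. (- s) powr p) has_real_derivative (p * (- s) powr (p - 1)) * (- 1)) (at s)"
      by (rule DERIV_chain2[where f = "\<lambda>s. s powr p", OF has_real_derivative_powr])
        (use 2 in \<open>auto intro!: derivative_eq_intros\<close>)
    then have "((\<lambda>s. (- s) powr p) has_real_derivative p * signed_powr p s) (at s)"
      using 2 p by (simp add: signed_powr_def max_def)
    then show ?thesis
      by (rule has_field_derivative_transform_within_open[of _ _ _ "{..<0}"]) (use 2 in auto)
  next
    case 3
    have "((\<lambda>h. \<bar>h\<bar> powr (p - 1)) \<longlongrightarrow> \<bar>0::real\<bar> powr (p - 1)) (at 0)"
      using p by (intro tendsto_powr2 tendsto_intros) auto
    then have l: "((\<lambda>h::real. \<bar>h\<bar> powr (p - 1)) \<longlongrightarrow> 0) (at 0)" by simp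
    have "norm (\<bar>h\<bar> powr p / h) = \<bar>h\<bar> powr (p - 1)" for h :: real
      by (cases "h = 0") (auto simp: powr_diff)
    then have "((\<lambda>h::real. \<bar>h\<bar> powr p / h) \<longlongrightarrow> 0) (at 0)"
      by (intro Lim_null_comparison[OF _ l] always_eventually) auto
    then show ?thesis unfolding 3 DERIV_def by (simp add: signed_powr_def)
  qed
qed

text \<open>Comparable with \<open>|x|^(-p)\<close> at infinity, but smooth at the origin.\<close>
definition hardy_weight :: "real \<Rightarrow> 'a::euclidean_space \<Rightarrow> real" where
  "hardy_weight p x = (1 + x \<bullet> x) powr (- (p / 2))"

lemma one_plus_inner_pos: "0 < 1 + x \<bullet> (x::'a::real_inner)"
  by (simp add: add_pos_nonneg)

lemma hardy_weight_line_derivative: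
  "((\<lambda>t. hardy_weight p (x + t *\<^sub>R i) * ((x + t *\<^sub>R i) \<bullet> i)) has_real_derivative
     - p * (x \<bullet> i)\<^sup>2 * (1 + x \<bullet> x) powr (- (p / 2) - 1) + hardy_weight p x * (i \<bullet> i)) (at 0)"
proof -
  have q: "((\<lambda>t. 1 + (x + t *\<^sub>R i) \<bullet> (x + t *\<^sub>R i)) has_real_derivative 2 * (x \<bullet> i)) (at 0)"
    unfolding inner_add_left inner_add_right by (auto intro!: derivative_eq_intros simp: inner_commute)
  have "((\<lambda>t. (1 + (x + t *\<^sub>R i) \<bullet> (x + t *\<^sub>R i)) powr (- (p / 2))) has_real_derivative
      (- (p / 2) * (1 + x \<bullet> x) powr (- (p / 2) - 1)) * (2 * (x \<bullet> i))) (at 0)"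
    by (rule DERIV_chain2[where f = "\<lambda>s. s powr (- (p / 2))", OF _ q])
      (use has_real_derivative_powr[OF one_plus_inner_pos[of x], of "- (p / 2)"] in simp)
  then have w: "((\<lambda>t. hardy_weight p (x + t *\<^sub>R i)) has_real_derivative
      - p * (x \<bullet> i) * (1 + x \<bullet> x) powr (- (p / 2) - 1)) (at 0)"
    unfolding hardy_weight_def by (simp add: algebra_simps)
  have l: "((\<lambda>t. (x + t *\<^sub>R i) \<bullet> i) has_real_derivative i \<bullet> i) (at 0)"
    unfolding inner_add_left by (auto intro!: derivative_eq_intros)
  from DERIV_mult[OF w l] show ?thesis
    by (simp add: power2_eq_square algebra_simps)
qed

lemma continuous_one_plus_inner_powr:
  "continuous_on UNIV (\<lambda>x::'a::euclidean_space. (1 + x \<bullet> x) powr q)"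
proof (intro continuous_on_powr continuous_intros ballI)
  fix x :: 'a
  show "1 + x \<bullet> x \<noteq> 0" using one_plus_inner_pos[of x] by simp
qed

lemma continuous_hardy_weight: "continuous_on UNIV (hardy_weight p)"
  unfolding hardy_weight_def[abs_def] by (rule continuous_one_plus_inner_powr)

lemma hardy_weight_nonneg: "0 \<le> hardy_weight p x" by (simp add: hardy_weight_def)

text \<open>Let \<open>w\<close> be the weight and \<open>X = w x\<close>. The divergence of \<open>|\<phi>|^p X\<close> has integral zero. As
\<open>div X \<ge> (N - p) w\<close>, where \<open>N\<close> is the dimension, this bounds \<open>(N - p) \<integral> |\<phi>|^p w\<close> by
\<open>p \<integral> |\<phi>|^(p-1) |\<nabla>\<phi>| |X|\<close>. Since \<open>|X| \<le> w^((p-1)/p)\<close>, Young's inequality absorbs half of the left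
side and leaves a multiple of the energy. This is where \<open>p < N\<close> enters.\<close>
lemma hardy_inequality:
  fixes p :: real
  assumes p: "1 < p" "p < DIM('a::euclidean_space)"
  obtains C where "C > 0" "\<And>\<phi> :: 'a \<Rightarrow> real. test_fun \<phi> \<Longrightarrow>
    (LINT x|lebesgue. \<bar>\<phi> x\<bar> powr p * hardy_weight p x) \<le> C * dirichlet p \<phi>"
proof -
  define N where "N = real DIM('a)"
  define c where "c = (N - p) / 2"
  have c: "c > 0" using p by (simp add: c_def N_def)
  \<comment> \<open>Chosen so that the term with \<open>a^p\<close> in Young's inequality has coefficient \<open>c\<close>, half of \<open>N - p\<close>.\<close>
  define \<epsilon> where "\<epsilon> = (c / (p - 1)) powr (1 / p)"
  have eps: "\<epsilon> > 0" "(p - 1) * \<epsilon> powr p = c" using p c by (simp_all add: \<epsilon>_def powr_powr)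
  define K where "K = (\<epsilon> powr (1 - p)) powr p"
  have K: "K > 0" using eps by (simp add: K_def)
  have young: "p * (a powr (p - 1) * b) \<le> c * a powr p + K * b powr p" if ab: "a \<ge> 0" "b \<ge> 0" for a b
  proof (cases "a = 0")
    case True
    then show ?thesis using p K by simp
  next
    case False
    then have a: "a > 0" using ab by simp
    have "(\<epsilon> * a) powr p + p * (\<epsilon> * a) powr (p - 1) * (\<epsilon> powr (1 - p) * b - \<epsilon> * a) \<le> (\<epsilon> powr (1 - p) * b) powr p"
      using p eps a ab by (intro powr_tangent_le) auto
    moreover have "(\<epsilon> * a) powr (p - 1) * (\<epsilon> powr (1 - p) * b) = a powr (p - 1) * b"
    proof -
      have "\<epsilon> powr (p - 1) * \<epsilon> powr (1 - p) = 1" using eps by (simp flip: powr_add)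
      then show ?thesis using eps a by (simp add: powr_mult algebra_simps)
    qed
    moreover have "(\<epsilon> * a) powr (p - 1) * (\<epsilon> * a) = \<epsilon> powr p * a powr p"
      using eps a powr_mult_base[of "\<epsilon> * a" "p - 1"] by (simp add: powr_mult mult.commute)
    moreover have "(\<epsilon> powr (1 - p) * b) powr p = K * b powr p" using ab by (simp add: powr_mult K_def)
    moreover have "(\<epsilon> * a) powr p = \<epsilon> powr p * a powr p" using eps a by (simp add: powr_mult)
    moreover have "p * (\<epsilon> * a) powr (p - 1) * (\<epsilon> powr (1 - p) * b - \<epsilon> * a)
        = p * ((\<epsilon> * a) powr (p - 1) * (\<epsilon> powr (1 - p) * b)) - p * ((\<epsilon> * a) powr (p - 1) * (\<epsilon> * a))"
      by (simp only: right_diff_distrib mult.assoc)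
    ultimately have "p * (a powr (p - 1) * b) \<le> K * b powr p + ((p - 1) * \<epsilon> powr p) * a powr p"
      by (simp only: left_diff_distrib mult_1 mult.assoc)
    then show ?thesis unfolding eps(2) by simp
  qed
  have "(LINT x|lebesgue. \<bar>\<phi> x\<bar> powr p * hardy_weight p x) \<le> (K / c) * dirichlet p \<phi>"
    if t: "test_fun \<phi>" for \<phi> :: "'a \<Rightarrow> real"
  proof -
    obtain R where R: "\<And>x. R < norm x \<Longrightarrow> \<phi> x = 0" using test_fun_supportE[OF t] by metis
    have cont: "continuous_on UNIV \<phi>" "continuous_on UNIV (grad \<phi>)"
      using t by (auto intro: test_fun_continuous test_fun_continuous_grad)
    have cw: "continuous_on UNIV (\<lambda>x::'a. (1 + x \<bullet> x) powr (- (p / 2) - 1))"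
      by (rule continuous_one_plus_inner_powr)
    have cp: "continuous_on UNIV (\<lambda>x. \<bar>\<phi> x\<bar> powr p)"
      using p by (intro continuous_on_powr' continuous_intros cont) auto
    define v where "v i x = hardy_weight p x * (x \<bullet> i)" for i x :: 'a
    define v' where "v' i x = - p * (x \<bullet> i)\<^sup>2 * (1 + x \<bullet> x) powr (- (p / 2) - 1) + hardy_weight p x" for i x :: 'a
    define D where "D i x = \<bar>\<phi> x\<bar> powr p * v' i x + (p * signed_powr p (\<phi> x) * (grad \<phi> x \<bullet> i)) * v i x" for i x
    have cv: "continuous_on UNIV (v i)" for i unfolding v_def[abs_def]
      by (intro continuous_intros continuous_hardy_weight)
    have cv': "continuous_on UNIV (v' i)" for i unfolding v'_def[abs_def]
      by (intro continuous_intros continuous_hardy_weight cw)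
    have cD: "continuous_on UNIV (D i)" for i unfolding D_def[abs_def]
      by (intro continuous_intros cp cv cv' continuous_signed_powr p cont)
    have supD: "D i x = 0" if "R < norm x" for i x using R[OF that] p by (simp add: D_def signed_powr_def)
    have int0: "integrable lebesgue (D i)" "(LINT x|lebesgue. D i x) = 0" if i: "i \<in> Basis" for i
    proof -
      obtain B where B: "\<And>x. norm (D i x) \<le> B" using continuous_bounded_support[OF cD supD] by blast
      have cf: "continuous_on UNIV (\<lambda>x. \<bar>\<phi> x\<bar> powr p * v i x)" by (intro continuous_intros cp cv)
      have d: "((\<lambda>s. \<bar>\<phi> (x + s *\<^sub>R i)\<bar> powr p * v i (x + s *\<^sub>R i)) has_real_derivative D i x) (at 0)" for x
      proof -
        have "((\<lambda>s. \<phi> (x + s *\<^sub>R i)) has_real_derivative grad \<phi> x \<bullet> i) (at 0)"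
          by (rule has_derivative_line) (rule smooth_has_derivative[OF test_fun_smooth[OF t]])
        then have 1: "((\<lambda>s. \<bar>\<phi> (x + s *\<^sub>R i)\<bar> powr p) has_real_derivative p * signed_powr p (\<phi> x) * (grad \<phi> x \<bullet> i)) (at 0)"
          by (rule DERIV_chain2[where f = "\<lambda>s. \<bar>s\<bar> powr p", rotated]) (use abs_powr_has_derivative[OF p(1)] in simp)
        have 2: "((\<lambda>s. v i (x + s *\<^sub>R i)) has_real_derivative v' i x) (at 0)"
          using hardy_weight_line_derivative[of p x i] i unfolding v_def v'_def by (simp add: inner_same_Basis)
        from DERIV_mult[OF 1 2] show ?thesis by (simp add: D_def algebra_simps)
      qed
      have s: "\<bar>\<phi> x\<bar> powr p * v i x = 0" if "R < norm x" for x using R[OF that] by simp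
      show "integrable lebesgue (D i)"
        by (rule integral_directional_derivative_eq_0(1)[OF cf s d]) (use B in auto)
      show "(LINT x|lebesgue. D i x) = 0"
        by (rule integral_directional_derivative_eq_0(2)[OF cf s d]) (use B in auto)
    qed
    define A where "A x = \<bar>\<phi> x\<bar> powr p * hardy_weight p x" for x
    have iA: "integrable lebesgue A"
      by (rule continuous_bounded_support_integrable[where R = R])
        (use R in \<open>auto simp: A_def[abs_def] intro!: continuous_intros cp continuous_hardy_weight\<close>)
    have iG: "integrable lebesgue (\<lambda>x. norm (grad \<phi> x) powr p)" using t p by (intro grad_powr_integrable) auto
    have pt: "c * A x - K * norm (grad \<phi> x) powr p \<le> (\<Sum>i\<in>Basis. D i x)" for x
    proof -
      define q where "q = 1 + x \<bullet> x"
      define w where "w = hardy_weight p x"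
      have q: "q > 0" using one_plus_inner_pos[of x] by (simp add: q_def)
      have w: "w = q powr (- (p / 2))" "w \<ge> 0" by (simp_all add: w_def hardy_weight_def q_def)
      have "(\<Sum>i\<in>Basis. v' i x) = - p * (x \<bullet> x) * q powr (- (p / 2) - 1) + N * w"
      proof -
        have ex: "x \<bullet> x = (\<Sum>i\<in>Basis. (x \<bullet> i)\<^sup>2)" by (simp add: euclidean_inner[of x x] power2_eq_square)
        have "(\<Sum>i\<in>Basis. v' i x) = - p * (\<Sum>i\<in>Basis. (x \<bullet> i)\<^sup>2) * q powr (- (p / 2) - 1) + N * w"
          unfolding v'_def q_def[symmetric] w_def[symmetric] N_def
          by (simp add: sum.distrib sum_distrib_left sum_distrib_right sum_negf sum_subtractf mult.assoc)
        then show ?thesis unfolding ex .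
      qed
      also have "\<dots> \<ge> - p * w + N * w"
      proof -
        have "(x \<bullet> x) * q powr (- (p / 2) - 1) \<le> q * q powr (- (p / 2) - 1)"
          by (intro mult_right_mono) (auto simp: q_def)
        also have "\<dots> = w" using q w by (simp add: powr_mult_base)
        finally show ?thesis using p by (simp add: mult_left_mono)
      qed
      finally have 1: "(N - p) * w \<le> (\<Sum>i\<in>Basis. v' i x)" by (simp add: algebra_simps)
      have "(\<Sum>i\<in>Basis. (grad \<phi> x \<bullet> i) * v i x) = w * (grad \<phi> x \<bullet> x)"
        unfolding v_def w_def[symmetric] euclidean_inner[of "grad \<phi> x" x] by (simp add: sum_distrib_left algebra_simps)
      then have e: "(\<Sum>i\<in>Basis. D i x) = \<bar>\<phi> x\<bar> powr p * (\<Sum>i\<in>Basis. v' i x) + p * signed_powr p (\<phi> x) * (w * (grad \<phi> x \<bullet> x))"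
        unfolding D_def by (simp add: sum.distrib sum_distrib_left[symmetric] mult.assoc)
      define a where "a = \<bar>\<phi> x\<bar> * q powr (- (1 / 2))"
      have ap: "a powr p = A x" using q p by (simp add: a_def A_def w_def[symmetric] w(1) powr_mult powr_powr)
      have xq: "norm x \<le> q powr (1 / 2)"
        using q by (simp add: powr_half_sqrt norm_eq_sqrt_inner q_def)
      have "\<bar>p * signed_powr p (\<phi> x) * (w * (grad \<phi> x \<bullet> x))\<bar> = p * (\<bar>\<phi> x\<bar> powr (p - 1) * (w * \<bar>grad \<phi> x \<bullet> x\<bar>))"
        using p w by (simp add: abs_mult abs_signed_powr)
      also have "\<dots> \<le> p * (\<bar>\<phi> x\<bar> powr (p - 1) * (w * (norm (grad \<phi> x) * q powr (1 / 2))))"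
      proof -
        have "\<bar>grad \<phi> x \<bullet> x\<bar> \<le> norm (grad \<phi> x) * q powr (1 / 2)"
          using Cauchy_Schwarz_ineq2[of "grad \<phi> x" x] mult_left_mono[OF xq, of "norm (grad \<phi> x)"] by simp
        then show ?thesis using p w by (intro mult_left_mono) auto
      qed
      also have "\<dots> = p * (a powr (p - 1) * norm (grad \<phi> x))"
      proof -
        have "w * q powr (1 / 2) = q powr (- (1 / 2) * (p - 1))"
        proof -
          have "- (p / 2) + 1 / 2 = - (1 / 2) * (p - 1)" by (simp add: field_simps)
          then show ?thesis unfolding w(1) powr_add[symmetric] by simp
        qed
        moreover have "a powr (p - 1) = \<bar>\<phi> x\<bar> powr (p - 1) * q powr (- (1 / 2) * (p - 1))"
          unfolding a_def by (simp add: powr_mult powr_powr)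
        ultimately show ?thesis by (metis mult.assoc mult.commute)
      qed
      also have "\<dots> \<le> c * A x + K * norm (grad \<phi> x) powr p"
        using young[of a "norm (grad \<phi> x)"] q unfolding ap by (simp add: a_def)
      finally have 2: "- (c * A x + K * norm (grad \<phi> x) powr p) \<le> p * signed_powr p (\<phi> x) * (w * (grad \<phi> x \<bullet> x))"
        by linarith
      have "\<bar>\<phi> x\<bar> powr p * ((N - p) * w) \<le> \<bar>\<phi> x\<bar> powr p * (\<Sum>i\<in>Basis. v' i x)"
        by (intro mult_left_mono 1) auto
      moreover have "\<bar>\<phi> x\<bar> powr p * ((N - p) * w) = 2 * c * A x" by (simp add: A_def w_def c_def)
      ultimately show ?thesis using 2 unfolding e by linarith
    qed
    have "(LINT x|lebesgue. c * A x - K * norm (grad \<phi> x) powr p) \<le> (LINT x|lebesgue. (\<Sum>i\<in>Basis. D i x))"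
      by (intro integral_mono pt Bochner_Integration.integrable_diff integrable_mult_right
          Bochner_Integration.integrable_sum iA iG int0)
    also have "\<dots> = (\<Sum>i\<in>Basis. LINT x|lebesgue. D i x)" by (intro Bochner_Integration.integral_sum int0)
    also have "\<dots> = 0" by (simp add: int0)
    finally have "c * (LINT x|lebesgue. A x) \<le> K * dirichlet p \<phi>" using iA iG by (simp add: dirichlet_def)
    then have "(LINT x|lebesgue. A x) \<le> (K / c) * dirichlet p \<phi>" using c by (simp add: field_simps)
    then show ?thesis unfolding A_def .
  qed
  then show ?thesis using that[of "K / c"] K c by simp
qed

text \<open>On a ball the Hardy weight is bounded below, and \<open>|\<phi>| \<le> 1 + |\<phi>|^p\<close>.\<close>
lemma local_L1_bound:
  fixes p R :: real
  assumes p: "1 < p" "p < DIM('a::euclidean_space)" 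
  obtains C where "C > 0" "\<And>\<phi> :: 'a \<Rightarrow> real. test_fun \<phi> \<Longrightarrow> ldist R \<phi> (\<lambda>_. 0) \<le> ennreal (C * (1 + dirichlet p \<phi>))"
proof -
  obtain H where H: "H > 0" "\<And>\<phi> :: 'a \<Rightarrow> real. test_fun \<phi> \<Longrightarrow>
    (LINT x|lebesgue. \<bar>\<phi> x\<bar> powr p * hardy_weight p x) \<le> H * dirichlet p \<phi>"
    using hardy_inequality[OF p] by blast
  define B where "B = measure lebesgue (cball (0::'a) R)"
  define K where "K = (1 + R\<^sup>2) powr (p / 2)"
  have KB: "K \<ge> 0" "B \<ge> 0" by (simp_all add: K_def B_def)
  have "ldist R \<phi> (\<lambda>_. 0) \<le> ennreal ((B + K * H + 1) * (1 + dirichlet p \<phi>))" if t: "test_fun \<phi>" for \<phi> :: "'a \<Rightarrow> real"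
  proof -
    have cont: "continuous_on UNIV \<phi>" using t by (rule test_fun_continuous)
    obtain S where S: "\<And>x. S < norm x \<Longrightarrow> \<phi> x = 0" using test_fun_supportE[OF t] by metis
    have i: "integrable lebesgue (\<lambda>x. \<bar>\<phi> x\<bar> powr p * hardy_weight p x)"
      by (rule continuous_bounded_support_integrable[where R = S])
        (use S p in \<open>auto intro!: continuous_intros continuous_on_powr' cont continuous_hardy_weight\<close>)
    have pt: "ennreal (norm (\<phi> x - 0)) * indicator (cball 0 R) x
      \<le> indicator (cball 0 R) x + ennreal K * ennreal (\<bar>\<phi> x\<bar> powr p * hardy_weight p x)" for x
    proof (cases "norm x \<le> R")
      case True
      have "x \<bullet> x \<le> R\<^sup>2" using power_mono[OF True, of 2] by (simp add: power2_norm_eq_inner)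
      then have "(1 + x \<bullet> x) powr (p / 2) \<le> K" unfolding K_def using p by (intro powr_mono2) auto
      moreover have "(1 + x \<bullet> x) powr (p / 2) * hardy_weight p x = 1"
        using one_plus_inner_pos[of x] by (simp add: hardy_weight_def flip: powr_add)
      ultimately have "1 \<le> K * hardy_weight p x" using mult_right_mono[OF _ hardy_weight_nonneg[of p x]] by metis
      then have "\<bar>\<phi> x\<bar> powr p * 1 \<le> \<bar>\<phi> x\<bar> powr p * (K * hardy_weight p x)" by (intro mult_left_mono) auto
      moreover have "\<bar>\<phi> x\<bar> \<le> 1 + \<bar>\<phi> x\<bar> powr p"
        using norm_le_powr_split[of p 1 "\<bar>\<phi> x\<bar>"] p by simp
      ultimately have "\<bar>\<phi> x\<bar> \<le> 1 + K * (\<bar>\<phi> x\<bar> powr p * hardy_weight p x)" by (simp add: algebra_simps)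
      then have "ennreal \<bar>\<phi> x\<bar> \<le> ennreal (1 + K * (\<bar>\<phi> x\<bar> powr p * hardy_weight p x))" by (rule ennreal_leI)
      also have "\<dots> = 1 + ennreal K * ennreal (\<bar>\<phi> x\<bar> powr p * hardy_weight p x)"
        using KB hardy_weight_nonneg[of p x] by (simp add: ennreal_mult)
      finally show ?thesis using True by simp
    qed simp
    have "ldist R \<phi> (\<lambda>_. 0) \<le> (\<integral>\<^sup>+x. indicator (cball 0 R) x + ennreal K * ennreal (\<bar>\<phi> x\<bar> powr p * hardy_weight p x) \<partial>lebesgue)"
      unfolding ldist_def by (intro nn_integral_mono pt)
    also have "\<dots> = emeasure lebesgue (cball (0::'a) R) + ennreal K * (\<integral>\<^sup>+x. ennreal (\<bar>\<phi> x\<bar> powr p * hardy_weight p x) \<partial>lebesgue)"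
      using borel_measurable_integrable[OF i] by (simp add: nn_integral_add nn_integral_cmult)
    also have "(\<integral>\<^sup>+x. ennreal (\<bar>\<phi> x\<bar> powr p * hardy_weight p x) \<partial>lebesgue)
        = ennreal (LINT x|lebesgue. \<bar>\<phi> x\<bar> powr p * hardy_weight p x)"
      by (rule nn_integral_eq_integral[OF i]) (auto simp: hardy_weight_nonneg)
    also have "emeasure lebesgue (cball (0::'a) R) = ennreal B"
      unfolding B_def by (intro emeasure_eq_ennreal_measure fmeasurableD2 lmeasurable_cball)
    also have "ennreal B + ennreal K * ennreal (LINT x|lebesgue. \<bar>\<phi> x\<bar> powr p * hardy_weight p x)
        \<le> ennreal B + ennreal K * ennreal (H * dirichlet p \<phi>)"
      by (intro add_left_mono mult_left_mono ennreal_leI H t) auto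
    also have "\<dots> = ennreal (B + K * (H * dirichlet p \<phi>))"
      using KB H(1) dirichlet_nonneg[of p \<phi>] by (simp add: ennreal_mult)
    also have "\<dots> \<le> ennreal ((B + K * H + 1) * (1 + dirichlet p \<phi>))"
    proof (rule ennreal_leI)
      have "(B + K * H + 1) * (1 + dirichlet p \<phi>) = (B + K * (H * dirichlet p \<phi>)) + (K * H + 1 + B * dirichlet p \<phi> + dirichlet p \<phi>)"
        by (simp add: algebra_simps)
      moreover have "0 \<le> K * H + 1 + B * dirichlet p \<phi> + dirichlet p \<phi>"
        using KB H(1) dirichlet_nonneg[of p \<phi>] by simp
      ultimately show "B + K * (H * dirichlet p \<phi>) \<le> (B + K * H + 1) * (1 + dirichlet p \<phi>)" by linarith
    qed
    finally show ?thesis .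
  qed
  moreover have "B + K * H + 1 > 0" using KB H(1) by (simp add: add_nonneg_pos)
  ultimately show ?thesis using that by blast
qed

section \<open>Compactness\<close>

text \<open>The integrals over the product space and the translations below are taken for Borel functions, for
which balls and boxes have to be recognised as Borel sets.\<close>
declare cball_lebesgue [measurable del] box_lebesgue [measurable del]

lemma cball_borel [measurable]: "cball a r \<in> sets borel"
  by simp

lemma nn_integral_cball_translate_le:
  fixes f :: "'a::euclidean_space \<Rightarrow> ennreal"
  assumes [measurable]: "f \<in> borel_measurable borel" and h: "norm h \<le> r"
  shows "(\<integral>\<^sup>+x\<in>cball 0 R. f (x + h) \<partial>lborel) \<le> (\<integral>\<^sup>+x\<in>cball 0 (R + r). f x \<partial>lborel)"
proof -
  have "(\<integral>\<^sup>+x\<in>cball 0 R. f (x + h) \<partial>lborel) \<le> (\<integral>\<^sup>+x. f (h + x) * indicator (cball 0 (R + r)) (h + x) \<partial>lborel)"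
  proof (rule nn_integral_mono)
    fix x :: 'a
    have "norm (h + x) \<le> R + r" if "norm x \<le> R" using that h norm_triangle_ineq[of h x] by linarith
    then show "f (x + h) * indicator (cball 0 R) x \<le> f (h + x) * indicator (cball 0 (R + r)) (h + x)"
      by (auto simp: add.commute split: split_indicator)
  qed
  also have "\<dots> = (\<integral>\<^sup>+x. f x * indicator (cball 0 (R + r)) x \<partial>distr lborel borel ((+) h))"
    by (subst nn_integral_distr) auto
  finally show ?thesis by (simp add: lborel_distr_plus)
qed

lemma nn_integral_lborel_swap:
  fixes f :: "'a::euclidean_space \<Rightarrow> 'b::euclidean_space \<Rightarrow> ennreal"
  assumes "case_prod f \<in> borel_measurable (lborel \<Otimes>\<^sub>M lborel)"
  shows "(\<integral>\<^sup>+x. \<integral>\<^sup>+y. f x y \<partial>lborel \<partial>lborel) = (\<integral>\<^sup>+y. \<integral>\<^sup>+x. f x y \<partial>lborel \<partial>lborel)"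
proof -
  have "pair_sigma_finite (lborel :: 'a measure) (lborel :: 'b measure)"
    by (intro pair_sigma_finite.intro sigma_finite_lborel)
  from pair_sigma_finite.Fubini'[OF this assms] show ?thesis by simp
qed

text \<open>Integrate the gradient along the segment from \<open>x\<close> to \<open>x + h\<close> and exchange the integrals; every translate
of the ball by a part of \<open>h\<close> lies in the larger ball.\<close>
lemma translation_estimate:
  fixes \<phi> :: "'a::euclidean_space \<Rightarrow> real"
  assumes t: "test_fun \<phi>" and h: "norm h \<le> r"
  shows "(\<integral>\<^sup>+x\<in>cball 0 R. ennreal \<bar>\<phi> (x + h) - \<phi> x\<bar> \<partial>lborel)
    \<le> ennreal r * (\<integral>\<^sup>+x\<in>cball 0 (R + r). ennreal (norm (grad \<phi> x)) \<partial>lborel)"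
proof -
  have [measurable]: "grad \<phi> \<in> borel_measurable borel" "\<phi> \<in> borel_measurable borel"
    using t by (auto intro: test_fun_measurable)
  have r: "r \<ge> 0" using h norm_ge_zero[of h] by linarith
  define g where "g x = ennreal (norm (grad \<phi> x))" for x
  have [measurable]: "g \<in> borel_measurable borel" unfolding g_def[abs_def] by measurable
  have pt: "ennreal \<bar>\<phi> (x + h) - \<phi> x\<bar> \<le> (\<integral>\<^sup>+s. ennreal r * (g (x + s *\<^sub>R h) * indicator {0..1} s) \<partial>lborel)" for x
  proof -
    have d: "((\<lambda>s. \<phi> (x + s *\<^sub>R h)) has_real_derivative grad \<phi> (x + s *\<^sub>R h) \<bullet> h) (at s)" for s
    proof -
      have "((\<lambda>u. \<phi> ((x + s *\<^sub>R h) + (u - s) *\<^sub>R h)) has_real_derivative grad \<phi> (x + s *\<^sub>R h) \<bullet> h) (at s)"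
        using DERIV_shift[of "\<lambda>u. \<phi> ((x + s *\<^sub>R h) + u *\<^sub>R h)" "grad \<phi> (x + s *\<^sub>R h) \<bullet> h" s "-s"]
          has_derivative_line[OF smooth_has_derivative[OF test_fun_smooth[OF t]], of "x + s *\<^sub>R h" h]
        by simp
      then show ?thesis by (simp add: algebra_simps)
    qed
    have c: "isCont (\<lambda>s. grad \<phi> (x + s *\<^sub>R h) \<bullet> h) s" for s
    proof -
      have "continuous_on UNIV (\<lambda>s. grad \<phi> (x + s *\<^sub>R h) \<bullet> h)"
        by (intro continuous_intros continuous_on_compose2[OF test_fun_continuous_grad[OF t, of UNIV]]) auto
      then show ?thesis by (simp add: continuous_on_eq_continuous_at)
    qed
    have b: "has_bochner_integral lborel (\<lambda>s. (grad \<phi> (x + s *\<^sub>R h) \<bullet> h) * indicator {0..1} s) (\<phi> (x + 1 *\<^sub>R h) - \<phi> (x + 0 *\<^sub>R h))"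
      by (rule has_bochner_integral_FTC_Icc_real) (use d c in auto)
    have "ennreal \<bar>\<phi> (x + h) - \<phi> x\<bar> \<le> (\<integral>\<^sup>+s. norm ((grad \<phi> (x + s *\<^sub>R h) \<bullet> h) * indicator {0..1} s) \<partial>lborel)"
      using has_bochner_integral_norm_bound[OF b] by simp
    also have "\<dots> \<le> (\<integral>\<^sup>+s. ennreal r * (g (x + s *\<^sub>R h) * indicator {0..1} s) \<partial>lborel)"
    proof (rule nn_integral_mono)
      fix s :: real
      have "\<bar>grad \<phi> (x + s *\<^sub>R h) \<bullet> h\<bar> \<le> norm (grad \<phi> (x + s *\<^sub>R h)) * norm h" by (rule Cauchy_Schwarz_ineq2)
      also have "\<dots> \<le> norm (grad \<phi> (x + s *\<^sub>R h)) * r" using h by (intro mult_left_mono) auto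
      finally have "ennreal \<bar>grad \<phi> (x + s *\<^sub>R h) \<bullet> h\<bar> \<le> ennreal (norm (grad \<phi> (x + s *\<^sub>R h)) * r)" by (rule ennreal_leI)
      also have "\<dots> = ennreal r * g (x + s *\<^sub>R h)" using r by (simp add: g_def ennreal_mult mult.commute)
      finally show "ennreal (norm ((grad \<phi> (x + s *\<^sub>R h) \<bullet> h) * indicator {0..1} s)) \<le> ennreal r * (g (x + s *\<^sub>R h) * indicator {0..1} s)"
        by (auto split: split_indicator)
    qed
    finally show ?thesis .
  qed
  have "(\<integral>\<^sup>+x\<in>cball 0 R. ennreal \<bar>\<phi> (x + h) - \<phi> x\<bar> \<partial>lborel)
    \<le> (\<integral>\<^sup>+x. (\<integral>\<^sup>+s. ennreal r * (g (x + s *\<^sub>R h) * indicator {0..1} s) \<partial>lborel) * indicator (cball 0 R) x \<partial>lborel)"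
    by (intro nn_integral_mono mult_right_mono pt) auto
  also have "\<dots> = (\<integral>\<^sup>+x. \<integral>\<^sup>+s. ennreal r * (g (x + s *\<^sub>R h) * indicator {0..1} s) * indicator (cball 0 R) x \<partial>lborel \<partial>lborel)"
    by (intro nn_integral_cong nn_integral_multc[symmetric]) measurable
  also have "\<dots> = (\<integral>\<^sup>+s. \<integral>\<^sup>+x. ennreal r * (g (x + s *\<^sub>R h) * indicator {0..1} s) * indicator (cball 0 R) x \<partial>lborel \<partial>lborel)"
    by (rule nn_integral_lborel_swap) measurable
  also have "\<dots> \<le> (\<integral>\<^sup>+(s::real). (ennreal r * (\<integral>\<^sup>+x\<in>cball 0 (R + r). g x \<partial>lborel)) * indicator {0..1} s \<partial>lborel)"
  proof (rule nn_integral_mono)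
    fix s :: real
    show "(\<integral>\<^sup>+x. ennreal r * (g (x + s *\<^sub>R h) * indicator {0..1} s) * indicator (cball 0 R) x \<partial>lborel)
       \<le> (ennreal r * (\<integral>\<^sup>+x\<in>cball 0 (R + r). g x \<partial>lborel)) * indicator {0..1} s"
    proof (cases "s \<in> {0..1}")
      case True
      have "norm (s *\<^sub>R h) \<le> r" using True h mult_left_le_one_le[of "norm h" s] by simp
      then have "(\<integral>\<^sup>+x\<in>cball 0 R. g (x + s *\<^sub>R h) \<partial>lborel) \<le> (\<integral>\<^sup>+x\<in>cball 0 (R + r). g x \<partial>lborel)"
        by (intro nn_integral_cball_translate_le) auto
      then show ?thesis using True by (simp add: mult.assoc nn_integral_cmult mult_left_mono)
    qed simp
  qed
  also have "\<dots> = ennreal r * (\<integral>\<^sup>+x\<in>cball 0 (R + r). g x \<partial>lborel)"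
    by (subst nn_integral_cmult_indicator) auto
  finally show ?thesis by (simp add: g_def)
qed

lemma grad_local_L1_bound:
  fixes \<phi> :: "'a::euclidean_space \<Rightarrow> real" and p R :: real
  assumes p: "1 < p" and t: "test_fun \<phi>"
  shows "(\<integral>\<^sup>+x\<in>cball 0 R. ennreal (norm (grad \<phi> x)) \<partial>lborel) \<le> ennreal (measure lebesgue (cball (0::'a) R) + dirichlet p \<phi>)"
proof -
  have [measurable]: "grad \<phi> \<in> borel_measurable lebesgue" using t by (auto intro: test_fun_measurable)
  have "ldist R (grad \<phi>) (\<lambda>_. 0) \<le> ennreal (1 * measure lebesgue (cball (0::'a) R))
     + ennreal (1 powr (1 - p)) * (\<integral>\<^sup>+x. ennreal (norm (grad \<phi> x - 0) powr p) \<partial>lebesgue)"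
    by (rule ldist_le_powr) (use p in auto)
  also have "\<dots> = ennreal (measure lebesgue (cball (0::'a) R)) + ennreal (dirichlet p \<phi>)"
    using nn_integral_dirichlet[OF t, of p] p by simp
  also have "\<dots> = ennreal (measure lebesgue (cball (0::'a) R) + dirichlet p \<phi>)"
    by (rule ennreal_plus[symmetric]) (auto simp: dirichlet_nonneg)
  finally show ?thesis by (simp add: ldist_def nn_integral_completion)
qed

text \<open>Averages over balls of radius \<open>d\<close> approximate functions of bounded energy at a rate depending on \<open>d\<close>
only, while for fixed \<open>d\<close> they are bounded and equicontinuous. They play the part of mollifications.\<close>
definition ball_avg :: "real \<Rightarrow> ('a::euclidean_space \<Rightarrow> real) \<Rightarrow> 'a \<Rightarrow> real" where
  "ball_avg d f x = (LINT y|lborel. indicator (cball 0 d) y * f (x + y)) / measure lborel (cball (0::'a) d)"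

lemma ball_avg_diff_le:
  fixes f :: "'a::euclidean_space \<Rightarrow> real"
  assumes d: "d > 0" and f: "continuous_on UNIV f" and g: "continuous_on UNIV g"
  shows "ennreal \<bar>ball_avg d f x - ball_avg d g y\<bar>
    \<le> ennreal (1 / measure lborel (cball (0::'a) d)) * (\<integral>\<^sup>+z\<in>cball 0 d. ennreal \<bar>f (x + z) - g (y + z)\<bar> \<partial>lborel)"
proof -
  have m: "measure lborel (cball (0::'a) d) > 0" using content_cball_pos[of d] d by simp
  have "continuous_on (cball 0 d) (\<lambda>z. f (x + z))" "continuous_on (cball 0 d) (\<lambda>z. g (y + z))"
    by (auto intro!: continuous_on_compose2[OF f] continuous_on_compose2[OF g] continuous_on_add
        continuous_on_const continuous_on_id)
  then have i: "integrable lborel (\<lambda>z. indicator (cball 0 d) z * f (x + z))" "integrable lborel (\<lambda>z. indicator (cball 0 d) z * g (y + z))"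
    using borel_integrable_compact[OF compact_cball[of 0 d], of "\<lambda>z. f (x + z)"]
      borel_integrable_compact[OF compact_cball[of 0 d], of "\<lambda>z. g (y + z)"]
    by auto
  have "ball_avg d f x - ball_avg d g y
    = (1 / measure lborel (cball (0::'a) d)) * (LINT z|lborel. indicator (cball 0 d) z * f (x + z) - indicator (cball 0 d) z * g (y + z))"
    unfolding ball_avg_def using i by (simp add: diff_divide_distrib)
  then have "ennreal \<bar>ball_avg d f x - ball_avg d g y\<bar>
    = ennreal (1 / measure lborel (cball (0::'a) d)) * ennreal \<bar>LINT z|lborel. indicator (cball 0 d) z * f (x + z) - indicator (cball 0 d) z * g (y + z)\<bar>"
    using m by (simp add: abs_mult flip: ennreal_mult)
  also have "\<dots> \<le> ennreal (1 / measure lborel (cball (0::'a) d)) * (\<integral>\<^sup>+z\<in>cball 0 d. ennreal \<bar>f (x + z) - g (y + z)\<bar> \<partial>lborel)"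
  proof (rule mult_left_mono)
    have "ennreal (norm (LINT z|lborel. indicator (cball 0 d) z * f (x + z) - indicator (cball 0 d) z * g (y + z)))
      \<le> (\<integral>\<^sup>+z. ennreal (norm (indicator (cball 0 d) z * f (x + z) - indicator (cball 0 d) z * g (y + z))) \<partial>lborel)"
      by (intro integral_norm_bound_ennreal Bochner_Integration.integrable_diff i)
    also have "\<dots> = (\<integral>\<^sup>+z\<in>cball 0 d. ennreal \<bar>f (x + z) - g (y + z)\<bar> \<partial>lborel)"
      by (intro nn_integral_cong) (simp split: split_indicator)
    finally show "ennreal \<bar>LINT z|lborel. indicator (cball 0 d) z * f (x + z) - indicator (cball 0 d) z * g (y + z)\<bar>
      \<le> (\<integral>\<^sup>+z\<in>cball 0 d. ennreal \<bar>f (x + z) - g (y + z)\<bar> \<partial>lborel)" by simp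
  qed auto
  finally show ?thesis .
qed

lemma ball_avg_zero: "ball_avg d (\<lambda>_. 0) x = 0" by (simp add: ball_avg_def)

lemma ball_avg_measurable [measurable]:
  fixes f :: "'a::euclidean_space \<Rightarrow> real"
  assumes [measurable]: "f \<in> borel_measurable borel"
  shows "ball_avg d f \<in> borel_measurable borel"
  unfolding ball_avg_def[abs_def]
  by (intro borel_measurable_divide borel_measurable_const
      sigma_finite_measure.borel_measurable_lebesgue_integral[OF sigma_finite_lborel])
    (simp add: measurable_cong_sets[OF sets_pair_measure_cong[OF refl sets_lborel] refl], measurable)

lemma ldist_ball_avg:
  fixes f :: "'a::euclidean_space \<Rightarrow> real"
  assumes d: "d > 0" and f: "continuous_on UNIV f"
    and M: "\<And>h. norm h \<le> d \<Longrightarrow> (\<integral>\<^sup>+x\<in>cball 0 R. ennreal \<bar>f (x + h) - f x\<bar> \<partial>lborel) \<le> M"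
  shows "ldist R f (ball_avg d f) \<le> M"
proof -
  have [measurable]: "f \<in> borel_measurable borel" by (rule borel_measurable_continuous_onI[OF f])
  define m where "m = measure lborel (cball (0::'a) d)"
  have m: "m > 0" unfolding m_def using content_cball_pos[of d] d by simp
  have em: "emeasure lborel (cball (0::'a) d) = ennreal m"
    unfolding m_def by (intro emeasure_eq_ennreal_measure) (metis emeasure_lborel_cball_finite infinity_ennreal_def less_irrefl)
  \<comment> \<open>The value \<open>f x\<close> is itself an average, of a constant function, so the difference of two averages bounds the error.\<close>
  have const: "ball_avg d (\<lambda>_. c) y = c" for c and y :: 'a
    using m em by (simp add: ball_avg_def m_def[symmetric] measure_def)
  have "ldist R f (ball_avg d f) = (\<integral>\<^sup>+x\<in>cball 0 R. ennreal \<bar>ball_avg d (\<lambda>_. f x) (0::'a) - ball_avg d f x\<bar> \<partial>lborel)"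
    unfolding const by (simp add: ldist_def nn_integral_completion)
  also have "\<dots> \<le> (\<integral>\<^sup>+x. (ennreal (1 / m) * (\<integral>\<^sup>+z\<in>cball 0 d. ennreal \<bar>f x - f (x + z)\<bar> \<partial>lborel)) * indicator (cball 0 R) x \<partial>lborel)"
    unfolding m_def by (intro nn_integral_mono mult_right_mono ball_avg_diff_le d f continuous_intros) auto
  also have "\<dots> = (\<integral>\<^sup>+x. \<integral>\<^sup>+z. ennreal (1 / m) * (ennreal \<bar>f x - f (x + z)\<bar> * indicator (cball 0 d) z) * indicator (cball 0 R) x \<partial>lborel \<partial>lborel)"
    by (simp add: nn_integral_cmult nn_integral_multc)
  also have "\<dots> = (\<integral>\<^sup>+z. \<integral>\<^sup>+x. ennreal (1 / m) * (ennreal \<bar>f x - f (x + z)\<bar> * indicator (cball 0 d) z) * indicator (cball 0 R) x \<partial>lborel \<partial>lborel)"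
    by (rule nn_integral_lborel_swap) measurable
  also have "\<dots> \<le> (\<integral>\<^sup>+(z::'a). (ennreal (1 / m) * M) * indicator (cball 0 d) z \<partial>lborel)"
  proof (rule nn_integral_mono)
    fix z :: 'a
    show "(\<integral>\<^sup>+x. ennreal (1 / m) * (ennreal \<bar>f x - f (x + z)\<bar> * indicator (cball 0 d) z) * indicator (cball 0 R) x \<partial>lborel)
      \<le> (ennreal (1 / m) * M) * indicator (cball 0 d) z"
    proof (cases "z \<in> cball 0 d")
      case True
      then have "(\<integral>\<^sup>+x\<in>cball 0 R. ennreal \<bar>f x - f (x + z)\<bar> \<partial>lborel) \<le> M"
        using M[of z] by (simp add: abs_minus_commute)
      then show ?thesis using True by (simp add: mult.assoc nn_integral_cmult mult_left_mono)
    qed simp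
  qed
  also have "\<dots> = ennreal (1 / m) * M * ennreal m" by (simp add: nn_integral_cmult_indicator em)
  also have "\<dots> = M * (ennreal (1 / m) * ennreal m)" by (simp add: mult.commute mult.left_commute)
  also have "\<dots> = M" using m by (simp add: ennreal_mult[symmetric])
  finally show ?thesis .
qed

lemma diagonal_convergent_subsequence:
  fixes f :: "nat \<Rightarrow> 'a \<Rightarrow> real"
  assumes S: "countable S" and bdd: "\<And>x. x \<in> S \<Longrightarrow> \<exists>M. \<forall>n. \<bar>f n x\<bar> \<le> M"
  obtains s where "strict_mono (s :: nat \<Rightarrow> nat)" "\<And>x. x \<in> S \<Longrightarrow> convergent (\<lambda>n. f (s n) x)"
proof (cases "S = {}")
  case True
  then show ?thesis using that[of id] strict_mono_id by auto
next
  case False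
  define e where "e = from_nat_into S"
  interpret subseqs "\<lambda>n s. convergent (\<lambda>i. f (s i) (e n))"
  proof
    fix n and s :: "nat \<Rightarrow> nat" assume "strict_mono s"
    obtain M where M: "\<And>k. \<bar>f k (e n)\<bar> \<le> M"
      using bdd[of "e n"] from_nat_into[OF False, of n] by (auto simp: e_def)
    then have "bounded (range (\<lambda>i. f (s i) (e n)))" unfolding bounded_iff by auto
    from bounded_imp_convergent_subsequence[OF this]
    obtain l r where "strict_mono r" "((\<lambda>i. f (s i) (e n)) \<circ> r) \<longlonglongrightarrow> l" by blast
    then show "\<exists>r'. strict_mono r' \<and> convergent (\<lambda>i. f ((s \<circ> r') i) (e n))"
      by (intro exI[of _ r]) (auto simp: o_def convergent_def)
  qed
  have "convergent (\<lambda>i. f (diagseq i) x)" if x: "x \<in> S" for x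
  proof -
    obtain n where n: "x = e n" using from_nat_into_surj[OF S x] by (auto simp: e_def)
    have "convergent (\<lambda>i. f ((diagseq \<circ> ((+) (Suc n))) i) (e n))"
    proof (rule diagseq_holds)
      fix r s :: "nat \<Rightarrow> nat" and k assume "strict_mono r" "convergent (\<lambda>i. f (s i) (e k))"
      then show "convergent (\<lambda>i. f ((s \<circ> r) i) (e k))"
        using convergent_subseq_convergent[of "\<lambda>i. f (s i) (e k)" r] by (simp add: o_def)
    qed
    then have "convergent (\<lambda>i. f (diagseq (i + Suc n)) (e n))" by (simp add: o_def add.commute)
    then show ?thesis unfolding n by (subst (asm) convergent_ignore_initial_segment)
  qed
  then show ?thesis using that[OF subseq_diagseq] by blast
qed

text \<open>The averages are Lipschitz with a constant independent of \<open>n\<close>, so convergence on a dense set spreads to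
all points.\<close>
lemma ball_avg_tendsto_everywhere:
  fixes f :: "nat \<Rightarrow> 'a::euclidean_space \<Rightarrow> real"
  assumes d: "d > 0" and f: "\<And>n. continuous_on UNIV (f n)"
    and M: "\<And>R. \<exists>M. M > 0 \<and> (\<forall>n h r. norm h \<le> r \<longrightarrow> r \<le> 1 \<longrightarrow>
        (\<integral>\<^sup>+x\<in>cball 0 R. ennreal \<bar>f n (x + h) - f n x\<bar> \<partial>lborel) \<le> ennreal (r * M))"
    and Q: "\<And>X. open X \<Longrightarrow> X \<noteq> {} \<Longrightarrow> \<exists>q\<in>Q. q \<in> X"
    and conv: "\<And>q. q \<in> Q \<Longrightarrow> convergent (\<lambda>n. ball_avg d (f n) q)"
  shows "convergent (\<lambda>n. ball_avg d (f n) x)"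
proof -
  define m where "m = measure lborel (cball (0::'a) d)"
  have m: "m > 0" unfolding m_def using content_cball_pos[of d] d by simp
  obtain M where M: "M > 0" "\<And>n h r. norm h \<le> r \<Longrightarrow> r \<le> 1 \<Longrightarrow>
      (\<integral>\<^sup>+z\<in>cball 0 (d + norm x). ennreal \<bar>f n (z + h) - f n z\<bar> \<partial>lborel) \<le> ennreal (r * M)"
    using M[of "d + norm x"] by blast
  have lip: "\<bar>ball_avg d (f n) (x + h) - ball_avg d (f n) x\<bar> \<le> r * (M / m)" if "norm h \<le> r" "r \<le> 1" for h r n
  proof -
    have [measurable]: "f n \<in> borel_measurable borel" by (rule borel_measurable_continuous_onI[OF f])
    have r: "r \<ge> 0" using that norm_ge_zero[of h] by linarith
    have "ennreal \<bar>ball_avg d (f n) (x + h) - ball_avg d (f n) x\<bar>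
      \<le> ennreal (1 / m) * (\<integral>\<^sup>+z\<in>cball 0 d. ennreal \<bar>f n (x + h + z) - f n (x + z)\<bar> \<partial>lborel)"
      unfolding m_def by (rule ball_avg_diff_le[OF d f f])
    also have "(\<integral>\<^sup>+z\<in>cball 0 d. ennreal \<bar>f n (x + h + z) - f n (x + z)\<bar> \<partial>lborel)
        = (\<integral>\<^sup>+z\<in>cball 0 d. ennreal \<bar>f n ((z + x) + h) - f n (z + x)\<bar> \<partial>lborel)"
      by (simp add: algebra_simps)
    also have "\<dots> \<le> (\<integral>\<^sup>+z\<in>cball 0 (d + norm x). ennreal \<bar>f n (z + h) - f n z\<bar> \<partial>lborel)"
      by (rule nn_integral_cball_translate_le[of "\<lambda>z. ennreal \<bar>f n (z + h) - f n z\<bar>"]) auto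
    also have "\<dots> \<le> ennreal (r * M)" by (rule M(2)[OF that])
    finally have "ennreal \<bar>ball_avg d (f n) (x + h) - ball_avg d (f n) x\<bar> \<le> ennreal (1 / m) * ennreal (r * M)"
      by (simp add: mult_left_mono)
    also have "\<dots> = ennreal (r * (M / m))" using m r M(1) by (simp flip: ennreal_mult)
    finally show ?thesis using r m M(1) by simp
  qed
  have "Cauchy (\<lambda>n. ball_avg d (f n) x)"
  proof (rule metric_CauchyI)
    fix e :: real assume e: "e > 0"
    define r where "r = min 1 (e / 4 / (M / m))"
    have r: "r > 0" "r \<le> 1" using e M(1) m by (auto simp: r_def)
    have "r * (M / m) \<le> (e / 4 / (M / m)) * (M / m)" using M(1) m by (intro mult_right_mono) (auto simp: r_def)
    then have re: "r * (M / m) \<le> e / 4" using M(1) m by simp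
    obtain q where q: "q \<in> Q" "q \<in> ball x r" using Q[of "ball x r"] r by auto
    have nq: "norm (q - x) \<le> r" using q(2) by (simp add: dist_norm norm_minus_commute)
    have "Cauchy (\<lambda>n. ball_avg d (f n) q)" using conv[OF q(1)] by (rule convergent_Cauchy)
    then obtain N where N: "\<And>i j. i \<ge> N \<Longrightarrow> j \<ge> N \<Longrightarrow> dist (ball_avg d (f i) q) (ball_avg d (f j) q) < e / 4"
      using e unfolding Cauchy_def by (metis divide_pos_pos zero_less_numeral)
    show "\<exists>N. \<forall>i\<ge>N. \<forall>j\<ge>N. dist (ball_avg d (f i) x) (ball_avg d (f j) x) < e"
    proof (intro exI[of _ N] allI impI)
      fix i j assume "N \<le> i" "N \<le> j"
      then have "dist (ball_avg d (f i) q) (ball_avg d (f j) q) < e / 4" by (rule N)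
      moreover have "\<bar>ball_avg d (f k) q - ball_avg d (f k) x\<bar> \<le> e / 4" for k
        using order_trans[OF lip[OF nq r(2), of k] re] by simp
      from this[of i] this[of j] calculation
      show "dist (ball_avg d (f i) x) (ball_avg d (f j) x) < e" unfolding dist_real_def by arith
    qed
  qed
  then show ?thesis by (simp add: Cauchy_convergent_iff)
qed

lemma ball_avg_bound:
  fixes f :: "'a::euclidean_space \<Rightarrow> real"
  assumes d: "d > 0" and f: "continuous_on UNIV f" and x: "norm x \<le> R"
    and D: "ldist (d + R) f (\<lambda>_. 0) \<le> ennreal D" "D \<ge> 0"
  shows "\<bar>ball_avg d f x\<bar> \<le> D / measure lborel (cball (0::'a) d)"
proof -
  define m where "m = measure lborel (cball (0::'a) d)"
  have m: "m > 0" unfolding m_def using content_cball_pos[of d] d by simp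
  have [measurable]: "f \<in> borel_measurable borel" by (rule borel_measurable_continuous_onI[OF f])
  have "ennreal \<bar>ball_avg d f x - ball_avg d (\<lambda>_. 0) x\<bar>
      \<le> ennreal (1 / m) * (\<integral>\<^sup>+z\<in>cball 0 d. ennreal \<bar>f (x + z) - 0\<bar> \<partial>lborel)"
    unfolding m_def by (rule ball_avg_diff_le[OF d f continuous_on_const])
  also have "(\<integral>\<^sup>+z\<in>cball 0 d. ennreal \<bar>f (x + z) - 0\<bar> \<partial>lborel) = (\<integral>\<^sup>+z\<in>cball 0 d. ennreal \<bar>f (z + x)\<bar> \<partial>lborel)"
    by (simp add: add.commute)
  also have "\<dots> \<le> (\<integral>\<^sup>+z\<in>cball 0 (d + R). ennreal \<bar>f z\<bar> \<partial>lborel)"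
    by (rule nn_integral_cball_translate_le[of "\<lambda>z. ennreal \<bar>f z\<bar>"]) (use x in auto)
  also have "\<dots> \<le> ennreal D" using D(1) by (simp add: ldist_def nn_integral_completion)
  finally have "ennreal \<bar>ball_avg d f x\<bar> \<le> ennreal (1 / m) * ennreal D"
    by (simp add: ball_avg_zero mult_left_mono)
  also have "\<dots> = ennreal (D / m)" using m D(2) by (simp flip: ennreal_mult)
  finally show ?thesis using m D(2) by (simp add: m_def)
qed

lemma ldist_Cauchy_of_bounded_pointwise:
  fixes a :: "nat \<Rightarrow> 'a::euclidean_space \<Rightarrow> real"
  assumes [measurable]: "\<And>n. a n \<in> borel_measurable borel" and conv: "\<And>x. convergent (\<lambda>n. a n x)"
    and bd: "\<And>n x. norm x \<le> R \<Longrightarrow> \<bar>a n x\<bar> \<le> B" and e: "e > 0"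
  shows "\<exists>N. \<forall>m\<ge>N. \<forall>n\<ge>N. ldist R (a m) (a n) \<le> ennreal e"
proof -
  define b where "b x = lim (\<lambda>n. a n x)" for x
  have lim: "(\<lambda>n. a n x) \<longlonglongrightarrow> b x" for x using conv[of x] by (simp add: b_def convergent_LIMSEQ_iff)
  have [measurable]: "b \<in> borel_measurable borel" unfolding b_def[abs_def] by measurable
  have "(\<lambda>n. \<integral>\<^sup>+x. ennreal (norm (indicator (cball 0 R) x * b x - indicator (cball 0 R) x * a n x)) \<partial>lborel) \<longlonglongrightarrow> 0"
  proof (rule nn_integral_dominated_convergence_norm)
    show "AE x in lborel. norm (indicator (cball 0 R) x * a n x) \<le> \<bar>B\<bar> * indicator (cball (0::'a) R) x" for n
    proof (rule AE_I2)
      fix x :: 'a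
      show "norm (indicator (cball 0 R) x * a n x) \<le> \<bar>B\<bar> * indicator (cball 0 R) x"
        using bd[of x n] by (auto split: split_indicator)
    qed
    have "(\<integral>\<^sup>+x. ennreal (\<bar>B\<bar> * indicator (cball (0::'a) R) x) \<partial>lborel) = (\<integral>\<^sup>+x. ennreal \<bar>B\<bar> * indicator (cball (0::'a) R) x \<partial>lborel)"
      by (intro nn_integral_cong) (simp split: split_indicator)
    also have "\<dots> = ennreal \<bar>B\<bar> * emeasure lborel (cball (0::'a) R)" by (rule nn_integral_cmult_indicator) simp
    also have "\<dots> < \<infinity>"
      using fmeasurableD2[OF lmeasurable_cball, of "0::'a" R] by (simp add: less_top[symmetric] ennreal_mult_eq_top_iff)
    finally show "(\<integral>\<^sup>+x. ennreal (\<bar>B\<bar> * indicator (cball (0::'a) R) x) \<partial>lborel) < \<infinity>" .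
    show "AE x in lborel. (\<lambda>n. indicator (cball 0 R) x * a n x) \<longlonglongrightarrow> indicator (cball 0 R) x * b x"
      by (intro AE_I2 tendsto_mult tendsto_const lim)
  qed measurable
  moreover have "(\<integral>\<^sup>+x. ennreal (norm (indicator (cball 0 R) x * b x - indicator (cball 0 R) x * a n x)) \<partial>lborel) = ldist R b (a n)" for n
    unfolding ldist_def nn_integral_completion by (intro nn_integral_cong) (simp split: split_indicator)
  ultimately have "\<forall>\<^sub>F n in sequentially. ldist R b (a n) < ennreal (e / 2)"
    using e unfolding ennreal_tendsto_0_iff by simp
  then obtain N where N: "\<And>n. n \<ge> N \<Longrightarrow> ldist R b (a n) < ennreal (e / 2)" unfolding eventually_sequentially by blast
  have "ldist R (a m) (a n) \<le> ennreal e" if "m \<ge> N" "n \<ge> N" for m n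
  proof -
    have "ldist R (a m) (a n) \<le> ldist R (a m) b + ldist R b (a n)" by (intro ldist_triangle borel_lebesgueI) auto
    also have "\<dots> \<le> ennreal (e / 2) + ennreal (e / 2)"
      using N[OF that(1)] N[OF that(2)] by (intro add_mono) (auto simp: ldist_commute[of R "a m"])
    also have "\<dots> = ennreal (e / 2 + e / 2)" using e by (intro ennreal_plus[symmetric]) auto
    finally show ?thesis by simp
  qed
  then show ?thesis by blast
qed

text \<open>A diagonal argument yields a subsequence along which the averages converge at all points of a countable
dense set, for all radii \<open>1/(k+1)\<close>, hence everywhere. On a ball they are uniformly bounded,
so they are Cauchy in \<open>L\<^sup>1\<close> there; the error of averaging is small uniformly in the index.\<close>
lemma rellich:
  fixes \<phi> :: "nat \<Rightarrow> 'a::euclidean_space \<Rightarrow> real" and p :: real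
  assumes p: "1 < p" "p < DIM('a)" and t: "\<And>n. test_fun (\<phi> n)" and B: "\<And>n. dirichlet p (\<phi> n) \<le> B"
  obtains u s where "strict_mono s" "L1loc u" "L1loc_tendsto (\<lambda>n. \<phi> (s n)) u"
proof -
  have cont: "continuous_on UNIV (\<phi> n)" for n using t by (rule test_fun_continuous)
  have [measurable]: "\<phi> n \<in> borel_measurable borel" for n using t by (rule test_fun_measurable)
  have L: "L1loc (\<phi> n)" for n using cont by (rule continuous_L1loc)
  have "\<exists>D\<ge>0. \<forall>n. ldist R (\<phi> n) (\<lambda>_. 0) \<le> ennreal D" for R
  proof -
    obtain C where C: "C > 0" "\<And>\<phi> :: 'a \<Rightarrow> real. test_fun \<phi> \<Longrightarrow> ldist R \<phi> (\<lambda>_. 0) \<le> ennreal (C * (1 + dirichlet p \<phi>))"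
      using local_L1_bound[OF p, of R] by blast
    have "ldist R (\<phi> n) (\<lambda>_. 0) \<le> ennreal (C * (1 + \<bar>B\<bar>))" for n
    proof -
      have "C * (1 + dirichlet p (\<phi> n)) \<le> C * (1 + \<bar>B\<bar>)" using C(1) B[of n] by (intro mult_left_mono) auto
      then show ?thesis using C(2)[OF t[of n]] by (meson ennreal_leI order_trans)
    qed
    then show ?thesis using C(1) by (intro exI[of _ "C * (1 + \<bar>B\<bar>)"]) auto
  qed
  then obtain D where D: "\<And>R. D R \<ge> 0" "\<And>R n. ldist R (\<phi> n) (\<lambda>_. 0) \<le> ennreal (D R)" by metis
  have M: "\<exists>M. M > 0 \<and> (\<forall>n h r. norm h \<le> r \<longrightarrow> r \<le> 1 \<longrightarrow>
        (\<integral>\<^sup>+x\<in>cball 0 R. ennreal \<bar>\<phi> n (x + h) - \<phi> n x\<bar> \<partial>lborel) \<le> ennreal (r * M))" for R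
  proof -
    define M where "M = measure lebesgue (cball (0::'a) (R + 1)) + \<bar>B\<bar> + 1"
    have M0: "M > 0" unfolding M_def by (simp add: add_nonneg_pos)
    have "(\<integral>\<^sup>+x\<in>cball 0 R. ennreal \<bar>\<phi> n (x + h) - \<phi> n x\<bar> \<partial>lborel) \<le> ennreal (r * M)"
      if h: "norm h \<le> r" "r \<le> 1" for n h r
    proof -
      have r: "r \<ge> 0" using h norm_ge_zero[of h] by linarith
      have "(\<integral>\<^sup>+x\<in>cball 0 R. ennreal \<bar>\<phi> n (x + h) - \<phi> n x\<bar> \<partial>lborel)
        \<le> ennreal r * (\<integral>\<^sup>+x\<in>cball 0 (R + r). ennreal (norm (grad (\<phi> n) x)) \<partial>lborel)"
        by (rule translation_estimate[OF t h(1)])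
      also have "\<dots> \<le> ennreal r * (\<integral>\<^sup>+x\<in>cball 0 (R + 1). ennreal (norm (grad (\<phi> n) x)) \<partial>lborel)"
        using h by (intro mult_left_mono nn_integral_mono) (auto split: split_indicator)
      also have "\<dots> \<le> ennreal r * ennreal (measure lebesgue (cball (0::'a) (R + 1)) + dirichlet p (\<phi> n))"
        by (intro mult_left_mono grad_local_L1_bound p t) auto
      also have "\<dots> \<le> ennreal r * ennreal M"
        using B[of n] by (intro mult_left_mono ennreal_leI) (auto simp: M_def)
      also have "\<dots> = ennreal (r * M)" using r M0 by (simp add: ennreal_mult)
      finally show ?thesis .
    qed
    then show ?thesis using M0 by blast
  qed
  obtain Q :: "'a set" where Q: "countable Q" "\<And>X. open X \<Longrightarrow> X \<noteq> {} \<Longrightarrow> \<exists>q\<in>Q. q \<in> X"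
    by (rule countable_dense_setE) blast
  define \<delta> where "\<delta> k = inverse (real (Suc k))" for k
  have \<delta>: "\<delta> k > 0" "\<delta> k \<le> 1" for k by (simp_all add: \<delta>_def field_simps)
  have "countable ((UNIV :: nat set) \<times> Q)" using Q(1) by auto
  then obtain s where s: "strict_mono s"
    and s_conv: "\<And>z. z \<in> (UNIV :: nat set) \<times> Q \<Longrightarrow> convergent (\<lambda>n. ball_avg (\<delta> (fst z)) (\<phi> (s n)) (snd z))"
  proof (rule diagonal_convergent_subsequence[where f = "\<lambda>n z. ball_avg (\<delta> (fst z)) (\<phi> n) (snd z)"])
    fix z :: "nat \<times> 'a"
    have "\<bar>ball_avg (\<delta> (fst z)) (\<phi> n) (snd z)\<bar>
      \<le> D (\<delta> (fst z) + norm (snd z)) / measure lborel (cball (0::'a) (\<delta> (fst z)))" for n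
      by (rule ball_avg_bound[OF \<delta>(1) cont order_refl D(2) D(1)])
    then show "\<exists>M. \<forall>n. \<bar>ball_avg (\<delta> (fst z)) (\<phi> n) (snd z)\<bar> \<le> M" by blast
  qed blast
  have conv: "convergent (\<lambda>n. ball_avg (\<delta> k) (\<phi> (s n)) x)" for k x
  proof (rule ball_avg_tendsto_everywhere[OF \<delta>(1) cont])
    show "\<exists>M>0. \<forall>n h r. norm h \<le> r \<longrightarrow> r \<le> 1 \<longrightarrow>
        (\<integral>\<^sup>+x\<in>cball 0 R. ennreal \<bar>\<phi> (s n) (x + h) - \<phi> (s n) x\<bar> \<partial>lborel) \<le> ennreal (r * M)" for R
      using M[of R] by blast
    show "\<exists>q\<in>Q. q \<in> X" if "open X" "X \<noteq> {}" for X using Q(2) that by blast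
    show "convergent (\<lambda>n. ball_avg (\<delta> k) (\<phi> (s n)) q)" if "q \<in> Q" for q
      using s_conv[of "(k, q)"] that by simp
  qed
  have cauchy: "\<exists>N. \<forall>m\<ge>N. \<forall>n\<ge>N. ldist R (\<phi> (s m)) (\<phi> (s n)) \<le> ennreal e" if e: "0 < e" for R e
  proof -
    obtain M where M: "M > 0" "\<And>n h r. norm h \<le> r \<Longrightarrow> r \<le> 1 \<Longrightarrow>
        (\<integral>\<^sup>+x\<in>cball 0 R. ennreal \<bar>\<phi> n (x + h) - \<phi> n x\<bar> \<partial>lborel) \<le> ennreal (r * M)"
      using M[of R] by blast
    have "\<exists>k. inverse (real (Suc k)) < e / 3 / M" using e M(1) by (intro reals_Archimedean) auto
    then obtain k where "\<delta> k < e / 3 / M" by (auto simp: \<delta>_def)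
    then have k: "\<delta> k * M \<le> e / 3" using M(1) by (simp add: field_simps)
    have 1: "ldist R (\<phi> n) (ball_avg (\<delta> k) (\<phi> n)) \<le> ennreal (e / 3)" for n
    proof -
      have "ldist R (\<phi> n) (ball_avg (\<delta> k) (\<phi> n)) \<le> ennreal (\<delta> k * M)"
        by (rule ldist_ball_avg[OF \<delta>(1) cont]) (use M(2) \<delta>(2) in blast)
      also have "\<dots> \<le> ennreal (e / 3)" using k by (rule ennreal_leI)
      finally show ?thesis .
    qed
    have "\<exists>N. \<forall>m\<ge>N. \<forall>n\<ge>N. ldist R (ball_avg (\<delta> k) (\<phi> (s m))) (ball_avg (\<delta> k) (\<phi> (s n))) \<le> ennreal (e / 3)"
    proof (rule ldist_Cauchy_of_bounded_pointwise)
      show "convergent (\<lambda>n. ball_avg (\<delta> k) (\<phi> (s n)) x)" for x by (rule conv)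
      show "\<bar>ball_avg (\<delta> k) (\<phi> (s n)) x\<bar> \<le> D (\<delta> k + R) / measure lborel (cball (0::'a) (\<delta> k))" if "norm x \<le> R" for n x
        by (rule ball_avg_bound[OF \<delta>(1) cont that D(2) D(1)])
    qed (use e in auto)
    then obtain N where N: "\<And>m n. m \<ge> N \<Longrightarrow> n \<ge> N \<Longrightarrow>
        ldist R (ball_avg (\<delta> k) (\<phi> (s m))) (ball_avg (\<delta> k) (\<phi> (s n))) \<le> ennreal (e / 3)" by blast
    have "ldist R (\<phi> (s m)) (\<phi> (s n)) \<le> ennreal e" if mn: "m \<ge> N" "n \<ge> N" for m n
    proof -
      let ?A = "\<lambda>n. ball_avg (\<delta> k) (\<phi> (s n))"
      have ms: "\<phi> (s n) \<in> borel_measurable lebesgue" "?A n \<in> borel_measurable lebesgue" for n by (auto intro!: borel_lebesgueI)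
      have "ldist R (\<phi> (s m)) (\<phi> (s n)) \<le> ldist R (\<phi> (s m)) (?A m) + ldist R (?A m) (\<phi> (s n))"
        by (intro ldist_triangle ms)
      also have "\<dots> \<le> ldist R (\<phi> (s m)) (?A m) + (ldist R (?A m) (?A n) + ldist R (?A n) (\<phi> (s n)))"
        by (intro add_left_mono ldist_triangle ms)
      also have "\<dots> \<le> ennreal (e / 3) + (ennreal (e / 3) + ennreal (e / 3))"
        using 1[of "s m"] 1[of "s n"] N[OF mn] by (intro add_mono) (auto simp: ldist_commute[of R "?A n"])
      also have "\<dots> = ennreal (e / 3 + (e / 3 + e / 3))" using e by (simp only: ennreal_plus[symmetric] less_imp_le divide_pos_pos zero_less_numeral add_nonneg_nonneg)
      finally show ?thesis by simp
    qed
    then show ?thesis by blast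
  qed
  obtain u where "L1loc u" "L1loc_tendsto (\<lambda>n. \<phi> (s n)) u"
    using L1loc_Cauchy_convergent[of "\<lambda>n. \<phi> (s n)", OF L cauchy] by blast
  then show ?thesis using that s by blast
qed

text \<open>Each \<open>u n\<close> is replaced by a test function within \<open>1/(n+1)\<close> of it, both in energy and in \<open>L\<^sup>1\<close> of the
ball of radius \<open>n\<close>. Local compactness and the lemma on weak limits then apply to the test functions.\<close>
lemma beppo_levi_compact:
  fixes u :: "nat \<Rightarrow> 'a::euclidean_space \<Rightarrow> real" and p :: real
  assumes p: "1 < p" "p < DIM('a)" and u: "\<And>n. u n \<in> beppo_levi p" and e: "(\<lambda>n. energy p (u n)) \<longlonglongrightarrow> e"
  obtains v s where "strict_mono s" "v \<in> beppo_levi p" "AE x in lebesgue. (\<lambda>n. u (s n) x) \<longlonglongrightarrow> v x" "energy p v \<le> e"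
proof -
  have Lu: "L1loc (u n)" for n using u by (simp add: beppo_levi_def)
  have "\<exists>w. test_fun w \<and> ldist (real n) w (u n) < ennreal (inverse (real (Suc n)))
      \<and> \<bar>dirichlet p w - energy p (u n)\<bar> < inverse (real (Suc n))" for n
  proof -
    obtain \<phi> where \<phi>: "\<And>k. test_fun (\<phi> k)" "L1loc_tendsto \<phi> (u n)" "(\<lambda>k. dirichlet p (\<phi> k)) \<longlonglongrightarrow> energy p (u n)"
      using beppo_levi_approx[OF p(1) u] by metis
    have "\<forall>\<^sub>F k in sequentially. ldist (real n) (\<phi> k) (u n) < ennreal (inverse (real (Suc n)))"
      using \<phi>(2) unfolding L1loc_tendsto_def ennreal_tendsto_0_iff by simp
    moreover have "\<forall>\<^sub>F k in sequentially. dist (dirichlet p (\<phi> k)) (energy p (u n)) < inverse (real (Suc n))"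
      using \<phi>(3) by (rule tendstoD) simp
    ultimately have "\<forall>\<^sub>F k in sequentially. ldist (real n) (\<phi> k) (u n) < ennreal (inverse (real (Suc n)))
       \<and> dist (dirichlet p (\<phi> k)) (energy p (u n)) < inverse (real (Suc n))"
      by (rule eventually_conj)
    then obtain k where "ldist (real n) (\<phi> k) (u n) < ennreal (inverse (real (Suc n)))"
       "dist (dirichlet p (\<phi> k)) (energy p (u n)) < inverse (real (Suc n))"
      using eventually_happens'[OF sequentially_bot] by blast
    then show ?thesis using \<phi>(1) by (auto simp: dist_real_def)
  qed
  then obtain w where w: "\<And>n. test_fun (w n)" "\<And>n. ldist (real n) (w n) (u n) < ennreal (inverse (real (Suc n)))"
      "\<And>n. \<bar>dirichlet p (w n) - energy p (u n)\<bar> < inverse (real (Suc n))" by metis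
  have Lw: "L1loc (w n)" for n using w(1) by (intro continuous_L1loc test_fun_continuous)
  have inv0: "(\<lambda>k. inverse (real (Suc k))) \<longlonglongrightarrow> 0" by (rule LIMSEQ_inverse_real_of_nat)
  have "(\<lambda>n. dirichlet p (w n) - energy p (u n)) \<longlonglongrightarrow> 0"
    by (rule Lim_null_comparison[OF _ inv0])
      (use w(3) in \<open>auto intro!: always_eventually less_imp_le simp del: of_nat_Suc\<close>)
  from tendsto_add[OF this e] have ew: "(\<lambda>n. dirichlet p (w n)) \<longlonglongrightarrow> e" by simp
  then have "Bseq (\<lambda>n. dirichlet p (w n))" by (intro convergent_imp_Bseq) (auto simp: convergent_def)
  then obtain B where B: "\<And>n. dirichlet p (w n) \<le> B" unfolding Bseq_def by (auto simp: abs_le_iff)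
  obtain v s where s: "strict_mono s" "L1loc v" "L1loc_tendsto (\<lambda>n. w (s n)) v"
    using rellich[OF p w(1) B] by (rule rellich[OF p w(1) B])
  have "(\<lambda>n. dirichlet p (w (s n))) \<longlonglongrightarrow> e" using LIMSEQ_subseq_LIMSEQ[OF ew s(1)] by (simp add: o_def)
  from beppo_levi_weak_limit[OF p(1) w(1) s(2,3) this] have v: "v \<in> beppo_levi p" "energy p v \<le> e" by auto
  have "L1loc_tendsto (\<lambda>n. u (s n)) v" unfolding L1loc_tendsto_def
  proof
    fix R
    have inv1: "(\<lambda>n. ennreal (inverse (real (Suc n)))) \<longlonglongrightarrow> 0"
      using tendsto_ennrealI[OF inv0] by simp
    have lim: "(\<lambda>n. ennreal (inverse (real (Suc n))) + ldist R (w (s n)) v) \<longlonglongrightarrow> 0"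
      using tendsto_add[OF inv1 s(3)[unfolded L1loc_tendsto_def, rule_format, of R]] by simp
    have "\<forall>\<^sub>F n in sequentially. ldist R (u (s n)) v \<le> ennreal (inverse (real (Suc n))) + ldist R (w (s n)) v"
      using eventually_ge_at_top[of "nat \<lceil>R\<rceil>"]
    proof eventually_elim
      case (elim n)
      have sn: "n \<le> s n" by (rule seq_suble[OF s(1)])
      then have R: "R \<le> real (s n)" using elim by linarith
      have "ldist R (u (s n)) (w (s n)) \<le> ldist (real (s n)) (w (s n)) (u (s n))"
        using ldist_mono[OF R] by (simp add: ldist_commute)
      also have "\<dots> \<le> ennreal (inverse (real (Suc (s n))))" using w(2) by (rule less_imp_le)
      also have "\<dots> \<le> ennreal (inverse (real (Suc n)))" using sn by (intro ennreal_leI le_imp_inverse_le) auto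
      finally have "ldist R (u (s n)) (w (s n)) \<le> ennreal (inverse (real (Suc n)))" .
      moreover have "ldist R (u (s n)) v \<le> ldist R (u (s n)) (w (s n)) + ldist R (w (s n)) v"
        by (intro ldist_triangle L1loc_measurable Lu Lw s)
      ultimately show ?case by (meson add_right_mono order_trans)
    qed
    then show "(\<lambda>n. ldist R (u (s n)) v) \<longlonglongrightarrow> 0"
      by (intro tendsto_sandwich[OF _ _ tendsto_const lim]) auto
  qed
  then obtain s' where s': "strict_mono s'" "AE x in lebesgue. (\<lambda>n. u (s (s' n)) x) \<longlonglongrightarrow> v x"
    by (rule L1loc_tendsto_AE_subseq[OF Lu s(2)])
  have "strict_mono (s \<circ> s')" using s(1) s'(1) by (rule strict_mono_o)
  then show ?thesis using that[of "s \<circ> s'"] v s'(2) by (simp add: o_def)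
qed

section \<open>Capacitary inequalities\<close>

lemma Cap_le_dirichlet:
  fixes \<phi> :: "'a::euclidean_space \<Rightarrow> real"
  assumes t: "test_fun \<phi>" and ge: "\<And>x. x \<in> F \<Longrightarrow> 1 \<le> \<phi> x"
  shows "0 \<le> Cap p F" "Cap p F \<le> dirichlet p \<phi>"
proof -
  let ?S = "{energy p u | u. u \<in> beppo_levi p \<and> (AE x in lebesgue. x \<in> F \<longrightarrow> u x \<ge> 1)}"
  have mem: "dirichlet p \<phi> \<in> ?S"
    using test_fun_beppo_levi[OF t, of p] energy_test_fun[OF t, of p] ge by (auto intro!: exI[of _ \<phi>])
  have nn: "0 \<le> y" if "y \<in> ?S" for y using that by (auto simp: energy_def)
  show "0 \<le> Cap p F" unfolding Cap_def using mem nn by (intro cInf_greatest) blast+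
  show "Cap p F \<le> dirichlet p \<phi>" unfolding Cap_def using mem nn by (intro cInf_lower bdd_belowI[of _ 0])
qed

lemma weight_mass_le_capacity:
  fixes \<phi> g :: "'a::euclidean_space \<Rightarrow> real"
  assumes p: "0 < p" "0 \<le> r" and W: "weight_norm p r g < \<infinity>"
    and F: "F \<in> sets lebesgue" "bounded F" and t: "test_fun \<phi>" and ge: "\<And>x. x \<in> F \<Longrightarrow> 1 \<le> \<phi> x"
  shows "(\<integral>\<^sup>+x\<in>F. ennreal \<bar>g x\<bar> \<partial>lebesgue) \<le> weight_norm p r g * ennreal (dirichlet p \<phi> powr (r / p))"
proof -
  define a where "a = (\<integral>\<^sup>+x\<in>F. ennreal \<bar>g x\<bar> \<partial>lebesgue)"
  define c where "c = ennreal (Cap p F powr (r / p))"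
  note cap = Cap_le_dirichlet[OF t ge]
  have "a / c \<le> weight_norm p r g"
    unfolding weight_norm_def a_def c_def by (rule SUP_upper) (use F in simp)
  moreover have "a \<le> (a / c) * c" if "a / c < \<infinity>"
  proof (cases "c = 0")
    case True
    then show ?thesis using that by (cases "a = 0") (auto simp: ennreal_divide_zero)
  next
    case False
    then have "c * (a / c) = a" by (simp add: ennreal_times_divide ennreal_mult_divide_eq c_def mult.commute)
    then show ?thesis by (simp add: mult.commute)
  qed
  ultimately have "a \<le> weight_norm p r g * c" using W by (meson le_less_trans mult_right_mono order_trans zero_le)
  also have "\<dots> \<le> weight_norm p r g * ennreal (dirichlet p \<phi> powr (r / p))"
    unfolding c_def using p cap by (intro mult_left_mono ennreal_leI powr_mono2) auto
  finally show ?thesis by (simp add: a_def)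
qed

lemma superlevel:
  fixes \<phi> :: "'a::euclidean_space \<Rightarrow> real"
  assumes t: "test_fun \<phi>" and s: "s > 0"
  shows "{x. s \<le> \<phi> x} \<in> sets lebesgue" "bounded {x. s \<le> \<phi> x}"
proof -
  have "closed {x. s \<le> \<phi> x}" by (intro closed_Collect_le continuous_on_const test_fun_continuous t)
  then show "{x. s \<le> \<phi> x} \<in> sets lebesgue" by (simp add: borel_closed)
  obtain R where R: "\<And>x. R < norm x \<Longrightarrow> \<phi> x = 0" using test_fun_supportE[OF t] by metis
  have "norm x \<le> R" if "s \<le> \<phi> x" for x using R[of x] that s by fastforce
  then show "bounded {x. s \<le> \<phi> x}" unfolding bounded_iff by blast
qed

lemma test_fun_minus: "test_fun \<phi> \<Longrightarrow> test_fun (\<lambda>x. - \<phi> x)"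
  using test_fun_cmult[of \<phi> "-1"] by simp

lemma dirichlet_minus: "test_fun \<phi> \<Longrightarrow> dirichlet p (\<lambda>x. - \<phi> x) = dirichlet p \<phi>"
  using dirichlet_cmult[of \<phi> p "-1"] by simp

text \<open>The function \<open>\<phi>/s\<close> competes for the capacity of \<open>{\<phi> \<ge> s}\<close>, and \<open>-\<phi>/s\<close> for that of \<open>{-\<phi> \<ge> s}\<close>.
Treating both signs separately avoids \<open>|\<phi>|\<close>, which is not smooth.\<close>
lemma capacitary_weak_type:
  fixes \<phi> g :: "'a::euclidean_space \<Rightarrow> real"
  assumes p: "0 < p" "0 \<le> r" and W: "weight_norm p r g < \<infinity>" and [measurable]: "g \<in> borel_measurable lebesgue"
    and t: "test_fun \<phi>" and s: "s > 0"
  shows "(\<integral>\<^sup>+x\<in>{x. s \<le> \<bar>\<phi> x\<bar>}. ennreal \<bar>g x\<bar> \<partial>lebesgue)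
    \<le> 2 * (weight_norm p r g * ennreal (s powr (- r) * dirichlet p \<phi> powr (r / p)))"
proof -
  have one: "(\<integral>\<^sup>+x\<in>{x. s \<le> f x}. ennreal \<bar>g x\<bar> \<partial>lebesgue)
    \<le> weight_norm p r g * ennreal (s powr (- r) * dirichlet p f powr (r / p))" if f: "test_fun f" for f :: "'a \<Rightarrow> real"
  proof -
    have "(\<integral>\<^sup>+x\<in>{x. s \<le> f x}. ennreal \<bar>g x\<bar> \<partial>lebesgue)
      \<le> weight_norm p r g * ennreal (dirichlet p (\<lambda>x. (1 / s) * f x) powr (r / p))"
      by (rule weight_mass_le_capacity[OF p W superlevel[OF f s] test_fun_cmult[OF f]]) (use s in \<open>auto simp: field_simps\<close>)
    also have "dirichlet p (\<lambda>x. (1 / s) * f x) powr (r / p) = s powr (- r) * dirichlet p f powr (r / p)"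
    proof -
      have "dirichlet p (\<lambda>x. (1 / s) * f x) = s powr (- p) * dirichlet p f"
        using dirichlet_cmult[OF f, of p "1 / s"] s by (simp add: powr_divide powr_minus_divide)
      moreover have "(s powr (- p)) powr (r / p) = s powr (- r)" using p by (simp add: powr_powr)
      ultimately show ?thesis by (simp add: powr_mult dirichlet_nonneg)
    qed
    finally show ?thesis .
  qed
  note S = superlevel(1)[OF t s] superlevel(1)[OF test_fun_minus[OF t] s]
  have "(\<integral>\<^sup>+x\<in>{x. s \<le> \<bar>\<phi> x\<bar>}. ennreal \<bar>g x\<bar> \<partial>lebesgue)
    \<le> (\<integral>\<^sup>+x. ennreal \<bar>g x\<bar> * indicator {x. s \<le> \<phi> x} x + ennreal \<bar>g x\<bar> * indicator {x. s \<le> - \<phi> x} x \<partial>lebesgue)"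
    by (intro nn_integral_mono) (auto split: split_indicator)
  also have "\<dots> = (\<integral>\<^sup>+x\<in>{x. s \<le> \<phi> x}. ennreal \<bar>g x\<bar> \<partial>lebesgue) + (\<integral>\<^sup>+x\<in>{x. s \<le> - \<phi> x}. ennreal \<bar>g x\<bar> \<partial>lebesgue)"
    using S by (intro nn_integral_add borel_measurable_times borel_measurable_indicator) auto
  also have "\<dots> \<le> weight_norm p r g * ennreal (s powr (- r) * dirichlet p \<phi> powr (r / p))
      + weight_norm p r g * ennreal (s powr (- r) * dirichlet p \<phi> powr (r / p))"
    using one[OF t] one[OF test_fun_minus[OF t]] by (intro add_mono) (simp_all add: dirichlet_minus[OF t])
  finally show ?thesis by (simp add: mult_2)
qed

lemma dyadic_scale:
  fixes s T :: real
  assumes "0 < T" "T \<le> s"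
  obtains j :: nat where "2 ^ j * T \<le> s" "s < 2 ^ Suc j * T"
proof -
  define j where "j = nat \<lfloor>log 2 (s / T)\<rfloor>"
  have pos: "s / T \<ge> 1" using assms by simp
  then have l: "log 2 (s / T) \<ge> 0" by simp
  have "real j \<le> log 2 (s / T)" "log 2 (s / T) < real (Suc j)"
    using l unfolding j_def by linarith+
  then have "2 powr real j \<le> s / T" "s / T < 2 powr real (Suc j)"
    using pos by (simp_all add: le_log_iff log_less_iff)
  then have "2 ^ j * T \<le> s" "s < 2 ^ Suc j * T"
    using assms(1) by (simp_all only: powr_realpow zero_less_numeral) (simp_all add: field_simps)
  then show ?thesis using that by blast
qed

lemma le_suminf_ennreal: "f i \<le> (\<Sum>i. f i :: ennreal)"
  using sum_le_suminf[of f "{i}"] by simp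

lemma dyadic_layers:
  fixes f g :: "'a::euclidean_space \<Rightarrow> real"
  assumes [measurable]: "f \<in> borel_measurable lebesgue" "g \<in> borel_measurable lebesgue"
    and q: "0 \<le> q" and T: "0 < T"
  shows "(\<integral>\<^sup>+x. ennreal \<bar>g x\<bar> * (ennreal (\<bar>f x\<bar> powr q) * indicator {T..} (f x)) \<partial>lebesgue)
    \<le> (\<Sum>j. ennreal ((2 ^ Suc j * T) powr q) * (\<integral>\<^sup>+x\<in>{x. 2 ^ j * T \<le> f x}. ennreal \<bar>g x\<bar> \<partial>lebesgue))"
proof -
  define F where "F j = {x. 2 ^ j * T \<le> f x}" for j :: nat
  define c where "c j = (2 ^ Suc j * T) powr q" for j :: nat
  have [measurable]: "F j \<in> sets lebesgue" for j
  proof -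
    have "{x \<in> space lebesgue. 2 ^ j * T \<le> f x} \<in> sets lebesgue" by measurable
    then show ?thesis by (simp add: F_def)
  qed
  have "(\<integral>\<^sup>+x. ennreal \<bar>g x\<bar> * (ennreal (\<bar>f x\<bar> powr q) * indicator {T..} (f x)) \<partial>lebesgue)
    \<le> (\<integral>\<^sup>+x. (\<Sum>j. ennreal (c j) * (ennreal \<bar>g x\<bar> * indicator (F j) x)) \<partial>lebesgue)"
  proof (rule nn_integral_mono)
    fix x
    show "ennreal \<bar>g x\<bar> * (ennreal (\<bar>f x\<bar> powr q) * indicator {T..} (f x))
      \<le> (\<Sum>j. ennreal (c j) * (ennreal \<bar>g x\<bar> * indicator (F j) x))"
    proof (cases "T \<le> f x")
      case True
      obtain j :: nat where j: "2 ^ j * T \<le> f x" "f x < 2 ^ Suc j * T"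
        using dyadic_scale[OF T True] by blast
      have "\<bar>f x\<bar> powr q \<le> c j" unfolding c_def using j q T True by (intro powr_mono2) auto
      then have "ennreal \<bar>g x\<bar> * (ennreal (\<bar>f x\<bar> powr q) * indicator {T..} (f x)) \<le> ennreal \<bar>g x\<bar> * ennreal (c j)"
        using True by (auto intro!: mult_left_mono ennreal_leI)
      also have "\<dots> = ennreal (c j) * (ennreal \<bar>g x\<bar> * indicator (F j) x)"
        using j(1) by (simp add: F_def mult.commute)
      also have "\<dots> \<le> (\<Sum>j. ennreal (c j) * (ennreal \<bar>g x\<bar> * indicator (F j) x))" by (rule le_suminf_ennreal)
      finally show ?thesis .
    qed simp
  qed
  also have "\<dots> = (\<Sum>j. \<integral>\<^sup>+x. ennreal (c j) * (ennreal \<bar>g x\<bar> * indicator (F j) x) \<partial>lebesgue)"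
    by (rule nn_integral_suminf) measurable
  also have "\<dots> = (\<Sum>j. ennreal (c j) * (\<integral>\<^sup>+x\<in>F j. ennreal \<bar>g x\<bar> \<partial>lebesgue))"
    by (intro suminf_cong nn_integral_cmult) measurable
  finally show ?thesis by (simp add: c_def F_def)
qed

text \<open>Sum the weak type estimate over the dyadic levels above \<open>T\<close>. The series is geometric with ratio
\<open>2^(q-r) < 1\<close>.\<close>
lemma tail_test_fun:
  fixes g :: "'a::euclidean_space \<Rightarrow> real" and p q r :: real
  assumes p: "0 < p" "0 \<le> q" "q < r" and W: "weight_norm p r g < \<infinity>" and gm [measurable]: "g \<in> borel_measurable lebesgue"
    and t: "test_fun \<phi>" and T: "T > 0"
  shows "(\<integral>\<^sup>+x. ennreal \<bar>g x\<bar> * (ennreal (\<bar>\<phi> x\<bar> powr q) * indicator {T<..} \<bar>\<phi> x\<bar>) \<partial>lebesgue)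
    \<le> weight_norm p r g * ennreal (2 * 2 powr q / (1 - 2 powr (q - r)) * T powr (q - r) * dirichlet p \<phi> powr (r / p))"
proof -
  define D where "D = dirichlet p \<phi> powr (r / p)"
  define W' where "W' = weight_norm p r g"
  have [measurable]: "\<phi> \<in> borel_measurable lebesgue" using test_fun_measurable(1)[OF t] by auto
  define F where "F j = {x. 2 ^ j * T \<le> \<bar>\<phi> x\<bar>}" for j :: nat
  define c where "c j = ((2 ^ Suc j * T) powr q)" for j :: nat
  have each: "ennreal (c j) * (\<integral>\<^sup>+x\<in>F j. ennreal \<bar>g x\<bar> \<partial>lebesgue)
    \<le> W' * ennreal (2 * 2 powr q * T powr (q - r) * D * (2 powr (q - r)) ^ j)" for j
  proof -
    have "ennreal (c j) * (\<integral>\<^sup>+x\<in>F j. ennreal \<bar>g x\<bar> \<partial>lebesgue) \<le> ennreal (c j) * (2 * (W' * ennreal ((2 ^ j * T) powr (- r) * D)))"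
      unfolding F_def W'_def D_def using p T by (intro mult_left_mono capacitary_weak_type W gm t) auto
    also have "\<dots> = W' * (ennreal 2 * (ennreal (c j) * ennreal ((2 ^ j * T) powr (- r) * D)))"
      by (simp add: mult_ac)
    also have "ennreal 2 * (ennreal (c j) * ennreal ((2 ^ j * T) powr (- r) * D)) = ennreal (2 * (c j * ((2 ^ j * T) powr (- r) * D)))"
      by (simp add: ennreal_mult c_def D_def)
    also have "2 * (c j * ((2 ^ j * T) powr (- r) * D)) = 2 * 2 powr q * T powr (q - r) * D * (2 powr (q - r)) ^ j"
    proof -
      have "c j = 2 powr q * (2 ^ j * T) powr q" unfolding c_def using T by (simp add: powr_mult mult.assoc)
      moreover have "(2 ^ j * T) powr q * (2 ^ j * T) powr (- r) = (2 ^ j * T) powr (q - r)" by (simp flip: powr_add)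
      moreover have "(2 ^ j * T) powr (q - r) = (2 powr (q - r)) ^ j * T powr (q - r)"
        using T by (simp add: powr_mult powr_power powr_powr mult.commute flip: powr_realpow)
      ultimately show ?thesis by (simp add: mult_ac)
    qed
    finally show ?thesis .
  qed
  have x: "2 powr (q - r) < (1::real)" using powr_less_mono[of "q - r" 0 2] p by simp
  have "(\<integral>\<^sup>+x. ennreal \<bar>g x\<bar> * (ennreal (\<bar>\<phi> x\<bar> powr q) * indicator {T<..} \<bar>\<phi> x\<bar>) \<partial>lebesgue)
    \<le> (\<integral>\<^sup>+x. ennreal \<bar>g x\<bar> * (ennreal (\<bar>\<bar>\<phi> x\<bar>\<bar> powr q) * indicator {T..} \<bar>\<phi> x\<bar>) \<partial>lebesgue)"
    by (intro nn_integral_mono) (auto split: split_indicator)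
  also have "\<dots> \<le> (\<Sum>j. ennreal (c j) * (\<integral>\<^sup>+x\<in>F j. ennreal \<bar>g x\<bar> \<partial>lebesgue))"
    unfolding c_def F_def using p T by (intro dyadic_layers) auto
  also have "\<dots> \<le> (\<Sum>j. W' * ennreal (2 * 2 powr q * T powr (q - r) * D * (2 powr (q - r)) ^ j))"
    by (intro suminf_le each) auto
  also have "\<dots> = W' * (\<Sum>j. ennreal (2 * 2 powr q * T powr (q - r) * D * (2 powr (q - r)) ^ j))"
    by (rule ennreal_suminf_cmult)
  also have "(\<Sum>j. ennreal (2 * 2 powr q * T powr (q - r) * D * (2 powr (q - r)) ^ j))
      = ennreal (\<Sum>j. 2 * 2 powr q * T powr (q - r) * D * (2 powr (q - r)) ^ j)"
    using x by (intro suminf_ennreal2) (auto simp: D_def intro!: summable_mult summable_geometric)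
  also have "(\<Sum>j. 2 * 2 powr q * T powr (q - r) * D * (2 powr (q - r)) ^ j)
      = 2 * 2 powr q * T powr (q - r) * D * (1 / (1 - 2 powr (q - r)))"
    using x by (subst suminf_mult) (auto simp: suminf_geometric intro!: summable_geometric)
  finally show ?thesis by (simp add: D_def W'_def mult_ac)
qed

text \<open>Maz'ya's truncation argument. At the level \<open>t = 2^j a\<close> the capacity of \<open>{\<phi> \<ge> 2t}\<close> is tested with the
smooth truncation \<open>step (\<phi>/t)\<close>, whose gradient is at most \<open>36/t |\<nabla>\<phi>|\<close> and lives on
\<open>{t < \<phi> < 2t}\<close>. These sets are disjoint, so the sum over \<open>j\<close> costs the energy only once, whereas
summing the weak type estimate would diverge. The factor \<open>144\<close> is \<open>4 * 36\<close>, as \<open>\<phi> < 4t\<close> on the layer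
between \<open>2t\<close> and \<open>4t\<close>.\<close>
lemma strong_type_one_sided:
  fixes g :: "'a::euclidean_space \<Rightarrow> real" and p :: real
  assumes p: "0 < p" and W: "weight_norm p p g < \<infinity>" and gm [measurable]: "g \<in> borel_measurable lebesgue"
    and t: "test_fun \<phi>" and a: "a > 0"
  shows "(\<integral>\<^sup>+x. ennreal \<bar>g x\<bar> * (ennreal (\<bar>\<phi> x\<bar> powr p) * indicator {2 * a..} (\<phi> x)) \<partial>lebesgue)
    \<le> weight_norm p p g * ennreal (144 powr p * dirichlet p \<phi>)"
proof -
  define W' where "W' = weight_norm p p g"
  have [measurable]: "\<phi> \<in> borel_measurable lebesgue" "grad \<phi> \<in> borel_measurable lebesgue"
    using test_fun_measurable[OF t] by auto
  define \<tau> where "\<tau> j = 2 ^ j * a" for j :: nat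
  have \<tau>: "\<tau> j > 0" for j using a by (simp add: \<tau>_def)
  define F where "F j = {x. 2 * \<tau> j \<le> \<phi> x}" for j :: nat
  have F: "F j \<in> sets lebesgue" "bounded (F j)" for j
    unfolding F_def using \<tau>[of j] by (auto intro!: superlevel t)
  define A where "A j = {x. \<tau> j < \<phi> x \<and> \<phi> x < 2 * \<tau> j}" for j :: nat
  have A [measurable]: "A j \<in> sets lebesgue" for j
  proof -
    have "{x \<in> space lebesgue. \<tau> j < \<phi> x \<and> \<phi> x < 2 * \<tau> j} \<in> sets lebesgue" by measurable
    then show ?thesis by (simp add: A_def)
  qed
  have disj: "disjoint_family A"
  proof -
    have "A i \<inter> A j = {}" if "i < j" for i j :: nat
    proof -
      have "Suc i \<le> j" using that by simp
      then have "(2::real) ^ Suc i \<le> 2 ^ j" by (intro power_increasing) auto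
      then have "2 * \<tau> i \<le> \<tau> j" using a mult_right_mono[of "2 ^ Suc i" "2 ^ j" a] by (simp add: \<tau>_def)
      then show ?thesis by (auto simp: A_def)
    qed
    then show ?thesis unfolding disjoint_family_on_def by (metis Int_commute linorder_neqE_nat)
  qed
  have D: "ennreal (dirichlet p (\<lambda>x. step ((1 / \<tau> j) * \<phi> x)))
      \<le> (\<integral>\<^sup>+x. ennreal ((36 / \<tau> j) powr p) * (ennreal (norm (grad \<phi> x) powr p) * indicator (A j) x) \<partial>lebesgue)" for j
  proof -
    have g: "grad (\<lambda>x. step ((1 / \<tau> j) * \<phi> x)) x = (step' ((1 / \<tau> j) * \<phi> x) * (1 / \<tau> j)) *\<^sub>R grad \<phi> x" for x
    proof -
      have "((\<lambda>s. step ((1 / \<tau> j) * s)) has_real_derivative step' ((1 / \<tau> j) * \<phi> x) * (1 / \<tau> j)) (at (\<phi> x))"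
        by (rule DERIV_chain2[where f = step, OF step_has_derivative]) (use \<tau>[of j] in \<open>auto intro!: derivative_eq_intros\<close>)
      from grad_compose[OF this test_fun_smooth[OF t]] show ?thesis .
    qed
    have "ennreal (dirichlet p (\<lambda>x. step ((1 / \<tau> j) * \<phi> x)))
      = (\<integral>\<^sup>+x. ennreal (norm (grad (\<lambda>x. step ((1 / \<tau> j) * \<phi> x)) x) powr p) \<partial>lebesgue)"
      by (rule nn_integral_dirichlet[OF test_fun_step[OF t] p, symmetric])
    also have "\<dots> \<le> (\<integral>\<^sup>+x. ennreal ((36 / \<tau> j) powr p) * (ennreal (norm (grad \<phi> x) powr p) * indicator (A j) x) \<partial>lebesgue)"
    proof (rule nn_integral_mono)
      fix x
      show "ennreal (norm (grad (\<lambda>x. step ((1 / \<tau> j) * \<phi> x)) x) powr p)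
        \<le> ennreal ((36 / \<tau> j) powr p) * (ennreal (norm (grad \<phi> x) powr p) * indicator (A j) x)"
      proof (cases "x \<in> A j")
        case True
        have "norm (grad (\<lambda>x. step ((1 / \<tau> j) * \<phi> x)) x) \<le> (36 / \<tau> j) * norm (grad \<phi> x)"
          unfolding g norm_scaleR using \<tau>[of j] step'_range[of "(1 / \<tau> j) * \<phi> x"]
          by (intro mult_right_mono) (auto simp: divide_right_mono)
        then have "norm (grad (\<lambda>x. step ((1 / \<tau> j) * \<phi> x)) x) powr p \<le> ((36 / \<tau> j) * norm (grad \<phi> x)) powr p"
          using p by (intro powr_mono2) auto
        also have "\<dots> = (36 / \<tau> j) powr p * norm (grad \<phi> x) powr p" by (rule powr_mult)
        finally show ?thesis using True by (simp add: ennreal_leI flip: ennreal_mult)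
      next
        case False
        then have "(1 / \<tau> j) * \<phi> x \<le> 1 \<or> 2 \<le> (1 / \<tau> j) * \<phi> x" using \<tau>[of j] by (auto simp: A_def field_simps)
        then have "step' ((1 / \<tau> j) * \<phi> x) = 0" by (rule step'_eq_0)
        then show ?thesis unfolding g by simp
      qed
    qed
    finally show ?thesis .
  qed
  define c where "c j = (4 * \<tau> j) powr p" for j
  have each: "ennreal (c j) * (\<integral>\<^sup>+x\<in>F j. ennreal \<bar>g x\<bar> \<partial>lebesgue)
    \<le> W' * (\<integral>\<^sup>+x. ennreal (144 powr p) * (ennreal (norm (grad \<phi> x) powr p) * indicator (A j) x) \<partial>lebesgue)" for j
  proof -
    have "ennreal (c j) * (\<integral>\<^sup>+x\<in>F j. ennreal \<bar>g x\<bar> \<partial>lebesgue)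
      \<le> ennreal (c j) * (W' * ennreal (dirichlet p (\<lambda>x. step ((1 / \<tau> j) * \<phi> x)) powr (p / p)))"
      unfolding W'_def
      by (intro mult_left_mono weight_mass_le_capacity W F test_fun_step t)
        (use p \<tau>[of j] in \<open>auto simp: F_def step_eq_1 field_simps\<close>)
    also have "\<dots> = ennreal (c j) * (W' * ennreal (dirichlet p (\<lambda>x. step ((1 / \<tau> j) * \<phi> x))))"
      using p by (simp add: dirichlet_nonneg)
    also have "\<dots> \<le> ennreal (c j) * (W' * (\<integral>\<^sup>+x. ennreal ((36 / \<tau> j) powr p) * (ennreal (norm (grad \<phi> x) powr p) * indicator (A j) x) \<partial>lebesgue))"
      by (intro mult_left_mono D) auto
    also have "\<dots> = W' * (ennreal (c j) * ennreal ((36 / \<tau> j) powr p) * (\<integral>\<^sup>+x. ennreal (norm (grad \<phi> x) powr p) * indicator (A j) x \<partial>lebesgue))"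
      by (subst nn_integral_cmult) (auto simp: mult_ac)
    also have "ennreal (c j) * ennreal ((36 / \<tau> j) powr p) = ennreal (144 powr p)"
      using \<tau>[of j] by (simp add: c_def flip: ennreal_mult powr_mult)
    also have "ennreal (144 powr p) * (\<integral>\<^sup>+x. ennreal (norm (grad \<phi> x) powr p) * indicator (A j) x \<partial>lebesgue)
      = (\<integral>\<^sup>+x. ennreal (144 powr p) * (ennreal (norm (grad \<phi> x) powr p) * indicator (A j) x) \<partial>lebesgue)"
      by (subst nn_integral_cmult) auto
    finally show ?thesis .
  qed
  have "(\<integral>\<^sup>+x. ennreal \<bar>g x\<bar> * (ennreal (\<bar>\<phi> x\<bar> powr p) * indicator {2 * a..} (\<phi> x)) \<partial>lebesgue)
    \<le> (\<Sum>j. ennreal ((2 ^ Suc j * (2 * a)) powr p) * (\<integral>\<^sup>+x\<in>{x. 2 ^ j * (2 * a) \<le> \<phi> x}. ennreal \<bar>g x\<bar> \<partial>lebesgue))"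
    using p a by (intro dyadic_layers) auto
  also have "\<dots> = (\<Sum>j. ennreal (c j) * (\<integral>\<^sup>+x\<in>F j. ennreal \<bar>g x\<bar> \<partial>lebesgue))"
    by (simp add: c_def F_def \<tau>_def mult_ac)
  also have "\<dots> \<le> (\<Sum>j. W' * (\<integral>\<^sup>+x. ennreal (144 powr p) * (ennreal (norm (grad \<phi> x) powr p) * indicator (A j) x) \<partial>lebesgue))"
    by (intro suminf_le each) auto
  also have "\<dots> = W' * (\<Sum>j. \<integral>\<^sup>+x. ennreal (144 powr p) * (ennreal (norm (grad \<phi> x) powr p) * indicator (A j) x) \<partial>lebesgue)"
    by (rule ennreal_suminf_cmult)
  also have "(\<Sum>j. \<integral>\<^sup>+x. ennreal (144 powr p) * (ennreal (norm (grad \<phi> x) powr p) * indicator (A j) x) \<partial>lebesgue)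
     = (\<integral>\<^sup>+x. (\<Sum>j. ennreal (144 powr p) * (ennreal (norm (grad \<phi> x) powr p) * indicator (A j) x)) \<partial>lebesgue)"
    by (rule nn_integral_suminf[symmetric]) measurable
  also have "\<dots> \<le> (\<integral>\<^sup>+x. ennreal (144 powr p) * ennreal (norm (grad \<phi> x) powr p) \<partial>lebesgue)"
  proof (rule nn_integral_mono)
    fix x
    have "(\<Sum>j. ennreal (144 powr p) * (ennreal (norm (grad \<phi> x) powr p) * indicator (A j) x))
      = ennreal (144 powr p) * (ennreal (norm (grad \<phi> x) powr p) * (\<Sum>j. indicator (A j) x))"
      by (simp add: ennreal_suminf_cmult)
    also have "(\<Sum>j. indicator (A j) x :: ennreal) = indicator (\<Union>j. A j) x"
      by (rule suminf_indicator[OF disj])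
    also have "ennreal (144 powr p) * (ennreal (norm (grad \<phi> x) powr p) * indicator (\<Union>j. A j) x)
       \<le> ennreal (144 powr p) * ennreal (norm (grad \<phi> x) powr p)"
      by (auto split: split_indicator)
    finally show "(\<Sum>j. ennreal (144 powr p) * (ennreal (norm (grad \<phi> x) powr p) * indicator (A j) x))
       \<le> ennreal (144 powr p) * ennreal (norm (grad \<phi> x) powr p)" .
  qed
  also have "\<dots> = ennreal (144 powr p) * ennreal (dirichlet p \<phi>)"
    using nn_integral_dirichlet[OF t p] by (simp add: nn_integral_cmult)
  also have "\<dots> = ennreal (144 powr p * dirichlet p \<phi>)" by (simp add: ennreal_mult dirichlet_nonneg)
  finally show ?thesis by (simp add: W'_def mult_left_mono)
qed

text \<open>Both signs together, and the lowest level tends to zero.\<close>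
lemma strong_type_test_fun:
  fixes g :: "'a::euclidean_space \<Rightarrow> real" and p :: real
  assumes p: "0 < p" and W: "weight_norm p p g < \<infinity>" and gm [measurable]: "g \<in> borel_measurable lebesgue"
    and t: "test_fun \<phi>"
  shows "(\<integral>\<^sup>+x. ennreal \<bar>g x\<bar> * ennreal (\<bar>\<phi> x\<bar> powr p) \<partial>lebesgue)
    \<le> weight_norm p p g * ennreal (2 * 144 powr p * dirichlet p \<phi>)"
proof -
  have [measurable]: "\<phi> \<in> borel_measurable lebesgue" using test_fun_measurable[OF t] by auto
  define a where "a n = inverse (real (Suc n))" for n
  have a: "a n > 0" for n by (simp add: a_def)
  define h where "h n x = ennreal \<bar>g x\<bar> * (ennreal (\<bar>\<phi> x\<bar> powr p) * indicator {2 * a n..} (\<phi> x))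
      + ennreal \<bar>g x\<bar> * (ennreal (\<bar>- \<phi> x\<bar> powr p) * indicator {2 * a n..} (- \<phi> x))" for n x
  have [measurable]: "h n \<in> borel_measurable lebesgue" for n unfolding h_def[abs_def] by measurable
  show ?thesis
  proof (rule nn_integral_fatou_tendsto)
    show "AE x in lebesgue. (\<lambda>n. h n x) \<longlonglongrightarrow> ennreal \<bar>g x\<bar> * ennreal (\<bar>\<phi> x\<bar> powr p)"
    proof (rule AE_I2)
      fix x
      have "\<forall>\<^sub>F n in sequentially. h n x = ennreal \<bar>g x\<bar> * ennreal (\<bar>\<phi> x\<bar> powr p)"
      proof (cases "\<phi> x = 0")
        case True
        then show ?thesis using p by (simp add: h_def)
      next
        case False
        have "\<forall>\<^sub>F n in sequentially. a n < \<bar>\<phi> x\<bar> / 2"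
          unfolding a_def using False by (intro order_tendstoD(2)[OF LIMSEQ_inverse_real_of_nat]) auto
        then show ?thesis
        proof eventually_elim
          case (elim n)
          then have "2 * a n \<le> \<bar>\<phi> x\<bar>" by simp
          then show ?case using a[of n] False unfolding h_def
            by (cases "\<phi> x > 0") (auto split: split_indicator)
        qed
      qed
      then show "(\<lambda>n. h n x) \<longlonglongrightarrow> ennreal \<bar>g x\<bar> * ennreal (\<bar>\<phi> x\<bar> powr p)" by (rule tendsto_eventually)
    qed
    have "(\<integral>\<^sup>+x. h n x \<partial>lebesgue) \<le> weight_norm p p g * ennreal (2 * 144 powr p * dirichlet p \<phi>)" for n
    proof -
      have "(\<integral>\<^sup>+x. h n x \<partial>lebesgue) = (\<integral>\<^sup>+x. ennreal \<bar>g x\<bar> * (ennreal (\<bar>\<phi> x\<bar> powr p) * indicator {2 * a n..} (\<phi> x)) \<partial>lebesgue)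
        + (\<integral>\<^sup>+x. ennreal \<bar>g x\<bar> * (ennreal (\<bar>- \<phi> x\<bar> powr p) * indicator {2 * a n..} (- \<phi> x)) \<partial>lebesgue)"
        unfolding h_def by (rule nn_integral_add) measurable
      also have "\<dots> \<le> weight_norm p p g * ennreal (144 powr p * dirichlet p \<phi>) + weight_norm p p g * ennreal (144 powr p * dirichlet p \<phi>)"
        using strong_type_one_sided[OF p W gm t a] strong_type_one_sided[OF p W gm test_fun_minus[OF t] a]
        by (intro add_mono) (simp_all add: dirichlet_minus[OF t])
      also have "\<dots> = weight_norm p p g * (ennreal (144 powr p * dirichlet p \<phi>) + ennreal (144 powr p * dirichlet p \<phi>))"
        by (simp add: distrib_left)
      also have "ennreal (144 powr p * dirichlet p \<phi>) + ennreal (144 powr p * dirichlet p \<phi>)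
        = ennreal (144 powr p * dirichlet p \<phi> + 144 powr p * dirichlet p \<phi>)"
        by (rule ennreal_plus[symmetric]) (auto simp: dirichlet_nonneg)
      finally show ?thesis by (simp add: mult_ac)
    qed
    then show "\<forall>\<^sub>F n in sequentially. (\<integral>\<^sup>+x. h n x \<partial>lebesgue) \<le> weight_norm p p g * ennreal (2 * 144 powr p * dirichlet p \<phi>)"
      by (intro always_eventually allI)
  qed measurable
qed

text \<open>Fatou's lemma along test functions that converge almost everywhere and in energy. The condition on
\<open>\<Phi>\<close> is a form of lower semicontinuity that admits powers as well as indicators of open sets.\<close>
lemma beppo_levi_transfer:
  fixes u g :: "'a::euclidean_space \<Rightarrow> real" and \<Phi> :: "real \<Rightarrow> ennreal" and K :: "real \<Rightarrow> real"
  assumes p: "1 < p" and u: "u \<in> beppo_levi p" and [measurable]: "g \<in> borel_measurable lebesgue" "\<Phi> \<in> borel_measurable borel"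
    and lsc: "\<And>X s. X \<longlonglongrightarrow> s \<Longrightarrow> \<Phi> s = 0 \<or> (\<lambda>n. \<Phi> (X n)) \<longlonglongrightarrow> \<Phi> s"
    and K: "continuous_on {0..} K" and W: "W < \<infinity>"
    and bound: "\<And>\<phi>. test_fun \<phi> \<Longrightarrow> (\<integral>\<^sup>+x. ennreal \<bar>g x\<bar> * \<Phi> (\<phi> x) \<partial>lebesgue) \<le> W * ennreal (K (dirichlet p \<phi>))"
  shows "(\<integral>\<^sup>+x. ennreal \<bar>g x\<bar> * \<Phi> (u x) \<partial>lebesgue) \<le> W * ennreal (K (energy p u))"
proof -
  obtain \<phi> where \<phi>: "\<And>k. test_fun (\<phi> k)" "L1loc_tendsto \<phi> u" "(\<lambda>k. dirichlet p (\<phi> k)) \<longlonglongrightarrow> energy p u"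
    using beppo_levi_approx[OF p u] by blast
  have L: "L1loc (\<phi> k)" "L1loc u" for k
    using \<phi>(1) u by (auto intro: continuous_L1loc test_fun_continuous simp: beppo_levi_def)
  obtain s where s: "strict_mono s" "AE x in lebesgue. (\<lambda>n. \<phi> (s n) x) \<longlonglongrightarrow> u x"
    by (rule L1loc_tendsto_AE_subseq[OF L \<phi>(2)])
  have [measurable]: "\<phi> k \<in> borel_measurable lebesgue" for k using L(1) by (rule L1loc_measurable)
  have E: "energy p u \<in> {0..}" by (simp add: energy_def)
  show ?thesis
  proof (rule nn_integral_fatou_bound[OF _ _ always_eventually[OF allI]])
    show "(\<integral>\<^sup>+x. ennreal \<bar>g x\<bar> * \<Phi> (\<phi> (s n) x) \<partial>lebesgue) \<le> W * ennreal (K (dirichlet p (\<phi> (s n))))" for n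
      by (rule bound[OF \<phi>(1)])
    have "(\<lambda>n. dirichlet p (\<phi> (s n))) \<longlonglongrightarrow> energy p u"
      using LIMSEQ_subseq_LIMSEQ[OF \<phi>(3) s(1)] by (simp add: o_def)
    then have "(\<lambda>n. K (dirichlet p (\<phi> (s n)))) \<longlonglongrightarrow> K (energy p u)"
      by (rule continuous_on_tendsto_compose[OF K _ E]) (simp add: dirichlet_nonneg)
    then show "(\<lambda>n. W * ennreal (K (dirichlet p (\<phi> (s n))))) \<longlonglongrightarrow> W * ennreal (K (energy p u))"
      using W by (intro ennreal_tendsto_cmult tendsto_ennrealI) auto
    show "AE x in lebesgue. ennreal \<bar>g x\<bar> * \<Phi> (u x) \<le> liminf (\<lambda>n. ennreal \<bar>g x\<bar> * \<Phi> (\<phi> (s n) x))"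
      using s(2)
    proof eventually_elim
      case (elim x)
      from lsc[OF elim] show ?case
      proof
        assume "(\<lambda>n. \<Phi> (\<phi> (s n) x)) \<longlonglongrightarrow> \<Phi> (u x)"
        then have "(\<lambda>n. ennreal \<bar>g x\<bar> * \<Phi> (\<phi> (s n) x)) \<longlonglongrightarrow> ennreal \<bar>g x\<bar> * \<Phi> (u x)"
          by (intro ennreal_tendsto_cmult) auto
        then show ?thesis by (simp add: lim_imp_Liminf)
      qed simp
    qed
  qed measurable
qed

lemma capacitary_strong_type:
  fixes u g :: "'a::euclidean_space \<Rightarrow> real" and p :: real
  assumes p: "1 < p" and u: "u \<in> beppo_levi p" and W: "weight_norm p p g < \<infinity>" and gm: "g \<in> borel_measurable lebesgue"
  shows "(\<integral>\<^sup>+x. ennreal \<bar>g x\<bar> * ennreal (\<bar>u x\<bar> powr p) \<partial>lebesgue) \<le> weight_norm p p g * ennreal (2 * 144 powr p * energy p u)"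
proof (rule beppo_levi_transfer[OF p u gm, where \<Phi> = "\<lambda>s. ennreal (\<bar>s\<bar> powr p)" and K = "\<lambda>d. 2 * 144 powr p * d"])
  show "ennreal (\<bar>s\<bar> powr p) = 0 \<or> (\<lambda>n. ennreal (\<bar>X n\<bar> powr p)) \<longlonglongrightarrow> ennreal (\<bar>s\<bar> powr p)" if "X \<longlonglongrightarrow> s" for X s
    using p that by (intro disjI2 tendsto_ennrealI tendsto_powr2 tendsto_rabs tendsto_const) auto
  show "(\<integral>\<^sup>+x. ennreal \<bar>g x\<bar> * ennreal (\<bar>\<phi> x\<bar> powr p) \<partial>lebesgue) \<le> weight_norm p p g * ennreal (2 * 144 powr p * dirichlet p \<phi>)"
    if "test_fun \<phi>" for \<phi>
    using p by (intro strong_type_test_fun W gm that) auto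
qed (use W in \<open>auto intro!: continuous_intros\<close>)

lemma tail_bound:
  fixes u g :: "'a::euclidean_space \<Rightarrow> real" and p q r :: real
  assumes p: "1 < p" and q: "0 < q" "q < r" and u: "u \<in> beppo_levi p" and W: "weight_norm p r g < \<infinity>"
    and gm: "g \<in> borel_measurable lebesgue" and T: "T > 0"
  shows "(\<integral>\<^sup>+x. ennreal \<bar>g x\<bar> * (ennreal (\<bar>u x\<bar> powr q) * indicator {T<..} \<bar>u x\<bar>) \<partial>lebesgue)
     \<le> weight_norm p r g * ennreal (2 * 2 powr q / (1 - 2 powr (q - r)) * T powr (q - r) * energy p u powr (r / p))"
proof (rule beppo_levi_transfer[OF p u gm, where \<Phi> = "\<lambda>s. ennreal (\<bar>s\<bar> powr q) * indicator {T<..} \<bar>s\<bar>"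
      and K = "\<lambda>d. 2 * 2 powr q / (1 - 2 powr (q - r)) * T powr (q - r) * d powr (r / p)"])
  show "ennreal (\<bar>s\<bar> powr q) * indicator {T<..} \<bar>s\<bar> = 0
      \<or> (\<lambda>n. ennreal (\<bar>X n\<bar> powr q) * indicator {T<..} \<bar>X n\<bar>) \<longlonglongrightarrow> ennreal (\<bar>s\<bar> powr q) * indicator {T<..} \<bar>s\<bar>"
    if X: "X \<longlonglongrightarrow> s" for X s
  proof (cases "T < \<bar>s\<bar>")
    case True
    have "\<forall>\<^sub>F n in sequentially. T < \<bar>X n\<bar>" by (rule order_tendstoD(1)[OF tendsto_rabs[OF X] True])
    then have ev: "\<forall>\<^sub>F n in sequentially. ennreal (\<bar>X n\<bar> powr q) = ennreal (\<bar>X n\<bar> powr q) * indicator {T<..} \<bar>X n\<bar>"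
      by eventually_elim simp
    have "(\<lambda>n. ennreal (\<bar>X n\<bar> powr q)) \<longlonglongrightarrow> ennreal (\<bar>s\<bar> powr q)"
      using q X by (intro tendsto_ennrealI tendsto_powr2 tendsto_rabs tendsto_const) auto
    from Lim_transform_eventually[OF this ev] show ?thesis using True by simp
  qed simp
  show "continuous_on {0..} (\<lambda>d. 2 * 2 powr q / (1 - 2 powr (q - r)) * T powr (q - r) * d powr (r / p))"
    using p q by (intro continuous_on_mult continuous_on_const continuous_on_powr' continuous_on_id) auto
  show "(\<integral>\<^sup>+x. ennreal \<bar>g x\<bar> * (ennreal (\<bar>\<phi> x\<bar> powr q) * indicator {T<..} \<bar>\<phi> x\<bar>) \<partial>lebesgue)
     \<le> weight_norm p r g * ennreal (2 * 2 powr q / (1 - 2 powr (q - r)) * T powr (q - r) * dirichlet p \<phi> powr (r / p))"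
    if "test_fun \<phi>" for \<phi>
    using p q by (intro tail_test_fun W gm that T) auto
qed (use W in \<open>auto\<close>)

section \<open>The logarithmic integral\<close>

text \<open>\<open>tail_part\<close> and \<open>head_part\<close> are the positive and the negative part of \<open>|s|^p ln (|s|/T)^p\<close>. The first
lives on \<open>|s| > T\<close> and is small for large \<open>T\<close>, the second on \<open>|s| < T\<close>, and Fatou's lemma is applied
to it.\<close>
definition tail_part :: "real \<Rightarrow> real \<Rightarrow> real \<Rightarrow> real" where
  "tail_part p T s = \<bar>s\<bar> powr p * max 0 (p * ln (\<bar>s\<bar> / T))"

definition head_part :: "real \<Rightarrow> real \<Rightarrow> real \<Rightarrow> real" where
  "head_part p T s = \<bar>s\<bar> powr p * max 0 (p * ln (T / \<bar>s\<bar>))"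

lemma log_split:
  assumes "T > 0"
  shows "\<bar>s\<bar> powr p * ln (\<bar>s\<bar> powr p) = p * ln T * \<bar>s\<bar> powr p + tail_part p T s - head_part p T s"
proof (cases "s = 0")
  case True
  then show ?thesis by (simp add: tail_part_def head_part_def)
next
  case False
  define a where "a = p * ln (\<bar>s\<bar> / T)"
  have n: "p * ln (T / \<bar>s\<bar>) = - a" using False assms by (simp add: a_def ln_div algebra_simps)
  have "max 0 a - max 0 (- a) = a" by simp
  then have "tail_part p T s - head_part p T s = \<bar>s\<bar> powr p * a"
    unfolding tail_part_def head_part_def n a_def[symmetric] by (simp add: right_diff_distrib[symmetric])
  moreover have "ln (\<bar>s\<bar> powr p) = p * ln T + a" using False assms by (simp add: a_def ln_powr ln_div algebra_simps)
  ultimately show ?thesis by (simp add: algebra_simps)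
qed

lemma parts_nonneg: "0 \<le> tail_part p T s" "0 \<le> head_part p T s"
  by (simp_all add: tail_part_def head_part_def)

lemma parts_measurable [measurable]:
  "tail_part p T \<in> borel_measurable borel" "head_part p T \<in> borel_measurable borel"
  unfolding tail_part_def[abs_def] head_part_def[abs_def] by measurable

text \<open>A logarithm costs less than any positive power, so an exponent \<open>q\<close> between \<open>p\<close> and \<open>r\<close> absorbs it.\<close>
lemma tail_part_le:
  assumes "0 < p" "p < q" "T > 0"
  shows "tail_part p T s \<le> p / (q - p) * T powr (p - q) * (\<bar>s\<bar> powr q * indicator {T<..} \<bar>s\<bar>)"
proof (cases "T < \<bar>s\<bar>")
  case False
  then have "ln (\<bar>s\<bar> / T) \<le> 0 \<or> s = 0" using assms by (cases "s = 0") auto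
  then have "tail_part p T s = 0" using assms(1) by (auto simp: tail_part_def mult_nonneg_nonpos)
  then show ?thesis using False by simp
next
  case True
  define y where "y = \<bar>s\<bar> / T"
  have y: "y > 1" using True assms by (simp add: y_def)
  have "(q - p) * ln y = ln (y powr (q - p))" using y by (simp add: ln_powr)
  also have "\<dots> \<le> y powr (q - p)" using y by (intro ln_bound) auto
  finally have "ln y \<le> y powr (q - p) / (q - p)" using assms by (simp add: field_simps)
  then have "p * ln y \<le> p * (y powr (q - p) / (q - p))" using assms by (intro mult_left_mono) auto
  moreover have "0 \<le> p * ln y" using y assms by simp
  ultimately have "tail_part p T s \<le> \<bar>s\<bar> powr p * (p * (y powr (q - p) / (q - p)))"
    unfolding tail_part_def y_def[symmetric] by (intro mult_left_mono) auto
  also have "\<bar>s\<bar> powr p * (p * (y powr (q - p) / (q - p))) = p / (q - p) * (\<bar>s\<bar> powr p * y powr (q - p))" by simp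
  also have "\<bar>s\<bar> powr p * y powr (q - p) = T powr (p - q) * \<bar>s\<bar> powr q"
  proof -
    have "y powr (q - p) = \<bar>s\<bar> powr (q - p) * T powr (p - q)"
      using powr_minus_divide[of T "q - p"] by (simp add: y_def powr_divide)
    moreover have "\<bar>s\<bar> powr p * \<bar>s\<bar> powr (q - p) = \<bar>s\<bar> powr q" by (simp flip: powr_add)
    ultimately show ?thesis by (simp add: mult_ac)
  qed
  finally show ?thesis using True by simp
qed

text \<open>The alternative \<open>0\<close> covers the point \<open>s = 0\<close>, where the definition through \<open>ln (T/0)\<close> says nothing about
nearby values.\<close>
lemma head_part_lsc:
  assumes "X \<longlonglongrightarrow> s" "T > 0" "0 < p"
  shows "head_part p T s = 0 \<or> (\<lambda>n. head_part p T (X n)) \<longlonglongrightarrow> head_part p T s"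
proof (cases "s = 0")
  case False
  then show ?thesis unfolding head_part_def using assms
    by (intro disjI2 tendsto_mult tendsto_powr2 tendsto_max tendsto_ln tendsto_divide tendsto_rabs tendsto_const) auto
qed (simp add: head_part_def)

lemma inverse_inverse_ennreal: "1 / (1 / x) = (x :: ennreal)"
proof (cases x)
  case (real a)
  then show ?thesis by (cases "a = 0") (simp_all add: divide_ennreal_def inverse_ennreal)
qed (simp add: divide_ennreal_def)

locale log_sobolev_weight =
  fixes g :: "'a::euclidean_space \<Rightarrow> real" and p r \<gamma> :: real
  assumes p: "1 < p" "p < DIM('a)" "p < r" and g: "g \<in> H_space p r \<inter> F_space p p"
    and g0: "\<not> (AE x in lebesgue. g x = 0)" and gam: "\<gamma> > r / (r - p)"
begin

lemma weight_measurable [measurable]: "g \<in> borel_measurable lebesgue"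
  using g by (auto simp: H_space_def L1loc_def)

lemma weight_norms_finite: "weight_norm p r g < \<infinity>" "weight_norm p p g < \<infinity>"
  using g by (auto simp: H_space_def F_space_def)

lemma gamma_pos: "\<gamma> > 0"
proof -
  have "r / (r - p) > 0" using p by simp
  then show ?thesis using gam by linarith
qed

definition "admissible = {u \<in> beppo_levi p. (LINT x|lebesgue. \<bar>g x\<bar> * \<bar>u x\<bar> powr p) = 1}"

lemma beppo_levi_measurable: "u \<in> beppo_levi p \<Longrightarrow> (u :: 'a \<Rightarrow> real) \<in> borel_measurable lebesgue"
  by (simp add: beppo_levi_def L1loc_def)

lemma admissible_integrable:
  assumes "u \<in> admissible"
  shows "integrable lebesgue (\<lambda>x. \<bar>g x\<bar> * \<bar>u x\<bar> powr p)"
    "(\<integral>\<^sup>+x. ennreal \<bar>g x\<bar> * ennreal (\<bar>u x\<bar> powr p) \<partial>lebesgue) = 1"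
proof -
  show i: "integrable lebesgue (\<lambda>x. \<bar>g x\<bar> * \<bar>u x\<bar> powr p)"
    using assms not_integrable_integral_eq unfolding admissible_def by fastforce
  show "(\<integral>\<^sup>+x. ennreal \<bar>g x\<bar> * ennreal (\<bar>u x\<bar> powr p) \<partial>lebesgue) = 1"
    using nn_integral_eq_integral[OF i] assms by (simp add: admissible_def ennreal_mult)
qed

lemma admissibleI:
  assumes u: "u \<in> beppo_levi p" and 1: "(\<integral>\<^sup>+x. ennreal \<bar>g x\<bar> * ennreal (\<bar>u x\<bar> powr p) \<partial>lebesgue) = 1"
  shows "u \<in> admissible"
proof -
  have [measurable]: "u \<in> borel_measurable lebesgue" using u by (rule beppo_levi_measurable)
  have "(LINT x|lebesgue. \<bar>g x\<bar> * \<bar>u x\<bar> powr p) = enn2real (\<integral>\<^sup>+x. ennreal (\<bar>g x\<bar> * \<bar>u x\<bar> powr p) \<partial>lebesgue)"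
    by (rule integral_eq_nn_integral) auto
  then show ?thesis using u 1 by (simp add: admissible_def ennreal_mult)
qed

lemma energy_lower_bound: "\<exists>c>0. \<forall>u\<in>admissible. c \<le> energy p u"
proof -
  obtain s where s: "weight_norm p p g = ennreal s" "s \<ge> 0" using weight_norms_finite(2) by (cases "weight_norm p p g") auto
  define K where "K = s * (2 * 144 powr p)"
  have K: "K \<ge> 0" using s by (simp add: K_def)
  have "1 / (K + 1) \<le> energy p u" if "u \<in> admissible" for u
  proof -
    have u: "u \<in> beppo_levi p" using that by (simp add: admissible_def)
    have E: "energy p u \<ge> 0" by (simp add: energy_def)
    have "1 \<le> ennreal s * ennreal (2 * 144 powr p * energy p u)"
      using capacitary_strong_type[OF p(1) u weight_norms_finite(2) weight_measurable] unfolding s(1) admissible_integrable(2)[OF that] .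
    also have "\<dots> = ennreal (K * energy p u)" using s E by (simp add: K_def mult.assoc flip: ennreal_mult)
    finally have "1 \<le> K * energy p u" using K E by simp
    then have "1 \<le> (K + 1) * energy p u" using E by (simp add: distrib_right)
    then show ?thesis using K by (simp add: field_simps)
  qed
  then show ?thesis using K by (intro exI[of _ "1 / (K + 1)"]) auto
qed

text \<open>The decay \<open>T^(p-r)\<close> does not depend on the intermediate exponent \<open>q\<close> that is used to absorb the
logarithm.\<close>
lemma tail_part_bound:
  "\<exists>C\<ge>0. \<forall>u\<in>beppo_levi p. \<forall>T>0.
    (\<integral>\<^sup>+x. ennreal \<bar>g x\<bar> * ennreal (tail_part p T (u x)) \<partial>lebesgue) \<le> ennreal (C * T powr (p - r) * energy p u powr (r / p))"
proof -
  obtain A where A: "weight_norm p r g = ennreal A" "A \<ge> 0" using weight_norms_finite(1) by (cases "weight_norm p r g") auto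
  define q where "q = (p + r) / 2"
  have q: "p < q" "q < r" "0 < q" using p by (auto simp: q_def)
  define B where "B = 2 * 2 powr q / (1 - 2 powr (q - r))"
  have "2 powr (q - r) < (1::real)" using powr_less_mono[of "q - r" 0 2] q by simp
  then have B: "B \<ge> 0" by (simp add: B_def)
  define C where "C = p / (q - p) * A * B"
  have C: "C \<ge> 0" using p q A B by (simp add: C_def)
  have "(\<integral>\<^sup>+x. ennreal \<bar>g x\<bar> * ennreal (tail_part p T (u x)) \<partial>lebesgue) \<le> ennreal (C * T powr (p - r) * energy p u powr (r / p))"
    if u: "u \<in> beppo_levi p" and T: "T > 0" for u T
  proof -
    have [measurable]: "u \<in> borel_measurable lebesgue" using u by (rule beppo_levi_measurable)
    define k where "k = p / (q - p) * T powr (p - q)"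
    have k: "k \<ge> 0" using p q by (simp add: k_def)
    have "(\<integral>\<^sup>+x. ennreal \<bar>g x\<bar> * ennreal (tail_part p T (u x)) \<partial>lebesgue)
      \<le> (\<integral>\<^sup>+x. ennreal k * (ennreal \<bar>g x\<bar> * (ennreal (\<bar>u x\<bar> powr q) * indicator {T<..} \<bar>u x\<bar>)) \<partial>lebesgue)"
    proof (rule nn_integral_mono)
      fix x
      have "ennreal (tail_part p T (u x)) \<le> ennreal (k * (\<bar>u x\<bar> powr q * indicator {T<..} \<bar>u x\<bar>))"
        unfolding k_def using p q T by (intro ennreal_leI tail_part_le) auto
      also have "\<dots> = ennreal k * (ennreal (\<bar>u x\<bar> powr q) * indicator {T<..} \<bar>u x\<bar>)"
        using k by (auto simp: ennreal_mult split: split_indicator)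
      finally have "ennreal \<bar>g x\<bar> * ennreal (tail_part p T (u x))
        \<le> ennreal \<bar>g x\<bar> * (ennreal k * (ennreal (\<bar>u x\<bar> powr q) * indicator {T<..} \<bar>u x\<bar>))"
        by (intro mult_left_mono) auto
      then show "ennreal \<bar>g x\<bar> * ennreal (tail_part p T (u x))
        \<le> ennreal k * (ennreal \<bar>g x\<bar> * (ennreal (\<bar>u x\<bar> powr q) * indicator {T<..} \<bar>u x\<bar>))"
        by (simp add: mult_ac)
    qed
    also have "\<dots> = ennreal k * (\<integral>\<^sup>+x. ennreal \<bar>g x\<bar> * (ennreal (\<bar>u x\<bar> powr q) * indicator {T<..} \<bar>u x\<bar>) \<partial>lebesgue)"
      by (rule nn_integral_cmult) measurable
    also have "\<dots> \<le> ennreal k * (ennreal A * ennreal (B * T powr (q - r) * energy p u powr (r / p)))"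
      unfolding B_def A(1)[symmetric] by (intro mult_left_mono tail_bound p q u weight_norms_finite weight_measurable T) auto
    also have "\<dots> = ennreal (k * (A * (B * T powr (q - r) * energy p u powr (r / p))))"
      using k A B by (simp flip: ennreal_mult)
    also have "k * (A * (B * T powr (q - r) * energy p u powr (r / p))) = C * T powr (p - r) * energy p u powr (r / p)"
    proof -
      have "T powr (p - q) * T powr (q - r) = T powr (p - r)" by (simp flip: powr_add)
      moreover have "k * (A * (B * T powr (q - r) * energy p u powr (r / p)))
          = C * (T powr (p - q) * T powr (q - r)) * energy p u powr (r / p)"
        by (simp add: k_def C_def mult_ac)
      ultimately show ?thesis by simp
    qed
    finally show ?thesis .
  qed
  then show ?thesis using C by blast
qed

definition "log_density u x = \<bar>g x\<bar> * (\<bar>u x\<bar> powr p * ln (\<bar>u x\<bar> powr p))"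

lemma admissible_measurable: "u \<in> admissible \<Longrightarrow> u \<in> borel_measurable lebesgue"
  by (simp add: admissible_def beppo_levi_measurable)

lemma tail_part_integrable:
  assumes u: "u \<in> beppo_levi p" and T: "T > 0"
  shows "integrable lebesgue (\<lambda>x. \<bar>g x\<bar> * tail_part p T (u x))"
proof -
  have [measurable]: "u \<in> borel_measurable lebesgue" using u by (rule beppo_levi_measurable)
  obtain C where "(\<integral>\<^sup>+x. ennreal \<bar>g x\<bar> * ennreal (tail_part p T (u x)) \<partial>lebesgue) \<le> ennreal (C * T powr (p - r) * energy p u powr (r / p))"
    using tail_part_bound u T by blast
  then show ?thesis
    by (intro integrableI_nonneg) (auto simp: parts_nonneg ennreal_mult intro: le_less_trans)
qed

lemma log_density_split:
  assumes "T > 0"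
  shows "log_density u x = p * ln T * (\<bar>g x\<bar> * \<bar>u x\<bar> powr p) + \<bar>g x\<bar> * tail_part p T (u x) - \<bar>g x\<bar> * head_part p T (u x)"
  unfolding log_density_def log_split[OF assms] by (simp add: algebra_simps)

lemma head_part_integrable_iff:
  assumes u: "u \<in> admissible" and T: "T > 0"
  shows "integrable lebesgue (\<lambda>x. \<bar>g x\<bar> * head_part p T (u x)) \<longleftrightarrow> integrable lebesgue (log_density u)"
    "integrable lebesgue (log_density u) \<Longrightarrow> (LINT x|lebesgue. log_density u x)
      = p * ln T + (LINT x|lebesgue. \<bar>g x\<bar> * tail_part p T (u x)) - (LINT x|lebesgue. \<bar>g x\<bar> * head_part p T (u x))"
proof -
  have ub: "u \<in> beppo_levi p" "(LINT x|lebesgue. \<bar>g x\<bar> * \<bar>u x\<bar> powr p) = 1" using u by (auto simp: admissible_def)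
  note i1 = admissible_integrable(1)[OF u]
  note i2 = tail_part_integrable[OF ub(1) T]
  have eq: "\<bar>g x\<bar> * head_part p T (u x) = p * ln T * (\<bar>g x\<bar> * \<bar>u x\<bar> powr p) + \<bar>g x\<bar> * tail_part p T (u x) - log_density u x" for x
    using log_density_split[OF T, of u x] by simp
  have 1: "integrable lebesgue (log_density u)" if "integrable lebesgue (\<lambda>x. \<bar>g x\<bar> * head_part p T (u x))"
    unfolding log_density_split[OF T, abs_def]
    by (intro Bochner_Integration.integrable_diff Bochner_Integration.integrable_add integrable_mult_right i1 i2 that)
  have 2: "integrable lebesgue (\<lambda>x. \<bar>g x\<bar> * head_part p T (u x))" if "integrable lebesgue (log_density u)"
    unfolding eq
    by (intro Bochner_Integration.integrable_diff Bochner_Integration.integrable_add integrable_mult_right i1 i2 that)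
  show "integrable lebesgue (\<lambda>x. \<bar>g x\<bar> * head_part p T (u x)) \<longleftrightarrow> integrable lebesgue (log_density u)"
    using 1 2 by blast
  assume "integrable lebesgue (log_density u)"
  note i3 = 2[OF this]
  show "(LINT x|lebesgue. log_density u x)
      = p * ln T + (LINT x|lebesgue. \<bar>g x\<bar> * tail_part p T (u x)) - (LINT x|lebesgue. \<bar>g x\<bar> * head_part p T (u x))"
    unfolding log_density_split[OF T, abs_def] using i1 i2 i3 ub(2) by simp
qed

text \<open>The positive part of the logarithmic integrand is always integrable, so the logarithmic integral is
finite or \<open>-\<infinity>\<close>. In the second case the denominator of the quotient is zero and its numerator is
positive, because admissible functions have positive energy.\<close>
lemma log_quotient_cases:
  assumes u: "u \<in> admissible"
  shows "integrable lebesgue (log_density u) \<Longrightarrow>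
      log_quotient p g \<gamma> u = ennreal (energy p u * exp (- (LINT x|lebesgue. log_density u x) / \<gamma>))"
    "\<not> integrable lebesgue (log_density u) \<Longrightarrow> log_quotient p g \<gamma> u = \<infinity>"
proof -
  have ub: "u \<in> beppo_levi p" using u by (auto simp: admissible_def)
  have [measurable]: "u \<in> borel_measurable lebesgue" using u by (rule admissible_measurable)
  have split: "log_density u x = \<bar>g x\<bar> * tail_part p 1 (u x) - \<bar>g x\<bar> * head_part p 1 (u x)" for x
    using log_density_split[of 1 u x] by simp
  have z: "tail_part p 1 s = 0 \<or> head_part p 1 s = 0" for s
  proof (cases "\<bar>s\<bar> \<ge> 1")
    case True
    then have "ln (1 / \<bar>s\<bar>) \<le> 0" by (auto simp: ln_div)
    then show ?thesis using p(1) by (simp add: head_part_def mult_nonneg_nonpos)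
  next
    case False
    then have "s = 0 \<or> ln (\<bar>s\<bar> / 1) \<le> 0" by (cases "s = 0") auto
    then show ?thesis using p(1) by (auto simp: tail_part_def mult_nonneg_nonpos)
  qed
  have pos: "ennreal (log_density u x) = ennreal \<bar>g x\<bar> * ennreal (tail_part p 1 (u x))"
    and neg: "ennreal (- log_density u x) = ennreal (\<bar>g x\<bar> * head_part p 1 (u x))" for x
    using z[of "u x"] parts_nonneg[of p 1 "u x"] unfolding split by (auto simp: ennreal_mult ennreal_neg)
  define a where "a = (\<integral>\<^sup>+x. ennreal (log_density u x) \<partial>lebesgue)"
  define b where "b = (\<integral>\<^sup>+x. ennreal (- log_density u x) \<partial>lebesgue)"
  have li: "log_integral p g u = enn2ereal a - enn2ereal b"
    unfolding log_integral_def a_def b_def log_density_def by (simp add: mult.assoc)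
  have a: "a < \<infinity>"
  proof -
    obtain C where "(\<integral>\<^sup>+x. ennreal \<bar>g x\<bar> * ennreal (tail_part p 1 (u x)) \<partial>lebesgue) \<le> ennreal (C * 1 powr (p - r) * energy p u powr (r / p))"
      using tail_part_bound ub zero_less_one by blast
    then show ?thesis unfolding a_def pos by (auto intro: le_less_trans)
  qed
  have meas: "log_density u \<in> borel_measurable lebesgue" unfolding log_density_def[abs_def] by measurable
  have iff: "integrable lebesgue (log_density u) \<longleftrightarrow> b < \<infinity>"
    using a meas unfolding real_integrable_def a_def b_def by (auto simp: less_top[symmetric])
  have E: "energy p u > 0" using energy_lower_bound u by force
  {
    assume i: "integrable lebesgue (log_density u)"
    then have "b < \<infinity>" using iff by simp
    then have "enn2ereal a - enn2ereal b = ereal (enn2real a - enn2real b)"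
      using a by (cases a; cases b) (auto simp: enn2ereal_ennreal)
    also have "enn2real a - enn2real b = (LINT x|lebesgue. log_density u x)"
      using real_lebesgue_integral_def[OF i] by (simp add: a_def b_def)
    finally have "log_quotient p g \<gamma> u = ennreal (energy p u) / ennreal (exp ((LINT x|lebesgue. log_density u x) / \<gamma>))"
      by (simp add: log_quotient_def li)
    also have "\<dots> = ennreal (energy p u * exp (- (LINT x|lebesgue. log_density u x) / \<gamma>))"
      using E by (subst divide_ennreal) (auto simp: exp_minus divide_inverse)
    finally show "log_quotient p g \<gamma> u = ennreal (energy p u * exp (- (LINT x|lebesgue. log_density u x) / \<gamma>))" .
  next
    assume "\<not> integrable lebesgue (log_density u)"
    then have "b = \<infinity>" using iff by (simp add: less_top[symmetric])
    then have "enn2ereal a - enn2ereal b = - \<infinity>" using a by (cases a) (auto simp: enn2ereal_ennreal)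
    moreover have "ereal (1 / \<gamma>) * (- \<infinity>) = - \<infinity>" using gamma_pos by simp
    moreover have "exp_ereal (- \<infinity>) = 0"
      unfolding MInfty_eq_minfinity[symmetric] by (rule exp_ereal.simps)
    ultimately have "exp_ereal (ereal (1 / \<gamma>) * log_integral p g u) = 0" unfolding li by simp
    then show "log_quotient p g \<gamma> u = \<infinity>" using E by (simp add: log_quotient_def ennreal_divide_zero)
  }
qed

text \<open>A smooth cutoff that equals \<open>1\<close> on a ball on which \<open>g\<close> is not almost everywhere zero, multiplied
by a constant. The strong
type inequality shows that its weighted integral is finite.\<close>
lemma admissible_nonempty: "admissible \<noteq> {}"
proof -
  have "\<exists>R. ldist R g (\<lambda>_. 0) \<noteq> 0"
    using ldist_eq_0_imp_AE[of g "\<lambda>_. 0"] g0 weight_measurable by auto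
  then obtain R where R: "ldist R g (\<lambda>_. 0) \<noteq> 0" by blast
  define S where "S = max R 1"
  have S: "S > 0" "R \<le> S" by (auto simp: S_def)
  define \<phi> where "\<phi> x = step (3 - (1 / S\<^sup>2) * (\<Sum>i\<in>Basis. (x \<bullet> i) * (x \<bullet> i)))" for x :: 'a
  have sm: "smooth \<phi>" unfolding \<phi>_def[abs_def]
    by (intro smooth_step smooth_diff smooth_const smooth_mult smooth_sum smooth_inner)
  have \<phi>: "\<phi> x = step (3 - (norm x / S)\<^sup>2)" for x
    unfolding \<phi>_def euclidean_inner[of x x, symmetric] by (simp add: power2_norm_eq_inner power_divide)
  have z: "\<phi> x = 0" if "2 * S < norm x" for x
  proof -
    have "2 \<le> norm x / S" using that S by (simp add: field_simps)
    then have "2\<^sup>2 \<le> (norm x / S)\<^sup>2" by (intro power_mono) auto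
    then show ?thesis unfolding \<phi> by (intro step_eq_0) simp
  qed
  have o: "\<phi> x = 1" if "norm x \<le> R" for x
  proof -
    have "norm x / S \<le> 1" using that S by (simp add: field_simps)
    then have "(norm x / S)\<^sup>2 \<le> 1\<^sup>2" using S by (intro power_mono) auto
    then show ?thesis unfolding \<phi> by (intro step_eq_1) simp
  qed
  have t: "test_fun \<phi>" unfolding test_fun_iff using sm z by blast
  define J where "J = (\<integral>\<^sup>+x. ennreal \<bar>g x\<bar> * ennreal (\<bar>\<phi> x\<bar> powr p) \<partial>lebesgue)"
  have "J \<le> weight_norm p p g * ennreal (2 * 144 powr p * dirichlet p \<phi>)"
    unfolding J_def using p by (intro strong_type_test_fun weight_norms_finite weight_measurable t) auto
  also have "\<dots> < \<infinity>" using weight_norms_finite(2) by (simp add: ennreal_mult_less_top)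
  finally have Jf: "J < \<infinity>" .
  have "ldist R g (\<lambda>_. 0) \<le> J" unfolding ldist_def J_def
    by (intro nn_integral_mono) (auto simp: o split: split_indicator)
  then have J0: "J \<noteq> 0" using R by auto
  obtain j where j: "J = ennreal j" "j > 0" using Jf J0 by (cases J) (auto simp: less_le)
  define v where "v x = (j powr (- (1 / p))) * \<phi> x" for x
  have tv: "test_fun v" unfolding v_def[abs_def] by (rule test_fun_cmult[OF t])
  have "(j powr (- (1 / p))) powr p = 1 / j"
  proof -
    have "- (1/p) * p = - 1" using p by simp
    then show ?thesis unfolding powr_powr using j(2) by (simp add: powr_neg_one)
  qed
  then have "\<bar>v x\<bar> powr p = (1 / j) * \<bar>\<phi> x\<bar> powr p" for x using j by (simp add: v_def abs_mult powr_mult)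
  then have "(\<integral>\<^sup>+x. ennreal \<bar>g x\<bar> * ennreal (\<bar>v x\<bar> powr p) \<partial>lebesgue)
      = (\<integral>\<^sup>+x. ennreal (1 / j) * (ennreal \<bar>g x\<bar> * ennreal (\<bar>\<phi> x\<bar> powr p)) \<partial>lebesgue)"
    using j by (intro nn_integral_cong) (simp add: ennreal_mult mult_ac del: times_divide_eq_left)
  also have "\<dots> = ennreal (1 / j) * J" unfolding J_def
  proof (rule nn_integral_cmult)
    have [measurable]: "\<phi> \<in> borel_measurable lebesgue" using test_fun_measurable(1)[OF t] by auto
    show "(\<lambda>x. ennreal \<bar>g x\<bar> * ennreal (\<bar>\<phi> x\<bar> powr p)) \<in> borel_measurable lebesgue" by measurable
  qed
  also have "\<dots> = 1" using j by (simp flip: ennreal_mult)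
  finally have "v \<in> admissible" by (intro admissibleI test_fun_beppo_levi tv)
  then show ?thesis by blast
qed

lemma log_upper_bound:
  "\<exists>C\<ge>0. \<forall>u\<in>admissible. integrable lebesgue (log_density u) \<longrightarrow>
     (LINT x|lebesgue. log_density u x) \<le> r / (r - p) * ln (energy p u) + C"
proof -
  obtain C where C: "C \<ge> 0" "\<And>u T. u \<in> beppo_levi p \<Longrightarrow> T > 0 \<Longrightarrow>
    (\<integral>\<^sup>+x. ennreal \<bar>g x\<bar> * ennreal (tail_part p T (u x)) \<partial>lebesgue) \<le> ennreal (C * T powr (p - r) * energy p u powr (r / p))"
    using tail_part_bound by blast
  have "(LINT x|lebesgue. log_density u x) \<le> r / (r - p) * ln (energy p u) + C"
    if u: "u \<in> admissible" and i: "integrable lebesgue (log_density u)" for u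
  proof -
    have ub: "u \<in> beppo_levi p" using u by (simp add: admissible_def)
    have E: "energy p u > 0" using energy_lower_bound u by force
    \<comment> \<open>This choice turns the bound for the tail into a constant and makes \<open>p ln T\<close> the announced multiple of \<open>ln E\<close>.\<close>
    define T where "T = energy p u powr (r / (p * (r - p)))"
    have T: "T > 0" using E by (simp add: T_def)
    have it: "integrable lebesgue (\<lambda>x. \<bar>g x\<bar> * tail_part p T (u x))" by (rule tail_part_integrable[OF ub T])
    have "T powr (p - r) = energy p u powr (- (r / p))"
    proof -
      have "r / (p * (r - p)) * (p - r) = - (r / p)" using p by (simp add: field_simps)
      then show ?thesis by (simp add: T_def powr_powr)
    qed
    then have eC: "C * T powr (p - r) * energy p u powr (r / p) = C" using E by (simp add: powr_minus)
    have "(\<integral>\<^sup>+x. ennreal (\<bar>g x\<bar> * tail_part p T (u x)) \<partial>lebesgue) \<le> ennreal C"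
      using C(2)[OF ub T] unfolding eC by (simp add: ennreal_mult parts_nonneg)
    then have tl: "(LINT x|lebesgue. \<bar>g x\<bar> * tail_part p T (u x)) \<le> C"
      using nn_integral_eq_integral[OF it] C(1) by (simp add: parts_nonneg)
    have hd: "0 \<le> (LINT x|lebesgue. \<bar>g x\<bar> * head_part p T (u x))" by (simp add: parts_nonneg)
    have "p * ln T = r / (r - p) * ln (energy p u)" using E p by (simp add: T_def ln_powr)
    then show ?thesis using head_part_integrable_iff(2)[OF u T i] tl hd by linarith
  qed
  then show ?thesis using C(1) by blast
qed

text \<open>In logarithms the quotient is \<open>ln E - L/\<gamma> \<ge> (1 - \<theta>) ln E - C/\<gamma>\<close>, and \<open>\<theta> = r/((r-p) \<gamma>) < 1\<close>.\<close>
lemma coercive: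
  assumes "B > 0"
  shows "\<exists>E. \<forall>u\<in>admissible. integrable lebesgue (log_density u) \<longrightarrow>
     energy p u * exp (- (LINT x|lebesgue. log_density u x) / \<gamma>) \<le> B \<longrightarrow> energy p u \<le> E"
proof -
  obtain C where C: "C \<ge> 0" "\<And>u. u \<in> admissible \<Longrightarrow> integrable lebesgue (log_density u) \<Longrightarrow>
     (LINT x|lebesgue. log_density u x) \<le> r / (r - p) * ln (energy p u) + C"
    using log_upper_bound by blast
  define \<theta> where "\<theta> = r / (r - p) / \<gamma>"
  have \<theta>: "\<theta> < 1" using gam unfolding \<theta>_def by (subst pos_divide_less_eq[OF gamma_pos]) simp
  have "energy p u \<le> exp ((ln B + C / \<gamma>) / (1 - \<theta>))"
    if u: "u \<in> admissible" and i: "integrable lebesgue (log_density u)"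
      and b: "energy p u * exp (- (LINT x|lebesgue. log_density u x) / \<gamma>) \<le> B" for u
  proof -
    define L where "L = (LINT x|lebesgue. log_density u x)"
    have E: "energy p u > 0" using energy_lower_bound u by force
    have "ln (energy p u * exp (- L / \<gamma>)) \<le> ln B" using b E assms by (simp add: L_def)
    then have 1: "ln (energy p u) - L / \<gamma> \<le> ln B" using E by (simp add: ln_mult)
    have "L / \<gamma> \<le> (r / (r - p) * ln (energy p u) + C) / \<gamma>"
      using C(2)[OF u i] gamma_pos by (intro divide_right_mono) (auto simp: L_def)
    also have "\<dots> = \<theta> * ln (energy p u) + C / \<gamma>" by (simp add: \<theta>_def add_divide_distrib)
    finally have "(1 - \<theta>) * ln (energy p u) \<le> ln B + C / \<gamma>" using 1 by (simp add: algebra_simps)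
    then have "ln (energy p u) \<le> (ln B + C / \<gamma>) / (1 - \<theta>)" using \<theta> by (simp add: field_simps)
    then show ?thesis using E by (metis exp_le_cancel_iff exp_ln)
  qed
  then show ?thesis by blast
qed

section \<open>Existence of a minimiser\<close>

text \<open>Fatou's lemma gives one inequality for the mass of \<open>v\<close>. Conversely, the unit mass of \<open>u n\<close> is at most the
integral of \<open>|\<psi>| min(|u n|, T)^p\<close>, which converges, plus the mass for the weight \<open>g - \<psi>\<close>, plus the mass
where \<open>|u n| > T\<close>. The last two are uniformly small for suitable \<open>\<psi>\<close> and \<open>T\<close>.\<close>
lemma weighted_mass_limit:
  assumes u: "\<And>n. u n \<in> admissible" and E: "\<And>n. energy p (u n) \<le> B"
    and v: "v \<in> beppo_levi p" "energy p v \<le> B" and ae: "AE x in lebesgue. (\<lambda>n. u n x) \<longlonglongrightarrow> v x"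
  shows "v \<in> admissible"
proof (rule admissibleI[OF v(1)])
  have ub: "u n \<in> beppo_levi p" for n using u by (simp add: admissible_def)
  have [measurable]: "u n \<in> borel_measurable lebesgue" "v \<in> borel_measurable lebesgue" for n
    using ub v by (auto intro: beppo_levi_measurable)
  have B: "B \<ge> 0" using order_trans[OF _ E[of 0], of 0] by (simp add: energy_def)
  define I where "I h w = (\<integral>\<^sup>+x. ennreal \<bar>h x\<bar> * ennreal (\<bar>w x\<bar> powr p) \<partial>lebesgue)" for h w :: "'a \<Rightarrow> real"
  have I1: "I g (u n) = 1" for n using admissible_integrable(2)[OF u] by (simp add: I_def)
  have le: "I g v \<le> 1"
    unfolding I_def
  proof (rule nn_integral_fatou_tendsto)
    show "AE x in lebesgue. (\<lambda>n. ennreal \<bar>g x\<bar> * ennreal (\<bar>u n x\<bar> powr p)) \<longlonglongrightarrow> ennreal \<bar>g x\<bar> * ennreal (\<bar>v x\<bar> powr p)"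
      using ae
    proof eventually_elim
      case (elim x)
      then show ?case using p
        by (intro ennreal_tendsto_cmult tendsto_ennrealI tendsto_powr2 tendsto_rabs tendsto_const) auto
    qed
    show "\<forall>\<^sub>F n in sequentially. (\<integral>\<^sup>+x. ennreal \<bar>g x\<bar> * ennreal (\<bar>u n x\<bar> powr p) \<partial>lebesgue) \<le> 1"
      using I1 by (simp add: I_def)
  qed measurable
  have "1 \<le> I g v + ennreal \<epsilon>" if eps: "\<epsilon> > 0" for \<epsilon>
  proof -
    define K where "K = 2 * 144 powr p"
    have K: "K > 0" by (simp add: K_def)
    define \<eta> where "\<eta> = \<epsilon> / 3 / (K * B + 1)"
    have KB: "K * B \<ge> 0" using K B by simp
    have \<eta>: "\<eta> > 0" using eps KB by (simp add: \<eta>_def)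
    have \<eta>K: "\<eta> * (K * B) \<le> \<epsilon> / 3" using eps KB by (simp add: \<eta>_def field_simps)
    obtain \<psi> where \<psi>: "test_fun \<psi>" "weight_norm p p (\<lambda>x. g x - \<psi> x) < ennreal \<eta>"
      using g \<eta> unfolding F_space_def by blast
    have [measurable]: "\<psi> \<in> borel_measurable lebesgue" using test_fun_measurable(1)[OF \<psi>(1)] by auto
    have diff: "I (\<lambda>x. g x - \<psi> x) w \<le> ennreal (\<epsilon> / 3)" if w: "w \<in> beppo_levi p" "energy p w \<le> B" for w
    proof -
      have "I (\<lambda>x. g x - \<psi> x) w \<le> weight_norm p p (\<lambda>x. g x - \<psi> x) * ennreal (2 * 144 powr p * energy p w)"
        unfolding I_def by (rule capacitary_strong_type[OF p(1) w(1) less_trans[OF \<psi>(2)]]) auto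
      also have "\<dots> \<le> ennreal \<eta> * ennreal (K * B)"
      proof (rule mult_mono)
        show "ennreal (2 * 144 powr p * energy p w) \<le> ennreal (K * B)"
          using w(2) unfolding K_def by (intro ennreal_leI mult_left_mono) auto
      qed (use \<psi>(2) in \<open>auto intro: less_imp_le\<close>)
      also have "\<dots> = ennreal (\<eta> * (K * B))" using \<eta> KB by (simp add: ennreal_mult)
      also have "\<dots> \<le> ennreal (\<epsilon> / 3)" by (rule ennreal_leI[OF \<eta>K])
      finally show ?thesis .
    qed
    obtain A where A: "weight_norm p r g = ennreal A" "A \<ge> 0" using weight_norms_finite(1) by (cases "weight_norm p r g") auto
    define c where "c = A * (2 * 2 powr p / (1 - 2 powr (p - r))) * B powr (r / p)"
    have "2 powr (p - r) < (1::real)" using powr_less_mono[of "p - r" 0 2] p by simp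
    then have c: "c \<ge> 0" using A by (simp add: c_def)
    have "((\<lambda>T. T powr (p - r)) \<longlongrightarrow> 0) at_top" using p by (intro tendsto_neg_powr filterlim_ident) auto
    then have "((\<lambda>T. c * T powr (p - r)) \<longlongrightarrow> c * 0) at_top" by (intro tendsto_mult tendsto_const)
    then have "\<forall>\<^sub>F T in at_top. c * T powr (p - r) < \<epsilon> / 3" using eps by (intro order_tendstoD(2)) auto
    then obtain T where T: "T > 0" "c * T powr (p - r) < \<epsilon> / 3"
      using eventually_conj[OF _ eventually_gt_at_top[of 0]] eventually_happens'[OF trivial_limit_at_top_linorder]
      by (metis (mono_tags, lifting))
    have tail: "(\<integral>\<^sup>+x. ennreal \<bar>g x\<bar> * (ennreal (\<bar>u n x\<bar> powr p) * indicator {T<..} \<bar>u n x\<bar>) \<partial>lebesgue) \<le> ennreal (\<epsilon> / 3)" for n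
    proof -
      have "(\<integral>\<^sup>+x. ennreal \<bar>g x\<bar> * (ennreal (\<bar>u n x\<bar> powr p) * indicator {T<..} \<bar>u n x\<bar>) \<partial>lebesgue)
        \<le> ennreal A * ennreal (2 * 2 powr p / (1 - 2 powr (p - r)) * T powr (p - r) * energy p (u n) powr (r / p))"
        unfolding A(1)[symmetric] by (rule tail_bound[OF p(1) _ p(3) ub weight_norms_finite(1) weight_measurable T(1)]) (use p in auto)
      also have "\<dots> \<le> ennreal A * ennreal (2 * 2 powr p / (1 - 2 powr (p - r)) * T powr (p - r) * B powr (r / p))"
        using E[of n] p \<open>2 powr (p - r) < 1\<close>
        by (intro mult_left_mono ennreal_leI powr_mono2) (auto simp: energy_def)
      also have "\<dots> = ennreal (c * T powr (p - r))"
        using A \<open>2 powr (p - r) < 1\<close> by (simp add: c_def mult_ac flip: ennreal_mult)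
      also have "\<dots> \<le> ennreal (\<epsilon> / 3)" using T by (intro ennreal_leI) auto
      finally show ?thesis .
    qed
    define f where "f w x = ennreal \<bar>\<psi> x\<bar> * ennreal (min \<bar>w x\<bar> T powr p)" for w :: "'a \<Rightarrow> real" and x
    have main: "1 \<le> (\<integral>\<^sup>+x. f (u n) x \<partial>lebesgue) + ennreal (\<epsilon> / 3) + ennreal (\<epsilon> / 3)" for n
    proof -
      have "1 = I g (u n)" by (simp add: I1)
      also have "\<dots> \<le> (\<integral>\<^sup>+x. f (u n) x + ennreal \<bar>g x - \<psi> x\<bar> * ennreal (\<bar>u n x\<bar> powr p)
          + ennreal \<bar>g x\<bar> * (ennreal (\<bar>u n x\<bar> powr p) * indicator {T<..} \<bar>u n x\<bar>) \<partial>lebesgue)"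
        unfolding I_def
      proof (rule nn_integral_mono)
        fix x
        show "ennreal \<bar>g x\<bar> * ennreal (\<bar>u n x\<bar> powr p) \<le> f (u n) x + ennreal \<bar>g x - \<psi> x\<bar> * ennreal (\<bar>u n x\<bar> powr p)
          + ennreal \<bar>g x\<bar> * (ennreal (\<bar>u n x\<bar> powr p) * indicator {T<..} \<bar>u n x\<bar>)"
        proof (cases "T < \<bar>u n x\<bar>")
          case True
          then show ?thesis by (simp add: add_increasing)
        next
          case False
          have "ennreal \<bar>g x\<bar> * ennreal (\<bar>u n x\<bar> powr p) \<le> (ennreal \<bar>\<psi> x\<bar> + ennreal \<bar>g x - \<psi> x\<bar>) * ennreal (\<bar>u n x\<bar> powr p)"
            by (intro mult_right_mono) (auto simp flip: ennreal_plus intro!: ennreal_leI)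
          also have "\<dots> = f (u n) x + ennreal \<bar>g x - \<psi> x\<bar> * ennreal (\<bar>u n x\<bar> powr p)"
            using False by (simp add: f_def distrib_right min_def)
          finally show ?thesis using False by simp
        qed
      qed
      also have "\<dots> = (\<integral>\<^sup>+x. f (u n) x \<partial>lebesgue) + I (\<lambda>x. g x - \<psi> x) (u n)
          + (\<integral>\<^sup>+x. ennreal \<bar>g x\<bar> * (ennreal (\<bar>u n x\<bar> powr p) * indicator {T<..} \<bar>u n x\<bar>) \<partial>lebesgue)"
        unfolding I_def f_def by (simp add: nn_integral_add)
      also have "\<dots> \<le> (\<integral>\<^sup>+x. f (u n) x \<partial>lebesgue) + ennreal (\<epsilon> / 3) + ennreal (\<epsilon> / 3)"
        by (intro add_mono diff ub E tail order_refl)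
      finally show ?thesis .
    qed
    have "(\<lambda>n. \<integral>\<^sup>+x. f (u n) x \<partial>lebesgue) \<longlonglongrightarrow> (\<integral>\<^sup>+x. f v x \<partial>lebesgue)"
    proof (rule nn_integral_dominated_convergence[where w = "\<lambda>x. ennreal \<bar>\<psi> x\<bar> * ennreal (T powr p)"])
      show "f (u n) \<in> borel_measurable lebesgue" "f v \<in> borel_measurable lebesgue" for n
        unfolding f_def[abs_def] by measurable
      show "AE x in lebesgue. f (u n) x \<le> ennreal \<bar>\<psi> x\<bar> * ennreal (T powr p)" for n
        unfolding f_def using p T by (intro AE_I2 mult_left_mono ennreal_leI powr_mono2) auto
      obtain R where R: "\<And>x. R < norm x \<Longrightarrow> \<psi> x = 0" using test_fun_supportE[OF \<psi>(1)] by metis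
      have "integrable lebesgue \<psi>"
        by (rule continuous_bounded_support_integrable[OF test_fun_continuous[OF \<psi>(1)] R])
      then have "(\<integral>\<^sup>+x. ennreal \<bar>\<psi> x\<bar> \<partial>lebesgue) < \<infinity>" by (simp add: integrable_iff_bounded)
      then show "(\<integral>\<^sup>+x. ennreal \<bar>\<psi> x\<bar> * ennreal (T powr p) \<partial>lebesgue) < \<infinity>"
        by (simp add: nn_integral_multc ennreal_mult_less_top)
      show "AE x in lebesgue. (\<lambda>n. f (u n) x) \<longlonglongrightarrow> f v x"
        using ae
      proof eventually_elim
        case (elim x)
        have "(\<lambda>n. min \<bar>u n x\<bar> T powr p) \<longlonglongrightarrow> min \<bar>v x\<bar> T powr p"
          using p T elim by (intro tendsto_powr2 tendsto_min tendsto_rabs tendsto_const) auto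
        then show ?case unfolding f_def by (intro ennreal_tendsto_cmult tendsto_ennrealI) auto
      qed
    qed measurable
    then have "(\<lambda>n. (\<integral>\<^sup>+x. f (u n) x \<partial>lebesgue) + ennreal (\<epsilon> / 3) + ennreal (\<epsilon> / 3))
        \<longlonglongrightarrow> (\<integral>\<^sup>+x. f v x \<partial>lebesgue) + ennreal (\<epsilon> / 3) + ennreal (\<epsilon> / 3)"
      by (intro tendsto_add tendsto_const)
    then have "1 \<le> (\<integral>\<^sup>+x. f v x \<partial>lebesgue) + ennreal (\<epsilon> / 3) + ennreal (\<epsilon> / 3)"
      by (rule LIMSEQ_le_const) (use main in auto)
    also have "(\<integral>\<^sup>+x. f v x \<partial>lebesgue) \<le> (\<integral>\<^sup>+x. ennreal \<bar>g x\<bar> * ennreal (\<bar>v x\<bar> powr p) + ennreal \<bar>g x - \<psi> x\<bar> * ennreal (\<bar>v x\<bar> powr p) \<partial>lebesgue)"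
    proof (rule nn_integral_mono)
      fix x
      have "f v x \<le> (ennreal \<bar>g x\<bar> + ennreal \<bar>g x - \<psi> x\<bar>) * ennreal (\<bar>v x\<bar> powr p)"
        unfolding f_def using p T
        by (intro mult_mono ennreal_leI powr_mono2) (auto simp flip: ennreal_plus intro!: ennreal_leI)
      then show "f v x \<le> ennreal \<bar>g x\<bar> * ennreal (\<bar>v x\<bar> powr p) + ennreal \<bar>g x - \<psi> x\<bar> * ennreal (\<bar>v x\<bar> powr p)"
        by (simp add: distrib_right)
    qed
    also have "\<dots> = I g v + I (\<lambda>x. g x - \<psi> x) v" unfolding I_def by (rule nn_integral_add) measurable
    also have "\<dots> \<le> I g v + ennreal (\<epsilon> / 3)" by (intro add_left_mono diff v)
    finally have "1 \<le> I g v + (ennreal (\<epsilon> / 3) + (ennreal (\<epsilon> / 3) + ennreal (\<epsilon> / 3)))"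
      by (simp add: add.assoc)
    also have "ennreal (\<epsilon> / 3) + (ennreal (\<epsilon> / 3) + ennreal (\<epsilon> / 3)) = ennreal (\<epsilon> / 3 + (\<epsilon> / 3 + \<epsilon> / 3))"
      using eps by (simp only: ennreal_plus[symmetric] less_imp_le divide_pos_pos zero_less_numeral add_nonneg_nonneg)
    finally show ?thesis by simp
  qed
  then have "1 \<le> I g v" by (auto intro: ennreal_le_epsilon)
  with le show "(\<integral>\<^sup>+x. ennreal \<bar>g x\<bar> * ennreal (\<bar>v x\<bar> powr p) \<partial>lebesgue) = 1" by (simp add: I_def)
qed

text \<open>Fatou's lemma bounds the head part of \<open>v\<close> at the level \<open>T\<close> by \<open>p ln T - l\<close> and the tail of the
sequence, which is at most \<open>c T^(p-r)\<close>. Hence the integral for \<open>v\<close> is at least \<open>l - c T^(p-r)\<close>, and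
\<open>T\<close> tends to infinity.\<close>
lemma log_integral_limit:
  assumes u: "\<And>n. u n \<in> admissible" and i: "\<And>n. integrable lebesgue (log_density (u n))"
    and E: "\<And>n. energy p (u n) \<le> B" and L: "(\<lambda>n. LINT x|lebesgue. log_density (u n) x) \<longlonglongrightarrow> l"
    and v: "v \<in> admissible" and ae: "AE x in lebesgue. (\<lambda>n. u n x) \<longlonglongrightarrow> v x"
  shows "integrable lebesgue (log_density v)" "l \<le> (LINT x|lebesgue. log_density v x)"
proof -
  have ub: "u n \<in> beppo_levi p" for n using u by (simp add: admissible_def)
  have [measurable]: "u n \<in> borel_measurable lebesgue" "v \<in> borel_measurable lebesgue" for n
    using u v by (auto intro: admissible_measurable)
  have B: "B \<ge> 0" using order_trans[OF _ E[of 0], of 0] by (simp add: energy_def)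
  obtain C where C: "C \<ge> 0" "\<And>u T. u \<in> beppo_levi p \<Longrightarrow> T > 0 \<Longrightarrow>
    (\<integral>\<^sup>+x. ennreal \<bar>g x\<bar> * ennreal (tail_part p T (u x)) \<partial>lebesgue) \<le> ennreal (C * T powr (p - r) * energy p u powr (r / p))"
    using tail_part_bound by blast
  define c where "c = C * B powr (r / p)"
  have c: "c \<ge> 0" using C by (simp add: c_def)
  have head: "(\<integral>\<^sup>+x. ennreal \<bar>g x\<bar> * ennreal (head_part p T (v x)) \<partial>lebesgue) \<le> ennreal (p * ln T + c * T powr (p - r) - l)"
    if T: "T > 0" for T
  proof (rule nn_integral_fatou_bound[OF _ _ always_eventually[OF allI]])
    show "AE x in lebesgue. ennreal \<bar>g x\<bar> * ennreal (head_part p T (v x)) \<le> liminf (\<lambda>n. ennreal \<bar>g x\<bar> * ennreal (head_part p T (u n x)))"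
      using ae
    proof eventually_elim
      case (elim x)
      have "0 < p" using p(1) by simp
      from head_part_lsc[OF elim T this] show ?case
      proof (elim disjE)
        assume "(\<lambda>n. head_part p T (u n x)) \<longlonglongrightarrow> head_part p T (v x)"
        then have "(\<lambda>n. ennreal \<bar>g x\<bar> * ennreal (head_part p T (u n x))) \<longlonglongrightarrow> ennreal \<bar>g x\<bar> * ennreal (head_part p T (v x))"
          by (intro ennreal_tendsto_cmult tendsto_ennrealI) auto
        then show ?thesis by (simp add: lim_imp_Liminf)
      qed auto
    qed
    fix n
    define \<tau> where "\<tau> = (LINT x|lebesgue. \<bar>g x\<bar> * tail_part p T (u n x))"
    have it: "integrable lebesgue (\<lambda>x. \<bar>g x\<bar> * tail_part p T (u n x))" by (rule tail_part_integrable[OF ub T])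
    have "(\<integral>\<^sup>+x. ennreal (\<bar>g x\<bar> * tail_part p T (u n x)) \<partial>lebesgue) \<le> ennreal (C * T powr (p - r) * energy p (u n) powr (r / p))"
      using C(2)[OF ub T] by (simp add: ennreal_mult parts_nonneg)
    then have "\<tau> \<le> C * T powr (p - r) * energy p (u n) powr (r / p)"
      using nn_integral_eq_integral[OF it] C(1) by (simp add: parts_nonneg \<tau>_def)
    also have "\<dots> \<le> C * T powr (p - r) * B powr (r / p)"
      using C(1) E[of n] p by (intro mult_left_mono powr_mono2) (auto simp: energy_def)
    finally have \<tau>: "\<tau> \<le> c * T powr (p - r)" by (simp add: c_def mult_ac)
    have ih: "integrable lebesgue (\<lambda>x. \<bar>g x\<bar> * head_part p T (u n x))"
      using head_part_integrable_iff(1)[OF u T] i by blast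
    have "(\<integral>\<^sup>+x. ennreal \<bar>g x\<bar> * ennreal (head_part p T (u n x)) \<partial>lebesgue) = ennreal (LINT x|lebesgue. \<bar>g x\<bar> * head_part p T (u n x))"
      using nn_integral_eq_integral[OF ih] by (simp add: ennreal_mult parts_nonneg)
    also have "(LINT x|lebesgue. \<bar>g x\<bar> * head_part p T (u n x)) = p * ln T + \<tau> - (LINT x|lebesgue. log_density (u n) x)"
      using head_part_integrable_iff(2)[OF u T i] by (simp add: \<tau>_def)
    also have "ennreal \<dots> \<le> ennreal (p * ln T + c * T powr (p - r) - (LINT x|lebesgue. log_density (u n) x))"
      using \<tau> by (intro ennreal_leI) simp
    finally show "(\<integral>\<^sup>+x. ennreal \<bar>g x\<bar> * ennreal (head_part p T (u n x)) \<partial>lebesgue)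
      \<le> ennreal (p * ln T + c * T powr (p - r) - (LINT x|lebesgue. log_density (u n) x))" .
  next
    show "(\<lambda>n. ennreal (p * ln T + c * T powr (p - r) - (LINT x|lebesgue. log_density (u n) x)))
      \<longlonglongrightarrow> ennreal (p * ln T + c * T powr (p - r) - l)"
      by (intro tendsto_ennrealI tendsto_diff tendsto_const L)
  qed measurable
  have ihv: "integrable lebesgue (\<lambda>x. \<bar>g x\<bar> * head_part p T (v x))" if T: "T > 0" for T
    using head[OF T] by (intro integrableI_nonneg) (auto simp: parts_nonneg ennreal_mult intro: le_less_trans)
  show iv: "integrable lebesgue (log_density v)"
    using ihv[of 1] head_part_integrable_iff(1)[OF v, of 1] by simp
  \<comment> \<open>For large \<open>T\<close> the bound for the head part is a nonnegative real number, so nothing is lost in \<open>ennreal\<close>.\<close>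
  have low: "l - c * T powr (p - r) \<le> (LINT x|lebesgue. log_density v x)" if T: "T > 1" "l \<le> p * ln T" for T
  proof -
    have T0: "T > 0" using T by simp
    have "ennreal (LINT x|lebesgue. \<bar>g x\<bar> * head_part p T (v x)) \<le> ennreal (p * ln T + c * T powr (p - r) - l)"
      using head[OF T0] nn_integral_eq_integral[OF ihv[OF T0]] by (simp add: ennreal_mult parts_nonneg)
    moreover have "0 \<le> p * ln T + c * T powr (p - r) - l"
      using T(2) mult_nonneg_nonneg[OF c powr_ge_zero[of T "p - r"]] by linarith
    ultimately have "(LINT x|lebesgue. \<bar>g x\<bar> * head_part p T (v x)) \<le> p * ln T + c * T powr (p - r) - l"
      by simp
    moreover have "0 \<le> (LINT x|lebesgue. \<bar>g x\<bar> * tail_part p T (v x))" by (simp add: parts_nonneg)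
    ultimately show ?thesis using head_part_integrable_iff(2)[OF v T0 iv] by linarith
  qed
  have "((\<lambda>T. T powr (p - r)) \<longlongrightarrow> 0) at_top" using p by (intro tendsto_neg_powr filterlim_ident) auto
  then have "((\<lambda>T. l - c * T powr (p - r)) \<longlongrightarrow> l - c * 0) at_top" by (intro tendsto_intros)
  moreover have "\<forall>\<^sub>F T in at_top. l - c * T powr (p - r) \<le> (LINT x|lebesgue. log_density v x)"
    using eventually_gt_at_top[of "max 1 (exp (l / p))"]
  proof eventually_elim
    case (elim T)
    then have "T > 1" "exp (l / p) < T" by auto
    then have "ln (exp (l / p)) < ln T" by (subst ln_less_cancel_iff) auto
    then have "l / p < ln T" by simp
    then have "l \<le> p * ln T" using p by (simp add: field_simps)
    with \<open>T > 1\<close> show ?case by (intro low)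
  qed
  ultimately have "l - c * 0 \<le> (LINT x|lebesgue. log_density v x)"
    by (intro tendsto_upperbound) auto
  then show "l \<le> (LINT x|lebesgue. log_density v x)" by simp
qed

theorem best_constant_attained:
  "\<exists>u\<in>beppo_levi p. (LINT x|lebesgue. \<bar>g x\<bar> * \<bar>u x\<bar> powr p) = 1 \<and> log_quotient p g \<gamma> u = 1 / C_B p g \<gamma>"
proof -
  define I where "I = (INF u\<in>admissible. log_quotient p g \<gamma> u)"
  have I: "1 / C_B p g \<gamma> = I" unfolding C_B_def I_def admissible_def by (rule inverse_inverse_ennreal)
  have "\<exists>u\<in>admissible. log_quotient p g \<gamma> u = I"
  proof (cases "I = \<infinity>")
    case True
    obtain u where u: "u \<in> admissible" using admissible_nonempty by blast
    then have "I \<le> log_quotient p g \<gamma> u" unfolding I_def by (rule INF_lower)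
    then show ?thesis using u True by (auto simp: top_unique)
  next
    case False
    then obtain \<iota> where \<iota>: "I = ennreal \<iota>" "\<iota> \<ge> 0" by (cases I) auto
    define Q where "Q u = energy p u * exp (- (LINT x|lebesgue. log_density u x) / \<gamma>)" for u
    have "\<exists>u\<in>admissible. log_quotient p g \<gamma> u < ennreal (\<iota> + inverse (real (Suc n)))" for n
    proof -
      have "I < ennreal (\<iota> + inverse (real (Suc n)))" unfolding \<iota>(1) using \<iota>(2)
        by (intro ennreal_lessI add_nonneg_pos) auto
      then show ?thesis unfolding I_def by (simp only: INF_less_iff)
    qed
    then obtain u where u: "\<And>n. u n \<in> admissible" "\<And>n. log_quotient p g \<gamma> (u n) < ennreal (\<iota> + inverse (real (Suc n)))"
      by metis
    have i: "integrable lebesgue (log_density (u n))" for n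
      using log_quotient_cases(2)[OF u(1)] u(2)[of n] by (cases "integrable lebesgue (log_density (u n))") auto
    have lq: "log_quotient p g \<gamma> (u n) = ennreal (Q (u n))" for n
      unfolding Q_def by (rule log_quotient_cases(1)[OF u(1) i])
    have Qnn: "Q w \<ge> 0" for w by (simp add: Q_def energy_def)
    have Qup: "Q (u n) \<le> \<iota> + inverse (real (Suc n))" for n
      using u(2)[of n] unfolding lq using Qnn[of "u n"] by (simp add: ennreal_less_iff)
    have Qlo: "\<iota> \<le> Q (u n)" for n
    proof -
      have "I \<le> log_quotient p g \<gamma> (u n)" unfolding I_def by (rule INF_lower[OF u(1)])
      then show ?thesis unfolding lq \<iota>(1) using Qnn by simp
    qed
    have Qlim: "(\<lambda>n. Q (u n)) \<longlonglongrightarrow> \<iota>"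
    proof (rule tendsto_sandwich[OF _ _ tendsto_const])
      show "(\<lambda>n. \<iota> + inverse (real (Suc n))) \<longlonglongrightarrow> \<iota>"
        using tendsto_add[OF tendsto_const[of \<iota>] LIMSEQ_inverse_real_of_nat] by simp
      show "\<forall>\<^sub>F n in sequentially. Q (u n) \<le> \<iota> + inverse (real (Suc n))" using Qup by (intro always_eventually allI)
      show "\<forall>\<^sub>F n in sequentially. \<iota> \<le> Q (u n)" using Qlo by (intro always_eventually allI)
    qed
    have Q1: "Q (u n) \<le> \<iota> + 1" for n
    proof -
      have "inverse (real (Suc n)) \<le> 1" by (simp add: field_simps)
      then show ?thesis using Qup[of n] by linarith
    qed
    obtain B where B: "\<And>n. energy p (u n) \<le> B"
      using coercive[of "\<iota> + 1"] \<iota>(2) u(1) i Q1 unfolding Q_def by (metis add_nonneg_pos zero_less_one)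
    obtain c0 where c0: "c0 > 0" "\<And>n. c0 \<le> energy p (u n)" using energy_lower_bound u(1) by blast
    define L where "L n = (LINT x|lebesgue. log_density (u n) x)" for n
    obtain C where C: "C \<ge> 0" "\<And>n. L n \<le> r / (r - p) * ln (energy p (u n)) + C"
      using log_upper_bound u(1) i unfolding L_def by blast
    have Lup: "L n \<le> r / (r - p) * ln B + C" for n
    proof -
      have "ln (energy p (u n)) \<le> ln B" using c0 B[of n] less_le_trans[OF c0(1) c0(2)[of n]] by (intro ln_mono) auto
      then have "r / (r - p) * ln (energy p (u n)) \<le> r / (r - p) * ln B" using p by (intro mult_left_mono) auto
      then show ?thesis using C(2)[of n] by linarith
    qed
    \<comment> \<open>The quotients are bounded above and the energies bounded below, which bounds the logarithmic integrals from below.\<close>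
    have Llo: "- \<gamma> * ln ((\<iota> + 1) / c0) \<le> L n" for n
    proof -
      have "c0 * exp (- L n / \<gamma>) \<le> Q (u n)" unfolding Q_def L_def using c0(2) by (intro mult_right_mono) auto
      also have "\<dots> \<le> \<iota> + 1" by (rule Q1)
      finally have "exp (- L n / \<gamma>) \<le> (\<iota> + 1) / c0" using c0(1) by (simp add: field_simps)
      then have "- L n / \<gamma> \<le> ln ((\<iota> + 1) / c0)" using c0(1) \<iota>(2) by (subst ln_ge_iff) auto
      then have "- L n \<le> \<gamma> * ln ((\<iota> + 1) / c0)" using gamma_pos by (simp add: field_simps)
      then show ?thesis by simp
    qed
    have "bounded (range (\<lambda>n. (energy p (u n), L n)))"
    proof (rule bounded_subset)
      show "bounded ({c0..B} \<times> {- \<gamma> * ln ((\<iota> + 1) / c0)..r / (r - p) * ln B + C})"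
        by (intro bounded_Times bounded_closed_interval)
    qed (use c0 B Lup Llo in auto)
    \<comment> \<open>Energies and logarithmic integrals converge along one common subsequence.\<close>
    from bounded_imp_convergent_subsequence[OF this]
    obtain z s where s: "strict_mono s" and z: "((\<lambda>n. (energy p (u n), L n)) \<circ> s) \<longlonglongrightarrow> z" by blast
    have el: "(\<lambda>n. energy p (u (s n))) \<longlonglongrightarrow> fst z" "(\<lambda>n. L (s n)) \<longlonglongrightarrow> snd z"
      using tendsto_fst[OF z] tendsto_snd[OF z] by (simp_all add: o_def)
    have ub: "u n \<in> beppo_levi p" for n using u(1) by (simp add: admissible_def)
    obtain v s' where v: "strict_mono s'" "v \<in> beppo_levi p"
      "AE x in lebesgue. (\<lambda>n. u (s (s' n)) x) \<longlonglongrightarrow> v x" "energy p v \<le> fst z"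
      by (rule beppo_levi_compact[OF p(1,2) ub el(1)])
    have "fst z \<le> B" using el(1) B by (intro LIMSEQ_le_const2) auto
    then have vB: "energy p v \<le> B" using v(4) by simp
    have va: "v \<in> admissible" by (rule weighted_mass_limit[OF u(1) B v(2) vB v(3)])
    have "(\<lambda>n. L (s (s' n))) \<longlonglongrightarrow> snd z" using LIMSEQ_subseq_LIMSEQ[OF el(2) v(1)] by (simp add: o_def)
    note lim = log_integral_limit[OF u(1) i B this[unfolded L_def] va v(3)]
    have "(\<lambda>n. Q (u (s n))) \<longlonglongrightarrow> fst z * exp (- snd z / \<gamma>)"
      unfolding Q_def L_def[symmetric] using gamma_pos by (intro tendsto_intros el) auto
    moreover have "(\<lambda>n. Q (u (s n))) \<longlonglongrightarrow> \<iota>" using LIMSEQ_subseq_LIMSEQ[OF Qlim s] by (simp add: o_def)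
    ultimately have eq: "fst z * exp (- snd z / \<gamma>) = \<iota>" by (rule LIMSEQ_unique)
    have "Q v \<le> fst z * exp (- snd z / \<gamma>)" unfolding Q_def
      using v(4) lim(2) gamma_pos by (intro mult_mono) (auto simp: divide_right_mono energy_def intro: order_trans[rotated])
    then have "log_quotient p g \<gamma> v \<le> I"
      using log_quotient_cases(1)[OF va lim(1)] unfolding eq \<iota>(1) Q_def by (simp add: ennreal_leI)
    moreover have "I \<le> log_quotient p g \<gamma> v" unfolding I_def by (rule INF_lower[OF va])
    ultimately show ?thesis using va by (auto intro: antisym)
  qed
  then show ?thesis unfolding I by (auto simp: admissible_def)
qed

end

theorem theorem1p2:
  fixes g :: "real ^ 'n \<Rightarrow> real" and p r \<gamma> pstar :: real
  assumes "CARD('n) \<ge> 3"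
    and "1 < p" and "p < real CARD('n)"
    and "pstar = real CARD('n) * p / (real CARD('n) - p)"
    and "p < r" and "r \<le> pstar"
    and "g \<in> H_space p r \<inter> F_space p p"
    and "\<not> (AE x in lebesgue. g x = 0)"
    and "\<gamma> > r / (r - p)"
  shows "\<exists>u \<in> beppo_levi p.
           (LINT x|lebesgue. \<bar>g x\<bar> * \<bar>u x\<bar> powr p) = 1 \<and>
           log_quotient p g \<gamma> u = 1 / C_B p g \<gamma>"
proof -
  interpret log_sobolev_weight g p r \<gamma>
    using assms by unfold_locales simp_all
  show ?thesis by (rule best_constant_attained)
qed

end
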